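(* Let $d$ be a positive integer and let $\chi_1(t)=|t|^{s_1}\mathrm{sgn}(t)^{m_1}$, $\chi_2(t)=|t|^{s_2}\mathrm{sgn}(t)^{m_2}$ be characters of $\mathbb{R}^*$ with $s_1,s_2\in\mathbb{C}$, $m_1,m_2\in\{0,1\}$, such that $|t|^{s_1-s_2}\mathrm{sgn}(t)^{m_1-m_2}=t^d\,\mathrm{sgn}(t)$ for all $t\in\mathbb{R}^*$. Then the smooth space (space of smooth vectors) of the representation $R_{\chi_1,\chi_2}$ of $GL(2,\mathbb{R})$ on $L^2(\mathbb{R},dx/|x|)$ is the space $\mathcal{K}_d$ of smooth functions $f:\mathbb{R}\setminus\{0\}\to\mathbb{C}$ such that $f$ and all its derivatives are rapidly decreasing at $\pm\infty$ and such that $g(x)=|x|^{-(d+1)/2}f(x)$ is smooth on the right and on the left at $x=0$.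
   Context: "Smooth on the right and on the left at $0$" means that $g|_{(0,\infty)}$ extends to a smooth function on $[0,\infty)$ and $g|_{(-\infty,0)}$ extends to a smooth function on $(-\infty,0]$ (the two extensions need not match at $0$). Put $\omega(b)=|b|^{s_1+s_2+1}\mathrm{sgn}(b)^{m_1+m_2}$ for $b\in\mathbb{R}^*$. The representation $R=R_{\chi_1,\chi_2}$ of $GL(2,\mathbb{R})$ on $L^2(\mathbb{R},dx/|x|)$ is given by the formulas $\left(R\begin{pmatrix}1&y\\0&1\end{pmatrix}f\right)(x)=e^{iyx}f(x)$ for $y\in\mathbb{R}$; $\left(R\begin{pmatrix}a&0\\0&1\end{pmatrix}f\right)(x)=|a|^{(s_1+s_2+1)/2}f(ax)=\omega(|a|^{1/2})f(ax)$ for $a\in\mathbb{R}^*$; $\left(R\begin{pmatrix}b&0\\0&b\end{pmatrix}f\right)(x)=\omega(b)f(x)$ for $b\in\mathbb{R}^*$; and $$\left(R\begin{pmatrix}0&-1\\1&0\end{pmatrix}f\right)(y)=\mathrm{sgn}(y)^{m_2+d+1}\int_{-\infty}^{\infty}f(x)j_d(xy)\frac{dx}{|x|},$$ where $j_d(x)=i^{-(d+1)}\sqrt{x}\,J_d(2\sqrt{x})$ for $x>0$, $j_d(x)=0$ for $x<0$, and $J_d$ is the classical $J$-Bessel function of order $d$; the integral is defined as the $L^2$ extension of a unitary operator on the space $\mathcal{K}_d$. A vector $v$ is smooth if $g\mapsto R(g)v$ is a smooth map from $GL(2,\mathbb{R})$ to the Hilbert space.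
   Formalization: For m_2=1 the sign sgn(y)^{m_2+d+1} in the formula for R of the matrix (0,-1;1,0) is inconsistent with the other formulas, so no such representation exists; the formal statement also allows the consistent sign sgn(y)^{d+1}, which agrees with the given one for m_2=0. *)

theory Defs
  imports "HOL-Analysis.Analysis"
begin

section \<open>The Hilbert space \<open>L\<^sup>2(\<real>, dx/|x|)\<close>\<close>

definition mult_haar :: "real measure" where
  "mult_haar = density lborel (\<lambda>x. ennreal (1 / \<bar>x\<bar>))"

definition square_integrable :: "(real \<Rightarrow> complex) \<Rightarrow> bool" where
  "square_integrable f \<longleftrightarrow>
     f \<in> borel_measurable borel \<and> integrable mult_haar (\<lambda>x. (cmod (f x))\<^sup>2)"

definition l2_rel :: "(real \<Rightarrow> complex) \<Rightarrow> (real \<Rightarrow> complex) \<Rightarrow> bool" where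
  "l2_rel f g \<longleftrightarrow> square_integrable f \<and> square_integrable g \<and> (AE x in mult_haar. f x = g x)"

lemma measurable_mult_haar [simp]: "borel_measurable mult_haar = borel_measurable borel"
  unfolding mult_haar_def by (simp add: measurable_density_eq2 cong: measurable_cong_sets)

lemma square_integrable_zero: "square_integrable (\<lambda>x. 0)"
  by (simp add: square_integrable_def)

lemma square_integrable_scale:
  assumes "square_integrable f" shows "square_integrable (\<lambda>x. c * f x)"
  using assms by (auto simp: square_integrable_def norm_mult power_mult_distrib)

lemma square_integrable_add:
  assumes f: "square_integrable f" and g: "square_integrable g"
  shows "square_integrable (\<lambda>x. f x + g x)"
proof -
  have mf: "f \<in> borel_measurable borel" and mg: "g \<in> borel_measurable borel"
    using f g by (auto simp: square_integrable_def)
  have "integrable mult_haar (\<lambda>x. 2 * (cmod (f x))\<^sup>2 + 2 * (cmod (g x))\<^sup>2)"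
    using f g by (auto simp: square_integrable_def)
  moreover have "(cmod (f x + g x))\<^sup>2 \<le> 2 * (cmod (f x))\<^sup>2 + 2 * (cmod (g x))\<^sup>2" for x
  proof -
    have "(cmod (f x + g x))\<^sup>2 \<le> (cmod (f x) + cmod (g x))\<^sup>2"
      by (intro power_mono norm_triangle_ineq) auto
    also have "\<dots> \<le> 2 * (cmod (f x))\<^sup>2 + 2 * (cmod (g x))\<^sup>2"
      using sum_squares_bound[of "cmod (f x)" "cmod (g x)"] by (simp add: power2_sum)
    finally show ?thesis .
  qed
  ultimately have "integrable mult_haar (\<lambda>x. (cmod (f x + g x))\<^sup>2)"
    by (elim Bochner_Integration.integrable_bound) (use mf mg in auto)
  then show ?thesis using mf mg by (simp add: square_integrable_def)
qed

lemma integrable_mult_cnj: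
  assumes f: "square_integrable f" and g: "square_integrable g"
  shows "integrable mult_haar (\<lambda>x. f x * cnj (g x))"
proof -
  have mf: "f \<in> borel_measurable borel" and mg: "g \<in> borel_measurable borel"
    using f g by (auto simp: square_integrable_def)
  have "integrable mult_haar (\<lambda>x. (cmod (f x))\<^sup>2 + (cmod (g x))\<^sup>2)"
    using f g by (auto simp: square_integrable_def)
  moreover have "cmod (f x * cnj (g x)) \<le> (cmod (f x))\<^sup>2 + (cmod (g x))\<^sup>2" for x
  proof -
    have "2 * (cmod (f x) * cmod (g x)) \<le> (cmod (f x))\<^sup>2 + (cmod (g x))\<^sup>2"
      using sum_squares_bound[of "cmod (f x)" "cmod (g x)"] by simp
    moreover have "0 \<le> cmod (f x) * cmod (g x)" by simp
    ultimately show ?thesis unfolding norm_mult complex_mod_cnj by linarith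
  qed
  moreover have "(\<lambda>x. cnj (g x)) \<in> borel_measurable borel"
    using mg by (intro borel_measurable_continuous_on[OF _ mg] continuous_intros)
  ultimately show ?thesis
    using mf by (elim Bochner_Integration.integrable_bound) auto
qed

quotient_type l2 = "real \<Rightarrow> complex" / partial: l2_rel
proof (rule part_equivpI)
  show "\<exists>f. l2_rel f f"
    by (rule exI[of _ "\<lambda>x. 0"]) (simp add: l2_rel_def square_integrable_zero)
  show "symp l2_rel"
    by (rule sympI) (auto simp: l2_rel_def elim: AE_mp)
  show "transp l2_rel"
    by (rule transpI) (auto simp: l2_rel_def)
qed

instantiation l2 :: real_vector
begin

lift_definition zero_l2 :: l2 is "\<lambda>x. 0"
  by (simp add: l2_rel_def square_integrable_zero)

lift_definition plus_l2 :: "l2 \<Rightarrow> l2 \<Rightarrow> l2" is "\<lambda>f g x. f x + g x"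
  by (auto simp: l2_rel_def square_integrable_add)

lift_definition uminus_l2 :: "l2 \<Rightarrow> l2" is "\<lambda>f x. - f x"
  using square_integrable_scale[where c = "-1"] by (auto simp: l2_rel_def)

definition minus_l2 :: "l2 \<Rightarrow> l2 \<Rightarrow> l2" where "minus_l2 u v = u + - v"

lift_definition scaleR_l2 :: "real \<Rightarrow> l2 \<Rightarrow> l2" is "\<lambda>r f x. of_real r * f x"
  by (auto simp: l2_rel_def square_integrable_scale)

instance
proof
  fix u v w :: l2 and r s :: real
  show "u + v + w = u + (v + w)"
    by transfer (auto simp: l2_rel_def square_integrable_add add.assoc)
  show "u + v = v + u"
    by transfer (auto simp: l2_rel_def square_integrable_add add.commute)
  show "0 + u = u" by transfer (auto simp: l2_rel_def)
  show "- u + u = 0"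
    by transfer (auto simp: l2_rel_def square_integrable_zero)
  show "u - v = u + - v" by (simp add: minus_l2_def)
  show "r *\<^sub>R (u + v) = r *\<^sub>R u + r *\<^sub>R v"
    by transfer (auto simp: l2_rel_def distrib_left square_integrable_add square_integrable_scale)
  show "(r + s) *\<^sub>R u = r *\<^sub>R u + s *\<^sub>R u"
    by transfer (auto simp: l2_rel_def distrib_right square_integrable_add square_integrable_scale)
  show "r *\<^sub>R s *\<^sub>R u = (r * s) *\<^sub>R u"
    by transfer (auto simp: l2_rel_def mult.assoc square_integrable_scale)
  show "1 *\<^sub>R u = u" by transfer (auto simp: l2_rel_def)
qed

end

instantiation l2 :: real_inner
begin

text \<open>The real part of the Hermitian product: it gives the usual \<open>L\<^sup>2\<close> norm.\<close>

lift_definition inner_l2 :: "l2 \<Rightarrow> l2 \<Rightarrow> real"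
  is "\<lambda>f g. Re (\<integral>x. f x * cnj (g x) \<partial>mult_haar)"
proof -
  fix f f' g g'
  assume *: "l2_rel f f'" "l2_rel g g'"
  have "(\<integral>x. f x * cnj (g x) \<partial>mult_haar) = (\<integral>x. f' x * cnj (g' x) \<partial>mult_haar)"
    using * borel_measurable_integrable[OF integrable_mult_cnj]
    by (intro integral_cong_AE) (auto simp: l2_rel_def)
  then show "Re (\<integral>x. f x * cnj (g x) \<partial>mult_haar) = Re (\<integral>x. f' x * cnj (g' x) \<partial>mult_haar)"
    by simp
qed

definition norm_l2 :: "l2 \<Rightarrow> real" where "norm_l2 v = sqrt (inner v v)"
definition sgn_l2 :: "l2 \<Rightarrow> l2" where "sgn_l2 v = v /\<^sub>R norm v"
definition dist_l2 :: "l2 \<Rightarrow> l2 \<Rightarrow> real" where "dist_l2 u v = norm (u - v)"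
definition uniformity_l2 :: "(l2 \<times> l2) filter" where
  "uniformity_l2 = (INF e\<in>{0<..}. principal {(u, v). dist u v < e})"
definition open_l2 :: "l2 set \<Rightarrow> bool" where
  "open_l2 U \<longleftrightarrow> (\<forall>u\<in>U. \<forall>\<^sub>F (u', v) in uniformity. u' = u \<longrightarrow> v \<in> U)"

instance
proof
  fix u v w :: l2 and r :: real and U :: "l2 set"
  show "sgn u = u /\<^sub>R norm u" by (rule sgn_l2_def)
  show "dist u v = norm (u - v)" by (rule dist_l2_def)
  show "uniformity = (INF e\<in>{0<..}. principal {(u :: l2, v). dist u v < e})"
    by (rule uniformity_l2_def)
  show "open U \<longleftrightarrow> (\<forall>u\<in>U. \<forall>\<^sub>F (u', v) in uniformity. u' = u \<longrightarrow> v \<in> U)"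
    by (rule open_l2_def)
  show "inner u v = inner v u"
  proof transfer
    fix f g :: "real \<Rightarrow> complex"
    have "(\<integral>x. g x * cnj (f x) \<partial>mult_haar) = (\<integral>x. cnj (f x * cnj (g x)) \<partial>mult_haar)"
      by (simp only: complex_cnj_mult complex_cnj_cnj mult.commute)
    then have "(\<integral>x. g x * cnj (f x) \<partial>mult_haar) = cnj (\<integral>x. f x * cnj (g x) \<partial>mult_haar)"
      by (simp only: Bochner_Integration.integral_cnj)
    then show "Re (\<integral>x. f x * cnj (g x) \<partial>mult_haar) = Re (\<integral>x. g x * cnj (f x) \<partial>mult_haar)"
      by simp
  qed
  show "inner (u + v) w = inner u w + inner v w"
    by transfer (auto simp: l2_rel_def distrib_right integrable_mult_cnj)
  show "inner (r *\<^sub>R u) v = r * inner u v"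
    by transfer (simp add: mult.assoc)
  have sq: "f x * cnj (f x) = of_real ((cmod (f x))\<^sup>2)" for f :: "real \<Rightarrow> complex" and x
    by (simp only: complex_norm_square)
  show "0 \<le> inner u u"
    by transfer (simp add: sq del: of_real_power)
  show "inner u u = 0 \<longleftrightarrow> u = 0"
  proof transfer
    fix f assume "l2_rel f f"
    then have f: "square_integrable f" by (simp add: l2_rel_def)
    then have "Re (\<integral>x. f x * cnj (f x) \<partial>mult_haar) = 0
        \<longleftrightarrow> (AE x in mult_haar. (cmod (f x))\<^sup>2 = 0)"
      by (simp add: sq square_integrable_def integral_nonneg_eq_0_iff_AE del: of_real_power)
    then show "Re (\<integral>x. f x * cnj (f x) \<partial>mult_haar) = 0 \<longleftrightarrow> l2_rel f (\<lambda>x. 0)"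
      using f by (simp add: l2_rel_def square_integrable_zero)
  qed
  show "norm u = sqrt (inner u u)" by (rule norm_l2_def)
qed

end

lift_definition scaleC_l2 :: "complex \<Rightarrow> l2 \<Rightarrow> l2" is "\<lambda>c f x. c * f x"
  by (auto simp: l2_rel_def square_integrable_scale)

lift_definition represents :: "(real \<Rightarrow> complex) \<Rightarrow> l2 \<Rightarrow> bool"
  is "\<lambda>f h. square_integrable f \<and> (AE x in mult_haar. f x = h x)"
  by (auto simp: l2_rel_def)


section \<open>Smooth maps\<close>

text \<open>Used for open \<open>S\<close> and for closed half-lines. In both cases the derivative within \<open>S\<close>
  is unique, and it is one-sided at the end point of a half-line.\<close>

primrec Ck_on :: "nat \<Rightarrow> 'a::real_normed_vector set \<Rightarrow> ('a \<Rightarrow> 'b::real_normed_vector) \<Rightarrow> bool" where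
  "Ck_on 0 S f \<longleftrightarrow> continuous_on S f"
| "Ck_on (Suc k) S f \<longleftrightarrow> f differentiable_on S \<and>
     (\<forall>v. Ck_on k S (\<lambda>x. frechet_derivative f (at x within S) v))"

definition smooth_on :: "'a::real_normed_vector set \<Rightarrow> ('a \<Rightarrow> 'b::real_normed_vector) \<Rightarrow> bool" where
  "smooth_on S f \<longleftrightarrow> (\<forall>k. Ck_on k S f)"


section \<open>The space \<open>\<K>\<^sub>d\<close>\<close>

definition nth_derivative :: "nat \<Rightarrow> (real \<Rightarrow> complex) \<Rightarrow> real \<Rightarrow> complex" where
  "nth_derivative n f = ((\<lambda>h x. vector_derivative h (at x)) ^^ n) f"

definition rapidly_decreasing :: "(real \<Rightarrow> complex) \<Rightarrow> bool" where
  "rapidly_decreasing f \<longleftrightarrow>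
     (\<forall>N::nat. ((\<lambda>x. x ^ N *\<^sub>R f x) \<longlongrightarrow> 0) at_top \<and> ((\<lambda>x. x ^ N *\<^sub>R f x) \<longlongrightarrow> 0) at_bot)"

definition smooth_right_at_0 :: "(real \<Rightarrow> complex) \<Rightarrow> bool" where
  "smooth_right_at_0 g \<longleftrightarrow> (\<exists>h. smooth_on {0..} h \<and> (\<forall>x>0. h x = g x))"

definition smooth_left_at_0 :: "(real \<Rightarrow> complex) \<Rightarrow> bool" where
  "smooth_left_at_0 g \<longleftrightarrow> (\<exists>h. smooth_on {..0} h \<and> (\<forall>x<0. h x = g x))"

text \<open>Functions on \<open>\<real> - {0}\<close> are total functions here, with an irrelevant value at \<open>0\<close>.\<close>

definition kirillov_space :: "nat \<Rightarrow> (real \<Rightarrow> complex) set" where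
  "kirillov_space d = {f. smooth_on (- {0}) f
     \<and> (\<forall>n. rapidly_decreasing (nth_derivative n f))
     \<and> smooth_right_at_0 (\<lambda>x. of_real (\<bar>x\<bar> powr (- (real d + 1) / 2)) * f x)
     \<and> smooth_left_at_0 (\<lambda>x. of_real (\<bar>x\<bar> powr (- (real d + 1) / 2)) * f x)}"


section \<open>The representation\<close>

definition quasichar :: "complex \<Rightarrow> int \<Rightarrow> real \<Rightarrow> complex" where
  "quasichar s m t = of_real \<bar>t\<bar> powr s * of_real (sgn t) powi m"

definition bessel_J :: "nat \<Rightarrow> real \<Rightarrow> real" where
  "bessel_J d z = (\<Sum>k. (-1) ^ k / (fact k * fact (k + d)) * (z / 2) ^ (2 * k + d))"

definition bessel_kernel :: "nat \<Rightarrow> real \<Rightarrow> complex" where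
  "bessel_kernel d x =
     (if x > 0 then \<i> powi (- (int d + 1)) * of_real (sqrt x * bessel_J d (2 * sqrt x)) else 0)"

definition mat2 :: "real \<Rightarrow> real \<Rightarrow> real \<Rightarrow> real \<Rightarrow> real^2^2" where
  "mat2 a b c d = vector [vector [a, b], vector [c, d]]"

definition GL2 :: "(real^2^2) set" where
  "GL2 = {g. invertible g}"

definition GL2_representation :: "(real^2^2 \<Rightarrow> l2 \<Rightarrow> l2) \<Rightarrow> bool" where
  "GL2_representation R \<longleftrightarrow>
     (\<forall>g\<in>GL2. bounded_linear (R g) \<and> (\<forall>c v. R g (scaleC_l2 c v) = scaleC_l2 c (R g v)))
   \<and> R (mat 1) = id
   \<and> (\<forall>g\<in>GL2. \<forall>h\<in>GL2. R (g ** h) = R g \<circ> R h)"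

definition unitary :: "(l2 \<Rightarrow> l2) \<Rightarrow> bool" where
  "unitary U \<longleftrightarrow> (\<forall>u v. U (u + v) = U u + U v) \<and> (\<forall>c v. U (scaleC_l2 c v) = scaleC_l2 c (U v))
     \<and> (\<forall>v. norm (U v) = norm v) \<and> surj U"

text \<open>\<open>kirillov_rep d s1 s2 m1 m2 \<epsilon> R\<close>: the representation \<open>R\<close> of \<open>GL(2,\<real>)\<close> is given by
  the Kirillov formulas, where \<open>\<epsilon>\<close> is the exponent of \<open>sgn y\<close> in the formula for
  \<open>w = mat2 0 (-1) 1 0\<close>. Upper triangular matrices and \<open>w\<close> generate the group, so there is
  at most one such \<open>R\<close>. The operator \<open>R w\<close> is the unitary extension of an integral operator on
  \<open>kirillov_space d\<close>; the integral itself need not converge for other vectors.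

  The formula in the source has \<open>\<epsilon> = m2 + d + 1\<close>. With
  \<open>\<delta> = mat2 (-1) 0 0 1\<close>, the relation \<open>w \<delta> = - \<delta> w\<close> and the value
  \<open>(-1)^(m1 + m2) = (-1)^(d + 1)\<close> of the central character at \<open>-1\<close> force
  \<open>\<epsilon> \<equiv> d + 1 (mod 2)\<close>. The source formula therefore gives a representation only if \<open>m2 = 0\<close>, while
  \<open>\<epsilon> = d + 1\<close> gives one for both values of \<open>m2\<close>. This is why \<open>\<epsilon>\<close> is a parameter.\<close>

definition kirillov_rep ::
  "nat \<Rightarrow> complex \<Rightarrow> complex \<Rightarrow> int \<Rightarrow> int \<Rightarrow> int \<Rightarrow> (real^2^2 \<Rightarrow> l2 \<Rightarrow> l2) \<Rightarrow> bool" where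
  "kirillov_rep d s1 s2 m1 m2 \<epsilon> R \<longleftrightarrow>
     GL2_representation R
   \<and> (\<forall>y f v. represents f v \<longrightarrow>
        represents (\<lambda>x. exp (\<i> * of_real (y * x)) * f x) (R (mat2 1 y 0 1) v))
   \<and> (\<forall>a f v. a \<noteq> 0 \<longrightarrow> represents f v \<longrightarrow>
        represents (\<lambda>x. of_real \<bar>a\<bar> powr ((s1 + s2 + 1) / 2) * f (a * x)) (R (mat2 a 0 0 1) v))
   \<and> (\<forall>b f v. b \<noteq> 0 \<longrightarrow> represents f v \<longrightarrow>
        represents (\<lambda>x. quasichar (s1 + s2 + 1) (m1 + m2) b * f x) (R (mat2 b 0 0 b) v))
   \<and> unitary (R (mat2 0 (-1) 1 0))
   \<and> (\<forall>f v. f \<in> kirillov_space d \<longrightarrow> represents f v \<longrightarrow>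
        represents (\<lambda>y. of_real (sgn y) powi \<epsilon> * (\<integral>x. f x * bessel_kernel d (x * y) \<partial>mult_haar))
          (R (mat2 0 (-1) 1 0) v))"

definition smooth_vectors :: "(real^2^2 \<Rightarrow> l2 \<Rightarrow> l2) \<Rightarrow> l2 set" where
  "smooth_vectors R = {v. smooth_on GL2 (\<lambda>g. R g v)}"

end

theory Submission
  imports Defs
begin

text \<open>
  For \<open>d > 0\<close> the elements of K are the functions \<open>|x|^((d+1)/2) g(x)\<close> with \<open>g\<close> a Schwartz
  function on each closed half-line. In terms of \<open>g\<close> the operator \<open>R w\<close> is the transform with kernel
  \<open>x^d B_d(xy)\<close>, where \<open>J_d(2 sqrt z) = z^(d/2) B_d(z)\<close>. Since \<open>B_m' = - B_(m+1)\<close>, every \<open>B_m\<close> is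
  bounded on the half-line, and \<open>z B_(m+2) = (m + 1) B_(m+1) - B_m\<close>, this transform preserves Schwartz
  functions, so \<open>R w\<close> preserves K.

  Elements of K are smooth: their orbit maps along the upper unipotent, diagonal and (by conjugation
  with \<open>w\<close>) lower unipotent subgroups are differentiable with derivatives in K. By the Gauss
  decomposition near 1 the full orbit map is differentiable, and its derivatives are combinations of
  orbit maps of elements of K with regular functions as coefficients.

  Conversely, the smooth vectors are stable under the Lie algebra and under \<open>w\<close>. The dilations show
  that a smooth vector has a representative \<open>f\<close> that is smooth off 0, and \<open>f\<close> is bounded because
  \<open>f\<close> and \<open>x f'\<close> are square integrable. The upper unipotent subgroup allows multiplication
  by \<open>x\<close>, which gives rapid decrease. The integral formula for \<open>R w\<close> therefore extends to smooth
  vectors, and as \<open>v\<close> is a multiple of \<open>R w (R w v)\<close>, it is \<open>|x|^((d+1)/2)\<close> times a function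
  that is smooth up to 0 on both sides.
\<close>

section \<open>Bessel functions\<close>

text \<open>Dilations control a vector only through \<open>x d/dx\<close>, which degenerates at 0,
  so smoothness at 0 cannot be read off from the diagonal subgroup. It comes from infinity:
  \<open>w\<close> exchanges the two ends, and decay of \<open>R w v\<close> makes its transform
  smooth up to 0. The obstacle is that the integral formula for \<open>R w\<close> is given on K
  only; elsewhere \<open>R w\<close> is a limit in norm. Boundedness and rapid decrease are
  therefore proved before the transform is used: they supply the dominating function that carries
  the formula over. For \<open>d > 0\<close> the weight \<open>|x|^((d+1)/2)\<close> contains a full
  factor \<open>x\<close>, which cancels the \<open>1 / x\<close> of the measure and gives K the
  majorant \<open>|x| / (1 + x^2)\<close>.

  In the other direction the operators depend only strongly continuously on the group element, so a
  product of them cannot be differentiated by the usual product rule; each partial product must have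
  its derivative in K again. Gauss coordinates are used at 1 alone, and \<open>R g\<close> moves the
  derivative from 1 to \<open>g\<close>; this brings in the entries of the inverse matrix as
  coefficients.\<close>

definition bes :: "nat \<Rightarrow> real \<Rightarrow> real" where
  "bes m z = (\<Sum>k. (-1) ^ k / (fact k * fact (k + m)) * z ^ k)"

lemma summable_bes: "summable (\<lambda>k. (-1) ^ k / (fact k * fact (k + m)) * (z::real) ^ k)"
proof (rule summable_comparison_test')
  show "summable (\<lambda>k. \<bar>z\<bar> ^ k /\<^sub>R fact k)"
    by (rule summable_exp_generic)
  fix k :: nat
  have "inverse (fact k * fact (k + m)) \<le> inverse (fact k * (1::real))"
    by (intro le_imp_inverse_le mult_left_mono) auto
  then have "inverse (fact k * fact (k + m)) * \<bar>z\<bar> ^ k \<le> inverse (fact k * (1::real)) * \<bar>z\<bar> ^ k"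
    by (rule mult_right_mono) simp
  then show "norm ((-1) ^ k / (fact k * fact (k + m)) * z ^ k) \<le> \<bar>z\<bar> ^ k /\<^sub>R fact k"
    by (simp add: abs_mult power_abs divide_inverse)
qed

lemma bes_zero: "bes m 0 = 1 / fact m"
  unfolding bes_def by (subst powser_zero) simp

lemma bes_has_real_derivative:
  "(bes m has_real_derivative - bes (Suc m) z) (at z)"
proof -
  let ?c = "\<lambda>k. (-1) ^ k / (fact k * fact (k + m)) :: real"
  have "((\<lambda>z. \<Sum>k. ?c k * z ^ k) has_real_derivative (\<Sum>k. diffs ?c k * z ^ k)) (at z)"
    by (rule termdiffs_strong'[of "\<bar>z\<bar> + 1"]) (use summable_bes in auto)
  moreover have "diffs ?c k * z ^ k = - ((-1) ^ k / (fact k * fact (k + Suc m)) * z ^ k)" for k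
  proof -
    have "fact (Suc k) * fact (Suc k + m) = real (Suc k) * (fact k * fact (k + Suc m) :: real)"
      by (simp del: of_nat_Suc)
    then show ?thesis
      unfolding diffs_def by (simp del: of_nat_Suc fact_Suc)
  qed
  ultimately have "((\<lambda>z. \<Sum>k. ?c k * z ^ k) has_real_derivative
      (\<Sum>k. - ((-1) ^ k / (fact k * fact (k + Suc m)) * z ^ k))) (at z)"
    by (simp only:)
  then show ?thesis
    unfolding bes_def[abs_def] suminf_minus[OF summable_bes] .
qed

text \<open>With \<open>B' = - B_(m+1)\<close> this is Bessel's equation
  \<open>z B'' + (m + 1) B' + B = 0\<close> for \<open>B = B_m\<close>. It holds coefficient by
  coefficient after an index shift.\<close>

lemma bes_recurrence:
  "z * bes (Suc (Suc m)) z = real (Suc m) * bes (Suc m) z - bes m z"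
proof -
  define a where "a m k = (-1) ^ k / (fact k * fact (k + m)) * z ^ k" for m k
  have bes: "bes m z = (\<Sum>k. a m k)" and a: "summable (a m)" for m
    using summable_bes[of m z] by (simp_all add: bes_def a_def[abs_def])
  have "z * bes (Suc (Suc m)) z = (\<Sum>k. z * a (Suc (Suc m)) k)"
    unfolding bes by (rule suminf_mult[symmetric, OF a])
  also have "(\<lambda>k. z * a (Suc (Suc m)) k) = (\<lambda>k. real (Suc m) * a (Suc m) (Suc k) - a m (Suc k))"
  proof
    fix k
    define F :: real where "F = fact (Suc k + Suc m)"
    have "F = real (Suc k + Suc m) * fact (Suc k + m)"
      unfolding F_def by (metis add_Suc_right fact_Suc)
    then have "a m (Suc k) = a (Suc m) (Suc k) * real (Suc k + Suc m)"
      unfolding a_def F_def[symmetric] by (simp del: of_nat_Suc of_nat_add fact_Suc)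
    then have "real (Suc m) * a (Suc m) (Suc k) - a m (Suc k)
        = a (Suc m) (Suc k) * (real (Suc m) - real (Suc k + Suc m))"
      by (simp only: right_diff_distrib mult.commute[of "real (Suc m)"])
    also have "\<dots> = - (real (Suc k) * a (Suc m) (Suc k))"
      by (simp add: algebra_simps)
    also have "\<dots> = z * a (Suc (Suc m)) k"
    proof -
      have *: "k + Suc (Suc m) = Suc k + Suc m" by simp
      show ?thesis
        unfolding a_def * F_def[symmetric] fact_Suc[of k] by (simp del: of_nat_Suc)
    qed
    finally show "z * a (Suc (Suc m)) k = real (Suc m) * a (Suc m) (Suc k) - a m (Suc k)" ..
  qed
  \<comment> \<open>The shift loses nothing: the term at index 0 vanishes, as
    \<open>Suc m / fact (Suc m) = 1 / fact m\<close>.\<close>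
  also have "suminf \<dots> = (\<Sum>k. real (Suc m) * a (Suc m) k - a m k)"
  proof -
    have "summable (\<lambda>k. real (Suc m) * a (Suc m) k - a m k)"
      by (intro summable_diff summable_mult a)
    moreover have "real (Suc m) * a (Suc m) 0 - a m 0 = 0"
      by (simp add: a_def del: of_nat_Suc)
    ultimately show ?thesis
      using suminf_split_head[of "\<lambda>k. real (Suc m) * a (Suc m) k - a m k"] by simp
  qed
  also have "\<dots> = real (Suc m) * bes (Suc m) z - bes m z"
    unfolding bes suminf_mult[OF a, symmetric] by (intro suminf_diff[symmetric] summable_mult a)
  finally show ?thesis .
qed

text \<open>Along the Bessel equation the energy \<open>bes m\<^sup>2 + z bes (m+1)\<^sup>2\<close> has derivative
  \<open>-(2m+1) bes (m+1)\<^sup>2\<close>.\<close>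

lemma abs_bes_le_1:
  assumes "z \<ge> 0" shows "\<bar>bes m z\<bar> \<le> 1"
proof -
  define E where "E z = (bes m z)\<^sup>2 + z * (bes (Suc m) z)\<^sup>2" for z
  have "E z \<le> E 0"
  proof (rule DERIV_nonpos_imp_nonincreasing[OF assms])
    fix x :: real
    have "(E has_real_derivative
        2 * bes m x * - bes (Suc m) x
        + ((bes (Suc m) x)\<^sup>2 + x * (2 * bes (Suc m) x * - bes (Suc (Suc m)) x))) (at x)"
      unfolding E_def
      by (auto intro!: derivative_eq_intros bes_has_real_derivative simp: power2_eq_square)
    moreover have "2 * bes m x * - bes (Suc m) x
        + ((bes (Suc m) x)\<^sup>2 + x * (2 * bes (Suc m) x * - bes (Suc (Suc m)) x))
        = 2 * bes m x * - bes (Suc m) x + ((bes (Suc m) x)\<^sup>2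
          - 2 * bes (Suc m) x * (x * bes (Suc (Suc m)) x))"
      by (simp add: algebra_simps)
    moreover have "\<dots> = - (2 * real m + 1) * (bes (Suc m) x)\<^sup>2"
      unfolding bes_recurrence by (simp add: algebra_simps power2_eq_square)
    moreover have "- (2 * real m + 1) * (bes (Suc m) x)\<^sup>2 \<le> 0"
      by (intro mult_nonpos_nonneg) auto
    ultimately show "\<exists>y. (E has_real_derivative y) (at x) \<and> y \<le> 0"
      by metis
  qed
  moreover have "E 0 \<le> 1"
    using fact_ge_1[of m, where 'a = real] by (auto simp: E_def bes_zero power_le_one)
  moreover have "(bes m z)\<^sup>2 \<le> E z"
    using assms by (simp add: E_def)
  ultimately have "(bes m z)\<^sup>2 \<le> 1\<^sup>2" by simp
  then show ?thesis by (metis abs_le_square_iff abs_one)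
qed

lemma continuous_on_bes [continuous_intros]:
  "continuous_on A f \<Longrightarrow> continuous_on A (\<lambda>x. bes m (f x))"
  using DERIV_continuous_on[OF bes_has_real_derivative[THEN has_field_derivative_at_within], of UNIV m]
  by (rule continuous_on_compose2) auto

lemma borel_measurable_bes [measurable]: "bes m \<in> borel_measurable borel"
  by (intro borel_measurable_continuous_onI continuous_intros)

lemma bessel_kernel_eq:
  assumes "x > 0"
  shows "bessel_kernel d x = \<i> powi (- (int d + 1)) * of_real (sqrt x ^ (d + 1) * bes d x)"
proof -
  have "(2 * sqrt x / 2) ^ (2 * k + d) = x ^ k * sqrt x ^ d" for k
    using assms by (simp add: power_add power_mult)
  then have "bessel_J d (2 * sqrt x) = (\<Sum>k. (-1) ^ k / (fact k * fact (k + d)) * x ^ k * sqrt x ^ d)"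
    by (simp add: bessel_J_def mult.assoc)
  also have "\<dots> = bes d x * sqrt x ^ d"
    unfolding bes_def by (rule suminf_mult2[symmetric, OF summable_bes])
  finally show ?thesis using assms by (simp add: bessel_kernel_def)
qed

section \<open>Chains of derivatives\<close>

text \<open>An infinite chain of derivatives, each of which satisfies \<open>P\<close>. Coinduction
  then asks only for a class of functions closed under differentiation, without a formula for the
  n-th derivative, and growth conditions travel along the chain.\<close>

coinductive smooth_with :: "real set \<Rightarrow> ((real \<Rightarrow> complex) \<Rightarrow> bool) \<Rightarrow> (real \<Rightarrow> complex) \<Rightarrow> bool"
  for S P where
  smooth_withI: "P f \<Longrightarrow> (\<And>x. x \<in> S \<Longrightarrow> (f has_vector_derivative f' x) (at x within S)) \<Longrightarrow>
    smooth_with S P f' \<Longrightarrow> smooth_with S P f"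

text \<open>The product rule turns one function of an explicit family into a sum of several; closing
  under addition once and for all keeps the families themselves simple.\<close>

inductive_set sums_of :: "(real \<Rightarrow> complex) set \<Rightarrow> (real \<Rightarrow> complex) set" for B where
  base: "f \<in> B \<Longrightarrow> f \<in> sums_of B"
| add: "f \<in> sums_of B \<Longrightarrow> g \<in> sums_of B \<Longrightarrow> (\<lambda>x. f x + g x) \<in> sums_of B"

lemma sums_of_derivative:
  assumes "\<And>f. f \<in> B \<Longrightarrow> \<exists>f'\<in>sums_of B. \<forall>x\<in>S. (f has_vector_derivative f' x) (at x within S)"
    and "f \<in> sums_of B"
  shows "\<exists>f'\<in>sums_of B. \<forall>x\<in>S. (f has_vector_derivative f' x) (at x within S)"
  using assms(2)
proof induction
  case (base f)
  then show ?case by (rule assms(1))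
next
  case (add f g)
  then obtain f' g' where f': "f' \<in> sums_of B"
      "\<And>x. x \<in> S \<Longrightarrow> (f has_vector_derivative f' x) (at x within S)"
    and g': "g' \<in> sums_of B"
      "\<And>x. x \<in> S \<Longrightarrow> (g has_vector_derivative g' x) (at x within S)"
    by blast
  then show ?case
    by (intro bexI[of _ "\<lambda>x. f' x + g' x"] ballI has_vector_derivative_add sums_of.add)
qed

lemma sums_of_property:
  assumes "\<And>f. f \<in> B \<Longrightarrow> P f" "\<And>f g. P f \<Longrightarrow> P g \<Longrightarrow> P (\<lambda>x. f x + g x)" "f \<in> sums_of B"
  shows "P f"
  using assms(3) by induction (auto intro: assms(1,2))

text \<open>Coinduction up to addition: only the generators have to be differentiated, because sums
  are differentiated termwise.\<close>

lemma smooth_with_sums_of: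
  assumes B: "\<And>f. f \<in> B \<Longrightarrow> P f"
    "\<And>f. f \<in> B \<Longrightarrow> \<exists>f'\<in>sums_of B. \<forall>x\<in>S. (f has_vector_derivative f' x) (at x within S)"
    and P: "\<And>f g. P f \<Longrightarrow> P g \<Longrightarrow> P (\<lambda>x. f x + g x)"
    and f: "f \<in> sums_of B"
  shows "smooth_with S P f"
  using f
proof (coinduction arbitrary: f)
  case smooth_with
  then show ?case
    using sums_of_derivative[of B S, OF B(2) smooth_with] sums_of_property[of B P, OF B(1) P smooth_with]
    by blast
qed

lemma smooth_with_coclosed:
  assumes B: "\<And>f. f \<in> B \<Longrightarrow> P f"
    "\<And>f. f \<in> B \<Longrightarrow> \<exists>f'\<in>B. \<forall>x\<in>S. (f has_vector_derivative f' x) (at x within S)"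
    and f: "f \<in> B"
  shows "smooth_with S P f"
  using f by (coinduction arbitrary: f) (use B in blast)

lemma smooth_withD:
  assumes "smooth_with S P f"
  obtains f' where "P f" "smooth_with S P f'"
    "\<And>x. x \<in> S \<Longrightarrow> (f has_vector_derivative f' x) (at x within S)"
  using assms by (cases rule: smooth_with.cases) blast

lemma smooth_with_derivative:
  assumes "smooth_with S P f"
  shows "\<exists>f'\<in>Collect (smooth_with S P). \<forall>x\<in>S. (f has_vector_derivative f' x) (at x within S)"
  using assms by (rule smooth_withD) blast

lemma smooth_with_imp: "smooth_with S P f \<Longrightarrow> P f"
  by (erule smooth_withD)

lemma smooth_with_mono:
  assumes "smooth_with S P f" "\<And>f. P f \<Longrightarrow> Q f"
  shows "smooth_with S Q f"
proof (rule smooth_with_coclosed[where B = "Collect (smooth_with S P)"])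
  fix f assume "f \<in> Collect (smooth_with S P)"
  then show "Q f" "\<exists>f'\<in>Collect (smooth_with S P). \<forall>x\<in>S. (f has_vector_derivative f' x) (at x within S)"
    using smooth_with_imp[of S P f] smooth_with_derivative[of S P f] assms(2) by simp_all
qed (use assms in simp)

lemma smooth_with_continuous_on: "smooth_with S P f \<Longrightarrow> continuous_on S f"
  by (erule smooth_withD) (auto simp: continuous_on_eq_continuous_within intro: has_vector_derivative_continuous)

lemma smooth_with_add:
  assumes "smooth_with S P f" "smooth_with S P g"
    and "\<And>f g. P f \<Longrightarrow> P g \<Longrightarrow> P (\<lambda>x. f x + g x)"
  shows "smooth_with S P (\<lambda>x. f x + g x)"
proof (rule smooth_with_sums_of[where B = "Collect (smooth_with S P)"])
  fix f assume "f \<in> Collect (smooth_with S P)"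
  then show "\<exists>f'\<in>sums_of (Collect (smooth_with S P)).
      \<forall>x\<in>S. (f has_vector_derivative f' x) (at x within S)"
    using smooth_with_derivative[of S P f] sums_of.base[of _ "Collect (smooth_with S P)"] by blast
qed (use assms smooth_with_imp[of S P] in \<open>auto intro: sums_of.intros\<close>)

lemma smooth_with_mult_left:
  assumes "smooth_with S P f" and "\<And>f. P f \<Longrightarrow> P (\<lambda>x. c * f x)"
  shows "smooth_with S P (\<lambda>x. c * f x)"
proof (rule smooth_with_coclosed[where B = "{\<lambda>x. c * f x |f. smooth_with S P f}"])
  fix g assume "g \<in> {\<lambda>x. c * f x |f. smooth_with S P f}"
  then obtain f where g: "g = (\<lambda>x. c * f x)" and f: "smooth_with S P f" by blast
  show "P g" unfolding g using f by (intro assms(2) smooth_with_imp)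
  from f obtain f' where "smooth_with S P f'"
    "\<And>x. x \<in> S \<Longrightarrow> (f has_vector_derivative f' x) (at x within S)"
    by (rule smooth_withD) blast
  then show "\<exists>f'\<in>{\<lambda>x. c * f x |f. smooth_with S P f}.
      \<forall>x\<in>S. (g has_vector_derivative f' x) (at x within S)"
    unfolding g by (intro bexI[of _ "\<lambda>x. c * f' x"]) (auto intro: has_vector_derivative_mult_right)
qed (use assms in blast)

lemma smooth_with_times_x:
  assumes "smooth_with S P f" and P: "\<And>f. P f \<Longrightarrow> P (\<lambda>x. of_real x * f x)"
    "\<And>f g. P f \<Longrightarrow> P g \<Longrightarrow> P (\<lambda>x. f x + g x)"
  shows "smooth_with S P (\<lambda>x. of_real x * f x)"
proof -
  \<comment> \<open>The derivative \<open>x f' + f\<close> of \<open>x f\<close> leaves the family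
    \<open>?A\<close>, so the plain chains \<open>?B\<close> are generators too.\<close>
  let ?A = "{\<lambda>x. of_real x * f x |f. smooth_with S P f}" and ?B = "Collect (smooth_with S P)"
  show ?thesis
  proof (rule smooth_with_sums_of[where B = "?A \<union> ?B"])
    fix g assume g: "g \<in> ?A \<union> ?B"
    then show "P g" using P smooth_with_imp[of S P] by auto
    from g show "\<exists>g'\<in>sums_of (?A \<union> ?B). \<forall>x\<in>S. (g has_vector_derivative g' x) (at x within S)"
    proof
      assume "g \<in> ?A"
      then obtain f where g: "g = (\<lambda>x. of_real x * f x)" and f: "smooth_with S P f" by blast
      from f obtain f' where f': "smooth_with S P f'"
        "\<And>x. x \<in> S \<Longrightarrow> (f has_vector_derivative f' x) (at x within S)"
        by (rule smooth_withD) blast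
      show ?thesis
        unfolding g
      proof (intro bexI[of _ "\<lambda>x. of_real x * f' x + f x"] ballI sums_of.add sums_of.base)
        fix x assume "x \<in> S"
        have "(of_real has_vector_derivative (1 :: complex)) (at x within S)"
          using has_vector_derivative_of_real[OF DERIV_ident] by simp
        from has_vector_derivative_mult[OF this f'(2)[OF \<open>x \<in> S\<close>]]
        show "((\<lambda>x. complex_of_real x * f x) has_vector_derivative of_real x * f' x + f x) (at x within S)"
          by simp
      qed (use f f' in auto)
    next
      assume "g \<in> ?B"
      then obtain g' where "g' \<in> ?B" "\<forall>x\<in>S. (g has_vector_derivative g' x) (at x within S)"
        using smooth_with_derivative[of S P g] by blast
      then show ?thesis by (intro bexI[of _ g'] sums_of.base) simp_all
    qed
  qed (use assms in \<open>auto intro: sums_of.intros\<close>)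
qed

text \<open>\<open>frechet_derivative\<close> chooses among the derivatives within \<open>S\<close>,
  and on \<open>S\<close> both functions have the same candidates. The choices therefore agree even
  where there is no derivative.\<close>

lemma Ck_on_cong:
  assumes "\<And>x. x \<in> S \<Longrightarrow> f x = g x"
  shows "Ck_on k S f \<longleftrightarrow> Ck_on k S g"
  using assms
proof (induction k arbitrary: f g)
  case 0
  then show ?case by (auto cong: continuous_on_cong)
next
  case (Suc k)
  have *: "(f has_derivative D) (at x within S) \<longleftrightarrow> (g has_derivative D) (at x within S)"
    if "x \<in> S" for x D
    using Suc.prems that by (metis (no_types, lifting) has_derivative_transform)
  then have "f differentiable_on S \<longleftrightarrow> g differentiable_on S"
    by (auto simp: differentiable_on_def differentiable_def)
  moreover have "Ck_on k S (\<lambda>x. frechet_derivative f (at x within S) v)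
      \<longleftrightarrow> Ck_on k S (\<lambda>x. frechet_derivative g (at x within S) v)" for v
    by (rule Suc.IH) (simp add: frechet_derivative_def * cong: Eps_cong)
  ultimately show ?case by simp
qed

lemma smooth_on_cong: "(\<And>x. x \<in> S \<Longrightarrow> f x = g x) \<Longrightarrow> smooth_on S f \<longleftrightarrow> smooth_on S g"
  unfolding smooth_on_def using Ck_on_cong[of S f g] by auto

lemma frechet_derivative_eq_vector_derivative:
  fixes f :: "real \<Rightarrow> complex"
  assumes "f differentiable (at x within S)"
  shows "(f has_vector_derivative frechet_derivative f (at x within S) 1) (at x within S)"
    and "frechet_derivative f (at x within S) v = of_real v * frechet_derivative f (at x within S) 1"
proof -
  have *: "(f has_derivative frechet_derivative f (at x within S)) (at x within S)"
    using assms by (simp add: frechet_derivative_works)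
  then have "linear (frechet_derivative f (at x within S))"
    by (rule has_derivative_linear)
  then have **: "frechet_derivative f (at x within S) v = v *\<^sub>R frechet_derivative f (at x within S) 1" for v
    by (metis linear_scale mult.right_neutral real_scaleR_def)
  with * show "(f has_vector_derivative frechet_derivative f (at x within S) 1) (at x within S)"
    by (simp add: has_vector_derivative_def flip: **)
  show "frechet_derivative f (at x within S) v = of_real v * frechet_derivative f (at x within S) 1"
    by (subst **) (simp add: scaleR_conv_of_real)
qed

text \<open>Nontriviality of the filters makes derivatives within \<open>S\<close> unique, so the
  derivative in a chain is the one chosen by \<open>frechet_derivative\<close>. Over the reals a
  linear map is its value at 1, which reduces all directions \<open>v\<close> to one.\<close>

lemma smooth_on_iff_smooth_with:
  assumes S: "\<And>x. x \<in> S \<Longrightarrow> at x within S \<noteq> bot"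
  shows "smooth_on S f \<longleftrightarrow> smooth_with S (\<lambda>_. True) f"
proof
  assume f: "smooth_on S f"
  show "smooth_with S (\<lambda>_. True) f"
  proof (rule smooth_with_coclosed[where B = "Collect (smooth_on S)"])
    fix f :: "real \<Rightarrow> complex" assume "f \<in> Collect (smooth_on S)"
    then have "Ck_on (Suc k) S f" for k by (simp only: smooth_on_def mem_Collect_eq)
    then have "f differentiable_on S" "smooth_on S (\<lambda>x. frechet_derivative f (at x within S) 1)"
      by (auto simp: smooth_on_def)
    then show "\<exists>f'\<in>Collect (smooth_on S). \<forall>x\<in>S. (f has_vector_derivative f' x) (at x within S)"
      by (intro bexI[of _ "\<lambda>x. frechet_derivative f (at x within S) 1"] ballI
          frechet_derivative_eq_vector_derivative(1)) (auto simp: differentiable_on_def)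
  qed (use f in auto)
next
  assume "smooth_with S (\<lambda>_. True) f"
  then have "Ck_on k S f" for k
  proof (induction k arbitrary: f)
    case 0
    then show ?case by (simp add: smooth_with_continuous_on)
  next
    case (Suc k)
    then obtain f' where f': "smooth_with S (\<lambda>_. True) f'"
      "\<And>x. x \<in> S \<Longrightarrow> (f has_vector_derivative f' x) (at x within S)"
      using smooth_with_derivative[OF Suc.prems] by blast
    then have diff: "f differentiable (at x within S)" if "x \<in> S" for x
      using that by (meson differentiableI_vector)
    have "frechet_derivative f (at x within S) v = of_real v * f' x" if "x \<in> S" for v x
      using vector_derivative_unique_within[OF S[OF that] f'(2)[OF that]
          frechet_derivative_eq_vector_derivative(1)[OF diff[OF that]]]
        frechet_derivative_eq_vector_derivative(2)[OF diff[OF that], of v] by simp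
    then have "Ck_on k S (\<lambda>x. frechet_derivative f (at x within S) v)
        \<longleftrightarrow> Ck_on k S (\<lambda>x. of_real v * f' x)" for v
      by (intro Ck_on_cong) auto
    moreover have "Ck_on k S (\<lambda>x. of_real v * f' x)" for v
      by (intro Suc.IH smooth_with_mult_left f'(1))
    ultimately show ?case
      using diff by (auto simp: differentiable_on_def)
  qed
  then show "smooth_on S f" by (simp add: smooth_on_def)
qed

section \<open>Rapid decrease\<close>

definition rapid_top :: "(real \<Rightarrow> complex) \<Rightarrow> bool" where
  "rapid_top f \<longleftrightarrow> (\<forall>N. ((\<lambda>x. x ^ N *\<^sub>R f x) \<longlongrightarrow> 0) at_top)"

definition rapid_half :: "(real \<Rightarrow> complex) \<Rightarrow> bool" where
  "rapid_half f \<longleftrightarrow> (\<forall>N. \<exists>C. \<forall>x\<ge>0. x ^ N * norm (f x) \<le> C)"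

abbreviation half_schwartz :: "(real \<Rightarrow> complex) \<Rightarrow> bool" where
  "half_schwartz \<equiv> smooth_with {0..} rapid_half"

text \<open>The reflection contributes a sign \<open>(-1)^N\<close>, which does not affect
  convergence to 0.\<close>

lemma rapidly_decreasing_iff:
  "rapidly_decreasing f \<longleftrightarrow> rapid_top f \<and> rapid_top (\<lambda>x. f (- x))"
proof -
  have "((\<lambda>x. x ^ N *\<^sub>R f x) \<longlongrightarrow> 0) at_bot \<longleftrightarrow> ((\<lambda>x. x ^ N *\<^sub>R f (- x)) \<longlongrightarrow> 0) at_top" for N
    by (simp add: filterlim_at_bot_mirror power_mult_distrib[of "-1", simplified]
        tendsto_norm_zero_iff[symmetric, of "\<lambda>x. _ x *\<^sub>R f (- x)"] power_abs)
  then show ?thesis by (auto simp: rapidly_decreasing_def rapid_top_def)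
qed

lemma rapid_top_cong:
  assumes "\<And>x. x > 0 \<Longrightarrow> f x = g x" shows "rapid_top f \<longleftrightarrow> rapid_top g"
proof -
  have "((\<lambda>x. x ^ N *\<^sub>R f x) \<longlongrightarrow> 0) at_top \<longleftrightarrow> ((\<lambda>x. x ^ N *\<^sub>R g x) \<longlongrightarrow> 0) at_top" for N
    by (intro filterlim_cong refl eventually_mono[OF eventually_gt_at_top[of 0]]) (simp add: assms)
  then show ?thesis by (simp add: rapid_top_def)
qed

lemma rapidly_decreasing_cong:
  assumes "\<And>x. x \<noteq> 0 \<Longrightarrow> f x = g x" shows "rapidly_decreasing f \<longleftrightarrow> rapidly_decreasing g"
  unfolding rapidly_decreasing_iff
  using rapid_top_cong[of f g] rapid_top_cong[of "\<lambda>x. f (- x)" "\<lambda>x. g (- x)"] assms by simp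

lemma rapid_top_add:
  assumes "rapid_top f" "rapid_top g" shows "rapid_top (\<lambda>x. f x + g x)"
  unfolding rapid_top_def
proof
  fix N
  show "((\<lambda>x. x ^ N *\<^sub>R (f x + g x)) \<longlongrightarrow> 0) at_top"
    using tendsto_add[of "\<lambda>x. x ^ N *\<^sub>R f x" 0 at_top "\<lambda>x. x ^ N *\<^sub>R g x" 0] assms
    by (simp add: rapid_top_def scaleR_add_right)
qed

lemma rapid_top_mult_bounded:
  assumes "rapid_top f" "\<And>x. x \<ge> 1 \<Longrightarrow> norm (c x) \<le> C"
  shows "rapid_top (\<lambda>x. c x * f x)"
  unfolding rapid_top_def
proof
  fix N
  have "((\<lambda>x. x ^ N *\<^sub>R f x) \<longlongrightarrow> 0) at_top"
    using assms(1) unfolding rapid_top_def by blast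
  then have "((\<lambda>x. C * norm (x ^ N *\<^sub>R f x)) \<longlongrightarrow> C * norm (0 :: complex)) at_top"
    by (intro tendsto_intros)
  then have lim: "((\<lambda>x. C * norm (x ^ N *\<^sub>R f x)) \<longlongrightarrow> 0) at_top" by simp
  have "\<forall>\<^sub>F x in at_top. norm (x ^ N *\<^sub>R (c x * f x)) \<le> C * norm (x ^ N *\<^sub>R f x)"
    using eventually_ge_at_top[of "1 :: real"]
  proof eventually_elim
    case (elim x)
    then have "norm (c x) * norm (x ^ N *\<^sub>R f x) \<le> C * norm (x ^ N *\<^sub>R f x)"
      by (intro mult_right_mono assms) auto
    then show ?case by (simp add: norm_mult mult_ac)
  qed
  then show "((\<lambda>x. x ^ N *\<^sub>R (c x * f x)) \<longlongrightarrow> 0) at_top"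
    by (rule Lim_null_comparison) (rule lim)
qed

lemma rapid_top_times_x:
  assumes "rapid_top f" shows "rapid_top (\<lambda>x. of_real x * f x)"
  unfolding rapid_top_def
proof
  fix N
  have "((\<lambda>x. x ^ Suc N *\<^sub>R f x) \<longlongrightarrow> 0) at_top"
    using assms unfolding rapid_top_def by blast
  then show "((\<lambda>x. x ^ N *\<^sub>R (of_real x * f x)) \<longlongrightarrow> 0) at_top"
    by (simp add: scaleR_conv_of_real mult_ac)
qed

lemma rapid_half_imp_top:
  assumes "rapid_half f" shows "rapid_top f"
  unfolding rapid_top_def
proof
  fix N
  \<comment> \<open>The bound for the next higher power leaves a factor \<open>C / x\<close>, which
    tends to 0.\<close>
  obtain C where C: "\<And>x. x \<ge> 0 \<Longrightarrow> x ^ Suc N * norm (f x) \<le> C"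
    using assms unfolding rapid_half_def by blast
  have "((\<lambda>x::real. C / x) \<longlongrightarrow> 0) at_top"
    by (rule tendsto_divide_0[OF tendsto_const]) (simp add: filterlim_at_top_imp_at_infinity filterlim_ident)
  moreover have "\<forall>\<^sub>F x in at_top. norm (x ^ N *\<^sub>R f x) \<le> C / x"
    using eventually_gt_at_top[of "0 :: real"]
    by eventually_elim (use C in \<open>auto simp: field_simps\<close>)
  ultimately show "((\<lambda>x. x ^ N *\<^sub>R f x) \<longlongrightarrow> 0) at_top"
    by (rule Lim_null_comparison[rotated])
qed

text \<open>The limit bounds the function beyond some point; continuity up to 0 bounds it on the
  remaining compact interval.\<close>

lemma rapid_half_if_top:
  assumes "rapid_top f" "continuous_on {0..} f" shows "rapid_half f"
  unfolding rapid_half_def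
proof
  fix N
  have "((\<lambda>x. x ^ N *\<^sub>R f x) \<longlongrightarrow> 0) at_top"
    using assms(1) unfolding rapid_top_def by blast
  from order_tendstoD(2)[OF tendsto_norm_zero[OF this], of 1]
  have "\<forall>\<^sub>F x in at_top. norm (x ^ N *\<^sub>R f x) < 1" by simp
  then obtain M where M: "\<And>x. x \<ge> M \<Longrightarrow> norm (x ^ N *\<^sub>R f x) < 1"
    unfolding eventually_at_top_linorder by blast
  have "bounded ((\<lambda>x. x ^ N *\<^sub>R f x) ` {0..max 0 M})"
    by (intro compact_imp_bounded compact_continuous_image continuous_intros
        continuous_on_subset[OF assms(2)]) auto
  then obtain B where B: "\<And>x. x \<in> {0..max 0 M} \<Longrightarrow> norm (x ^ N *\<^sub>R f x) \<le> B"
    unfolding bounded_iff by blast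
  show "\<exists>C. \<forall>x\<ge>0. x ^ N * norm (f x) \<le> C"
  proof (intro exI[of _ "max 1 B"] allI impI)
    fix x :: real assume "x \<ge> 0"
    then have "x ^ N * norm (f x) = norm (x ^ N *\<^sub>R f x)" by simp
    also have "\<dots> \<le> max 1 B"
      using \<open>x \<ge> 0\<close> B[of x] M[of x] by (cases "x \<le> M") (auto simp del: norm_scaleR)
    finally show "x ^ N * norm (f x) \<le> max 1 B" .
  qed
qed

lemma rapid_half_add: "rapid_half f \<Longrightarrow> rapid_half g \<Longrightarrow> rapid_half (\<lambda>x. f x + g x)"
  unfolding rapid_half_def
proof
  fix N assume "\<forall>N. \<exists>C. \<forall>x\<ge>0. x ^ N * norm (f x) \<le> C" "\<forall>N. \<exists>C. \<forall>x\<ge>0. x ^ N * norm (g x) \<le> C"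
  then obtain A B where AB: "\<And>x. x \<ge> 0 \<Longrightarrow> x ^ N * norm (f x) \<le> A" "\<And>x. x \<ge> 0 \<Longrightarrow> x ^ N * norm (g x) \<le> B"
    by metis
  have "x ^ N * norm (f x + g x) \<le> A + B" if "x \<ge> 0" for x
  proof -
    have "x ^ N * norm (f x + g x) \<le> x ^ N * (norm (f x) + norm (g x))"
      using that by (intro mult_left_mono norm_triangle_ineq) auto
    then show ?thesis using AB[OF that] by (simp add: distrib_left)
  qed
  then show "\<exists>C. \<forall>x\<ge>0. x ^ N * norm (f x + g x) \<le> C" by blast
qed

lemma rapid_half_mult_left: "rapid_half f \<Longrightarrow> rapid_half (\<lambda>x. c * f x)"
  unfolding rapid_half_def
proof
  fix N assume "\<forall>N. \<exists>C. \<forall>x\<ge>0. x ^ N * norm (f x) \<le> C"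
  then obtain A where "\<And>x. x \<ge> 0 \<Longrightarrow> x ^ N * norm (f x) \<le> A" by metis
  then have "norm c * (x ^ N * norm (f x)) \<le> norm c * A" if "x \<ge> 0" for x
    using that by (intro mult_left_mono) auto
  then show "\<exists>C. \<forall>x\<ge>0. x ^ N * norm (c * f x) \<le> C"
    by (intro exI[of _ "norm c * A"]) (auto simp: norm_mult mult_ac)
qed

lemma rapid_half_times_x:
  assumes "rapid_half f" shows "rapid_half (\<lambda>x. of_real x * f x)"
  unfolding rapid_half_def
proof
  fix N
  obtain A where "\<And>x. x \<ge> 0 \<Longrightarrow> x ^ Suc N * norm (f x) \<le> A"
    using assms unfolding rapid_half_def by metis
  then show "\<exists>C. \<forall>x\<ge>0. x ^ N * norm (of_real x * f x) \<le> C"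
    by (intro exI[of _ A]) (auto simp: norm_mult mult_ac)
qed

lemma half_schwartz_add: "half_schwartz f \<Longrightarrow> half_schwartz g \<Longrightarrow> half_schwartz (\<lambda>x. f x + g x)"
  by (rule smooth_with_add) (auto intro: rapid_half_add)

lemma half_schwartz_mult_left: "half_schwartz f \<Longrightarrow> half_schwartz (\<lambda>x. c * f x)"
  by (rule smooth_with_mult_left) (auto intro: rapid_half_mult_left)

lemma half_schwartz_times_x: "half_schwartz f \<Longrightarrow> half_schwartz (\<lambda>x. of_real x * f x)"
  by (rule smooth_with_times_x) (auto intro: rapid_half_add rapid_half_times_x)

lemma half_schwartz_derivative:
  assumes "half_schwartz g"
  obtains g' where "half_schwartz g'"
    "\<And>x. x \<ge> 0 \<Longrightarrow> (g has_vector_derivative g' x) (at x within {0..})"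
    "\<And>x. x > 0 \<Longrightarrow> (g has_vector_derivative g' x) (at x)"
proof -
  obtain g' where g': "half_schwartz g'"
    "\<And>x. x \<ge> 0 \<Longrightarrow> (g has_vector_derivative g' x) (at x within {0..})"
    using smooth_with_derivative[OF assms] by auto
  moreover have "at x within {0..} = at x" if "x > 0" for x :: real
    using that by (intro at_within_interior) simp
  ultimately show ?thesis using that[of g'] by (metis less_imp_le)
qed

lemma half_schwartz_rapid: "half_schwartz g \<Longrightarrow> rapid_half g"
  by (rule smooth_with_imp)

lemma half_schwartz_continuous: "half_schwartz g \<Longrightarrow> continuous_on {0..} g"
  by (rule smooth_with_continuous_on)

section \<open>Reflection and the description of the space K\<close>

lemma has_vector_derivative_scale_arg:
  assumes "(f has_vector_derivative D) (at (s * x))"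
  shows "((\<lambda>x. f (s * x)) has_vector_derivative s *\<^sub>R D) (at x)"
proof -
  have "((\<lambda>x. s * x) has_vector_derivative s) (at x)"
    by (auto intro!: derivative_eq_intros)
  from vector_diff_chain_at[OF this assms] show ?thesis by (simp add: o_def)
qed

lemma has_vector_derivative_reflect:
  "(f has_vector_derivative D) (at (- x)) \<Longrightarrow> ((\<lambda>x. f (- x)) has_vector_derivative - D) (at x)" for x :: real
  using has_vector_derivative_scale_arg[of f D "- 1" x] by simp

lemma smooth_with_reflect:
  assumes f: "smooth_with S P f" and P: "\<And>f c. P f \<Longrightarrow> Q (\<lambda>x. c * f (- x))"
  shows "smooth_with (uminus ` S) Q (\<lambda>x. f (- x))"
\<comment> \<open>Every differentiation of \<open>f (- x)\<close> brings a sign, so the family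
  carries a free constant \<open>c\<close>.\<close>
proof (rule smooth_with_coclosed[where B = "{\<lambda>x. c * f (- x) |c f. smooth_with S P f}"])
  fix g assume "g \<in> {\<lambda>x. c * f (- x) |c f. smooth_with S P f}"
  then obtain c f where g: "g = (\<lambda>x. c * f (- x))" and f: "smooth_with S P f" by blast
  show "Q g" unfolding g using f by (intro P smooth_with_imp)
  obtain f' where f': "smooth_with S P f'"
    "\<And>x. x \<in> S \<Longrightarrow> (f has_vector_derivative f' x) (at x within S)"
    using smooth_with_derivative[OF f] by blast
  show "\<exists>f'\<in>{\<lambda>x. c * f (- x) |c f. smooth_with S P f}.
      \<forall>x\<in>uminus ` S. (g has_vector_derivative f' x) (at x within uminus ` S)"
  proof (intro bexI[of _ "\<lambda>x. (- c) * f' (- x)"] ballI)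
    fix x assume "x \<in> uminus ` S"
    then have "(f has_vector_derivative f' (- x)) (at (- x) within uminus ` uminus ` S)"
      using f'(2) by (auto simp: image_image)
    moreover have "(uminus has_vector_derivative (- 1)) (at x within uminus ` S)"
      by (auto intro!: derivative_eq_intros)
    ultimately have "(f \<circ> uminus has_vector_derivative (- 1) *\<^sub>R f' (- x)) (at x within uminus ` S)"
      by (intro vector_diff_chain_within)
    then show "(g has_vector_derivative - c * f' (- x)) (at x within uminus ` S)"
      unfolding g using has_vector_derivative_mult_right by (fastforce simp: o_def)
  qed (use f' in blast)
qed (rule CollectI, rule exI[of _ 1], use f in auto)

lemma at_within_nontrivial:
  "x \<noteq> 0 \<Longrightarrow> at x within - {0} \<noteq> (bot :: real filter)"
  "x \<ge> 0 \<Longrightarrow> at x within {0..} \<noteq> (bot :: real filter)"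
  "x \<le> 0 \<Longrightarrow> at x within {..0} \<noteq> (bot :: real filter)"
proof -
  show "at x within - {0} \<noteq> bot" if "x \<noteq> 0"
    using that by (subst at_within_open) auto
  show "at x within {0..} \<noteq> bot" if "x \<ge> 0"
    using that islimpt_greaterThanLessThan1[of x "x + 1"]
    by (auto simp: trivial_limit_within intro: islimpt_subset)
  show "at x within {..0} \<noteq> bot" if "x \<le> 0"
    using that islimpt_greaterThanLessThan2[of "x - 1" x]
    by (auto simp: trivial_limit_within intro: islimpt_subset)
qed

lemma powr_weight:
  assumes "x \<noteq> 0" shows "\<bar>x\<bar> powr (- (real d + 1) / 2) = 1 / sqrt \<bar>x\<bar> ^ (d + 1)"
proof -
  have "\<bar>x\<bar> powr (- (real d + 1) / 2) = (\<bar>x\<bar> powr (1 / 2)) powr (- real (d + 1))"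
    by (simp only: powr_powr) (simp add: algebra_simps)
  also have "\<dots> = 1 / sqrt \<bar>x\<bar> ^ (d + 1)"
    using assms by (subst powr_minus_divide, subst powr_realpow) (auto simp: powr_half_sqrt)
  finally show ?thesis .
qed

lemma smooth_right_at_0_iff:
  "smooth_right_at_0 g \<longleftrightarrow> (\<exists>h. smooth_with {0..} (\<lambda>_. True) h \<and> (\<forall>x>0. h x = g x))"
  unfolding smooth_right_at_0_def
  by (subst smooth_on_iff_smooth_with) (auto simp: at_within_nontrivial)

lemma smooth_left_at_0_iff:
  "smooth_left_at_0 g \<longleftrightarrow> smooth_right_at_0 (\<lambda>x. g (- x))"
proof -
  have "smooth_left_at_0 g \<longleftrightarrow> (\<exists>h. smooth_with {..0} (\<lambda>_. True) h \<and> (\<forall>x<0. h x = g x))"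
    unfolding smooth_left_at_0_def
    by (subst smooth_on_iff_smooth_with) (auto simp: at_within_nontrivial)
  also have "\<dots> \<longleftrightarrow> (\<exists>h. smooth_with {0..} (\<lambda>_. True) h \<and> (\<forall>x>0. h x = g (- x)))"
  proof safe
    fix h assume "smooth_with {..0} (\<lambda>_. True) h" "\<forall>x<0. h x = g x"
    then show "\<exists>h. smooth_with {0..} (\<lambda>_. True) h \<and> (\<forall>x>0. h x = g (- x))"
      using smooth_with_reflect[of "{..0}" "\<lambda>_. True" h "\<lambda>_. True"]
      by (intro exI[of _ "\<lambda>x. h (- x)"]) (auto simp: image_uminus_atMost)
  next
    fix h assume "smooth_with {0..} (\<lambda>_. True) h" "\<forall>x>0. h x = g (- x)"
    then show "\<exists>h. smooth_with {..0} (\<lambda>_. True) h \<and> (\<forall>x<0. h x = g x)"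
      using smooth_with_reflect[of "{0..}" "\<lambda>_. True" h "\<lambda>_. True"]
      by (intro exI[of _ "\<lambda>x. h (- x)"]) (auto simp: image_uminus_atLeast)
  qed
  finally show ?thesis by (simp add: smooth_right_at_0_iff)
qed

text \<open>Iterated derivatives at \<open>x\<close> see only a neighbourhood that avoids 0, so the
  arbitrary value at 0 never enters.\<close>

lemma nth_derivative_cong:
  assumes "\<And>x. x \<noteq> 0 \<Longrightarrow> f x = g x" "x \<noteq> 0"
  shows "nth_derivative n f x = nth_derivative n g x"
  using assms(2)
proof (induction n arbitrary: x)
  case (Suc n)
  have "(nth_derivative n f has_vector_derivative D) (at x) \<longleftrightarrow>
      (nth_derivative n g has_vector_derivative D) (at x)" for D
    by (rule iffI; erule has_vector_derivative_transform_within_open[where S = "- {0}"])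
      (use Suc in \<open>auto intro: open_Compl\<close>)
  then show ?case
    by (simp add: nth_derivative_def vector_derivative_def)
qed (simp add: nth_derivative_def assms(1))

lemma nth_derivative_Suc:
  "nth_derivative (Suc n) f = nth_derivative n (\<lambda>x. vector_derivative f (at x))"
  by (simp only: nth_derivative_def funpow_Suc_right o_def)

text \<open>Off 0 the members of a chain are the iterated derivatives in the definition of K. They
  may differ at 0, a point that is irrelevant to decay.\<close>

lemma smooth_with_punctured_iff:
  "smooth_with (- {0}) rapidly_decreasing f \<longleftrightarrow>
     smooth_on (- {0}) f \<and> (\<forall>n. rapidly_decreasing (nth_derivative n f))"
proof
  assume f: "smooth_with (- {0}) rapidly_decreasing f"
  then have "smooth_with (- {0}) (\<lambda>_. True) f" by (rule smooth_with_mono) simp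
  then have "smooth_on (- {0}) f"
    by (subst smooth_on_iff_smooth_with) (auto simp: at_within_nontrivial)
  moreover have "rapidly_decreasing (nth_derivative n f)" for n
    using f
  proof (induction n arbitrary: f)
    case 0
    then show ?case using smooth_with_imp by (auto simp: nth_derivative_def)
  next
    case (Suc n)
    obtain f' where f': "smooth_with (- {0}) rapidly_decreasing f'"
      "\<And>x. x \<noteq> 0 \<Longrightarrow> (f has_vector_derivative f' x) (at x within - {0})"
      using smooth_with_derivative[OF Suc.prems] by auto
    then have "vector_derivative f (at x) = f' x" if "x \<noteq> 0" for x
      using that at_within_open[of x "- {0}"] f'(2)[of x]
      by (auto simp: open_Compl intro: vector_derivative_at)
    then have "nth_derivative (Suc n) f x = nth_derivative n f' x" if "x \<noteq> 0" for x
      unfolding nth_derivative_Suc using that by (rule nth_derivative_cong)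
    with Suc.IH[OF f'(1)] show ?case
      using rapidly_decreasing_cong by blast
  qed
  ultimately show "smooth_on (- {0}) f \<and> (\<forall>n. rapidly_decreasing (nth_derivative n f))" by blast
next
  let ?B = "{f. smooth_on (- {0}) f \<and> (\<forall>n. rapidly_decreasing (nth_derivative n f))}"
  assume f: "smooth_on (- {0}) f \<and> (\<forall>n. rapidly_decreasing (nth_derivative n f))"
  show "smooth_with (- {0}) rapidly_decreasing f"
  proof (rule smooth_with_coclosed[where B = ?B])
    fix f assume f: "f \<in> ?B"
    then show "rapidly_decreasing f"
      by (auto simp: nth_derivative_def dest: spec[of _ 0])
    from f have "smooth_with (- {0}) (\<lambda>_. True) f"
      using smooth_on_iff_smooth_with[of "- {0}" f] at_within_nontrivial by auto
    then obtain f' where f': "smooth_with (- {0}) (\<lambda>_. True) f'"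
      "\<And>x. x \<noteq> 0 \<Longrightarrow> (f has_vector_derivative f' x) (at x within - {0})"
      using smooth_with_derivative by fastforce
    then have f'_eq: "vector_derivative f (at x) = f' x" if "x \<noteq> 0" for x
      using that at_within_open[of x "- {0}"] f'(2)[of x]
      by (auto simp: open_Compl intro: vector_derivative_at)
    have "smooth_on (- {0}) f'"
      using smooth_on_iff_smooth_with[of "- {0}" f'] at_within_nontrivial f'(1) by auto
    then have "smooth_on (- {0}) (\<lambda>x. vector_derivative f (at x))"
      using smooth_on_cong[of "- {0}" "\<lambda>x. vector_derivative f (at x)" f'] f'_eq by auto
    moreover have "rapidly_decreasing (nth_derivative n (\<lambda>x. vector_derivative f (at x)))" for n
      using f by (auto simp flip: nth_derivative_Suc)
    ultimately show "\<exists>f'\<in>?B. \<forall>x\<in>- {0}. (f has_vector_derivative f' x) (at x within - {0})"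
      using f'(2) f'_eq by (intro bexI[of _ "\<lambda>x. vector_derivative f (at x)"]) auto
  qed (use f in blast)
qed

text \<open>This is \<open>|x|^((d+1)/2)\<close>; the square root keeps the exponent an integer for
  both parities of \<open>d\<close>.\<close>

definition weight :: "nat \<Rightarrow> real \<Rightarrow> real" where "weight d x = sqrt \<bar>x\<bar> ^ (d + 1)"

lemma weight_minus [simp]: "weight d (- x) = weight d x"
  by (simp add: weight_def)

lemma kirillov_space_iff_weight:
  "f \<in> kirillov_space d \<longleftrightarrow> smooth_with (- {0}) rapidly_decreasing f
     \<and> (\<exists>h. smooth_with {0..} (\<lambda>_. True) h \<and> (\<forall>x>0. h x = f x / of_real (weight d x)))
     \<and> (\<exists>h. smooth_with {0..} (\<lambda>_. True) h \<and> (\<forall>x>0. h x = f (- x) / of_real (weight d x)))"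
proof -
  have "of_real (\<bar>x\<bar> powr (- (real d + 1) / 2)) * f y = f y / of_real (weight d x)" if "x > 0" for x y
    using that powr_weight[of x d] by (simp add: weight_def)
  then show ?thesis
    by (simp add: kirillov_space_def smooth_with_punctured_iff smooth_left_at_0_iff smooth_right_at_0_iff)
qed

text \<open>In this form the powers \<open>x^(- n / 2)\<close> are closed under differentiation up
  to constants.\<close>

lemma inverse_sqrt_power_has_derivative:
  assumes "x > 0"
  shows "((\<lambda>x. (1 / sqrt x) ^ n) has_real_derivative - (real n / 2) * (1 / sqrt x) ^ (n + 2)) (at x)"
proof -
  have eq: "(1 / sqrt x) ^ n = x powr (- (real n / 2))" if "x > 0" for x n
  proof -
    have "(1 / sqrt x) ^ n = (x powr (- 1 / 2)) powr real n"
      using that by (subst powr_realpow) (auto simp: powr_minus_divide powr_half_sqrt)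
    then show ?thesis by (simp add: powr_powr)
  qed
  have "((\<lambda>x. x powr (- (real n / 2))) has_real_derivative
      - (real n / 2) * x powr (- (real n / 2) - 1)) (at x)"
    using assms by (auto intro!: derivative_eq_intros)
  moreover have "x powr (- (real n / 2) - 1) = (1 / sqrt x) ^ (n + 2)"
  proof -
    have *: "- (real n / 2) - 1 = - (real (n + 2) / 2)" by (simp add: field_simps)
    show ?thesis unfolding * by (rule eq[OF assms, symmetric])
  qed
  ultimately show ?thesis
    using assms eq by (auto elim!: has_field_derivative_transform_within_open[where S = "{0<..}"])
qed

text \<open>The two ends are controlled by different hypotheses. On the open half-line each
  derivative of \<open>h\<close> is a sum of negative half-integral powers of \<open>x\<close> times
  rapidly decreasing functions, hence decays at infinity; near 0 it is bounded because it is
  continuous on the closed half-line.\<close>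

lemma half_schwartz_of_weighted:
  assumes f: "smooth_with {0<..} rapid_top f" and h: "smooth_with {0..} (\<lambda>_. True) h"
    and h_eq: "\<And>x. x > 0 \<Longrightarrow> h x = f x / of_real (weight d x)"
  shows "half_schwartz h"
proof -
  define D where "D = {\<lambda>x. c * of_real ((1 / sqrt x) ^ n) * \<phi> x |c n \<phi>. smooth_with {0<..} rapid_top \<phi>}"
  have D_deriv: "\<exists>\<psi>'\<in>sums_of D. \<forall>x\<in>{0<..}. (\<psi> has_vector_derivative \<psi>' x) (at x within {0<..})"
    if "\<psi> \<in> sums_of D" for \<psi>
  proof (rule sums_of_derivative[OF _ that])
    fix \<psi> assume "\<psi> \<in> D"
    then obtain c n \<phi> where \<psi>: "\<psi> = (\<lambda>x. c * of_real ((1 / sqrt x) ^ n) * \<phi> x)"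
      and \<phi>: "smooth_with {0<..} rapid_top \<phi>" unfolding D_def by blast
    obtain \<phi>' where \<phi>': "smooth_with {0<..} rapid_top \<phi>'"
      "\<And>x. x > 0 \<Longrightarrow> (\<phi> has_vector_derivative \<phi>' x) (at x within {0<..})"
      using smooth_with_derivative[OF \<phi>] by auto
    let ?\<psi>' = "\<lambda>x. c * of_real ((1 / sqrt x) ^ n) * \<phi>' x
      + (c * of_real (- (real n / 2))) * of_real ((1 / sqrt x) ^ (n + 2)) * \<phi> x"
    show "\<exists>\<psi>'\<in>sums_of D. \<forall>x\<in>{0<..}. (\<psi> has_vector_derivative \<psi>' x) (at x within {0<..})"
    proof (intro bexI[of _ ?\<psi>'] ballI)
      show "?\<psi>' \<in> sums_of D"
        using \<phi> \<phi>'(1) unfolding D_def by (intro sums_of.add sums_of.base) blast+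
      fix x :: real assume x: "x \<in> {0<..}"
      then have "((\<lambda>x. complex_of_real ((1 / sqrt x) ^ n)) has_vector_derivative
          of_real (- (real n / 2) * (1 / sqrt x) ^ (n + 2))) (at x within {0<..})"
        by (intro has_vector_derivative_of_real
            has_field_derivative_at_within[OF inverse_sqrt_power_has_derivative]) simp
      from has_vector_derivative_mult_right[OF has_vector_derivative_mult[OF this \<phi>'(2)], of c]
      show "(\<psi> has_vector_derivative ?\<psi>' x) (at x within {0<..})"
        using x unfolding \<psi> by (simp add: algebra_simps)
    qed
  qed
  have D_rapid: "rapid_top \<psi>" if "\<psi> \<in> sums_of D" for \<psi>
  proof (rule sums_of_property[where P = rapid_top, OF _ rapid_top_add that])
    fix \<psi> assume "\<psi> \<in> D"
    then obtain c n \<phi> where \<psi>: "\<psi> = (\<lambda>x. c * of_real ((1 / sqrt x) ^ n) * \<phi> x)"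
      and \<phi>: "smooth_with {0<..} rapid_top \<phi>" unfolding D_def by blast
    show "rapid_top \<psi>"
      unfolding \<psi>
    proof (rule rapid_top_mult_bounded[OF smooth_with_imp[OF \<phi>]])
      fix x :: real assume "x \<ge> 1"
      then have "(1 / sqrt x) ^ n \<le> 1" by (intro power_le_one) auto
      then show "norm (c * of_real ((1 / sqrt x) ^ n)) \<le> norm c"
        using \<open>x \<ge> 1\<close> mult_left_mono[of _ 1 "norm c"] by (simp add: norm_mult norm_power norm_divide)
    qed
  qed auto
  \<comment> \<open>A member is a chain up to 0 that also has a formula in \<open>D\<close> off 0;
    uniqueness of derivatives keeps the two in step.\<close>
  define B where "B = {h. smooth_with {0..} (\<lambda>_. True) h \<and> (\<exists>\<psi>\<in>sums_of D. \<forall>x>0. h x = \<psi> x)}"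
  show ?thesis
  proof (rule smooth_with_coclosed[where B = B])
    fix h assume "h \<in> B"
    then obtain \<psi> where h: "smooth_with {0..} (\<lambda>_. True) h" and \<psi>: "\<psi> \<in> sums_of D"
      and h_\<psi>: "\<And>x. x > 0 \<Longrightarrow> h x = \<psi> x" unfolding B_def by blast
    have "rapid_top h" using D_rapid[OF \<psi>] rapid_top_cong[of h \<psi>] h_\<psi> by blast
    then show "rapid_half h" by (rule rapid_half_if_top) (rule smooth_with_continuous_on[OF h])
    obtain h' where h': "smooth_with {0..} (\<lambda>_. True) h'"
      "\<And>x. x \<ge> 0 \<Longrightarrow> (h has_vector_derivative h' x) (at x within {0..})"
      using smooth_with_derivative[OF h] by auto
    obtain \<psi>' where \<psi>': "\<psi>' \<in> sums_of D"
      "\<And>x. x > 0 \<Longrightarrow> (\<psi> has_vector_derivative \<psi>' x) (at x within {0<..})"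
      using D_deriv[OF \<psi>] by auto
    have "h' x = \<psi>' x" if "x > 0" for x
    proof (rule vector_derivative_unique_at)
      show "(h has_vector_derivative h' x) (at x)"
        using h'(2)[of x] that at_within_interior[of x "{0..}"] by simp
      have "(\<psi> has_vector_derivative \<psi>' x) (at x)"
        using \<psi>'(2)[OF that] that at_within_open[of x "{0<..}"] by simp
      then show "(h has_vector_derivative \<psi>' x) (at x)"
        by (rule has_vector_derivative_transform_within_open[where S = "{0<..}"]) (use that h_\<psi> in auto)
    qed
    then have "h' \<in> B" using h'(1) \<psi>'(1) unfolding B_def by blast
    then show "\<exists>h'\<in>B. \<forall>x\<in>{0..}. (h has_vector_derivative h' x) (at x within {0..})"
      using h'(2) by auto
  next
    have "(\<lambda>x. 1 * of_real ((1 / sqrt x) ^ (d + 1)) * f x) \<in> sums_of D"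
      unfolding D_def using f by (intro sums_of.base) blast
    then show "h \<in> B"
      unfolding B_def using h h_eq
      by (intro CollectI conjI bexI[of _ "\<lambda>x. 1 * of_real ((1 / sqrt x) ^ (d + 1)) * f x"])
        (auto simp: weight_def power_divide)
  qed
qed

lemma smooth_with_subset_open:
  assumes "smooth_with S P f" "T \<subseteq> S" "\<And>f. P f \<Longrightarrow> Q f"
  shows "smooth_with T Q f"
proof (rule smooth_with_coclosed[where B = "Collect (smooth_with S P)"])
  fix f assume f: "f \<in> Collect (smooth_with S P)"
  then show "Q f" by (auto intro: assms(3) smooth_with_imp)
  obtain f' where f': "smooth_with S P f'" "\<And>x. x \<in> S \<Longrightarrow> (f has_vector_derivative f' x) (at x within S)"
    using smooth_with_derivative[of S P f] f by auto
  then show "\<exists>f'\<in>Collect (smooth_with S P). \<forall>x\<in>T. (f has_vector_derivative f' x) (at x within T)"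
    using assms(2) by (intro bexI[of _ f'] ballI has_vector_derivative_within_subset[OF f'(2) assms(2)]) auto
qed (use assms in simp)

lemma sqrt_power_has_derivative:
  assumes "x > 0"
  shows "((\<lambda>x. sqrt x ^ (d + 1) * (1 / x) ^ n) has_real_derivative
    ((real d + 1) / 2 - real n) * (sqrt x ^ (d + 1) * (1 / x) ^ Suc n)) (at x)"
proof -
  have eq: "sqrt x ^ (d + 1) * (1 / x) ^ n = x powr ((real d + 1) / 2 - real n)" if "x > 0" for x n
  proof -
    have "sqrt x ^ (d + 1) = (x powr (1 / 2)) powr real (d + 1)"
      using that by (subst powr_realpow) (auto simp: powr_half_sqrt)
    moreover have "(1 / x) ^ n = x powr (- real n)"
      using that by (simp add: powr_minus_divide powr_realpow power_divide)
    ultimately show ?thesis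
      by (simp add: powr_powr add.commute flip: powr_add)
  qed
  have "((\<lambda>x. x powr ((real d + 1) / 2 - real n)) has_real_derivative
      ((real d + 1) / 2 - real n) * x powr ((real d + 1) / 2 - real n - 1)) (at x)"
    using assms by (auto intro!: derivative_eq_intros)
  moreover have "x powr ((real d + 1) / 2 - real n - 1) = sqrt x ^ (d + 1) * (1 / x) ^ Suc n"
    using eq[OF assms, of "Suc n"] by (simp add: algebra_simps)
  ultimately show ?thesis
    using assms eq by (auto elim!: has_field_derivative_transform_within_open[where S = "{0<..}"])
qed

text \<open>Derivatives off 0 have the form \<open>F n g\<close>, the weight times
  \<open>x^(- n)\<close> times a Schwartz function \<open>g\<close>, with \<open>n\<close> counting
  the derivatives. The growing singularity at 0 is harmless, as these derivatives are tested only at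
  infinity.\<close>

lemma kirillov_space_of_half_schwartz:
  assumes g: "half_schwartz g1" "half_schwartz g2"
    and f: "\<And>x. x > 0 \<Longrightarrow> f x = of_real (weight d x) * g1 x"
      "\<And>x. x > 0 \<Longrightarrow> f (- x) = of_real (weight d x) * g2 x"
  shows "f \<in> kirillov_space d"
  unfolding kirillov_space_iff_weight
proof (intro conjI)
  have "smooth_with {0..} (\<lambda>_. True) g1" "smooth_with {0..} (\<lambda>_. True) g2"
    using g by (auto intro: smooth_with_mono)
  then show "\<exists>h. smooth_with {0..} (\<lambda>_. True) h \<and> (\<forall>x>0. h x = f x / of_real (weight d x))"
    "\<exists>h. smooth_with {0..} (\<lambda>_. True) h \<and> (\<forall>x>0. h x = f (- x) / of_real (weight d x))"
    by (intro exI[of _ g1] exI[of _ g2] conjI; simp add: f weight_def)+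
  define F where "F n g x = complex_of_real (sqrt x ^ (d + 1) * (1 / x) ^ n) * g x" for n g x
  have F_deriv: "(F n g has_vector_derivative
      F (Suc n) (\<lambda>x. of_real ((real d + 1) / 2 - real n) * g x + of_real x * g' x) x) (at x)"
    if "x > 0" "(g has_vector_derivative g' x) (at x)" for n g g' x
  proof -
    from has_vector_derivative_mult[OF has_vector_derivative_of_real
        [OF sqrt_power_has_derivative[OF that(1), of d n]] that(2)]
    show ?thesis
      using that(1) unfolding F_def by (simp add: field_simps)
  qed
  have F_rapid: "rapid_top (F n g)" if "half_schwartz g" for n g
  proof -
    have *: "rapid_top (\<lambda>x. of_real (x ^ k) * g x)" for k
    proof (induction k)
      case 0
      then show ?case using rapid_half_imp_top[OF half_schwartz_rapid[OF that]] by simp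
    next
      case (Suc k)
      from rapid_top_times_x[OF this] show ?case by (simp add: mult_ac)
    qed
    \<comment> \<open>Writing \<open>sqrt x\<close> as \<open>(sqrt x / x) * x\<close> leaves a
      coefficient that is at most 1 for \<open>x >= 1\<close>, and a polynomial factor.\<close>
    have "rapid_top (\<lambda>x. of_real ((sqrt x / x) ^ (d + 1) * (1 / x) ^ n) * (of_real (x ^ (d + 1)) * g x))"
    proof (rule rapid_top_mult_bounded[OF *])
      fix x :: real assume "x \<ge> 1"
      then have "sqrt x \<le> x" by (simp add: real_le_lsqrt power2_eq_square real_sqrt_le_iff)
      then have "(sqrt x / x) ^ (d + 1) * (1 / x) ^ n \<le> 1 * 1"
        using \<open>x \<ge> 1\<close> by (intro mult_mono power_le_one) auto
      then show "norm (complex_of_real ((sqrt x / x) ^ (d + 1) * (1 / x) ^ n)) \<le> 1"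
        using \<open>x \<ge> 1\<close> by (subst norm_of_real) simp
    qed
    also have "?this \<longleftrightarrow> rapid_top (F n g)"
      by (rule rapid_top_cong) (simp add: F_def power_divide)
    finally show ?thesis .
  qed
  define B where "B = {\<phi>. \<exists>n g1 g2. half_schwartz g1 \<and> half_schwartz g2 \<and>
    (\<forall>x>0. \<phi> x = F n g1 x) \<and> (\<forall>x>0. \<phi> (- x) = F n g2 x)}"
  show "smooth_with (- {0}) rapidly_decreasing f"
  proof (rule smooth_with_coclosed[where B = B])
    fix \<phi> assume "\<phi> \<in> B"
    then obtain n g1 g2 where g: "half_schwartz g1" "half_schwartz g2"
      and \<phi>: "\<And>x. x > 0 \<Longrightarrow> \<phi> x = F n g1 x" "\<And>x. x > 0 \<Longrightarrow> \<phi> (- x) = F n g2 x"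
      unfolding B_def by blast
    show "rapidly_decreasing \<phi>"
      unfolding rapidly_decreasing_iff
      using rapid_top_cong[THEN iffD2, OF \<phi>(1) F_rapid[OF g(1)]]
        rapid_top_cong[THEN iffD2, OF \<phi>(2) F_rapid[OF g(2)]] by simp
    obtain g1' where g1': "half_schwartz g1'"
      "\<And>x. x > 0 \<Longrightarrow> (g1 has_vector_derivative g1' x) (at x)"
      by (rule half_schwartz_derivative[OF g(1)]) blast
    obtain g2' where g2': "half_schwartz g2'"
      "\<And>x. x > 0 \<Longrightarrow> (g2 has_vector_derivative g2' x) (at x)"
      by (rule half_schwartz_derivative[OF g(2)]) blast
    define k where "k g g' x = complex_of_real ((real d + 1) / 2 - real n) * g x + complex_of_real x * g' x"
      for g g' :: "real \<Rightarrow> complex" and x :: real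
    have k: "half_schwartz (k g1 g1')" "half_schwartz (\<lambda>x. - 1 * k g2 g2' x)"
      unfolding k_def
      by (intro half_schwartz_add half_schwartz_mult_left half_schwartz_times_x g g1' g2')+
    \<comment> \<open>On the negative side the chain rule for \<open>- x\<close> contributes the
      factor \<open>- 1\<close>.\<close>
    define \<phi>' where "\<phi>' x = (if x > 0 then F (Suc n) (k g1 g1') x
      else F (Suc n) (\<lambda>x. - 1 * k g2 g2' x) (- x))" for x
    have "\<phi>' \<in> B"
      unfolding B_def mem_Collect_eq using k
      by (intro exI[of _ "Suc n"] exI[of _ "k g1 g1'"] exI[of _ "\<lambda>x. - 1 * k g2 g2' x"])
        (auto simp: \<phi>'_def)
    moreover have "(\<phi> has_vector_derivative \<phi>' x) (at x within - {0})" if "x \<noteq> 0" for x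
    proof (cases "x > 0")
      case True
      have "(F n g1 has_vector_derivative \<phi>' x) (at x)"
        using F_deriv[of x g1 g1' n, OF True g1'(2)[OF True]] True by (simp add: \<phi>'_def k_def[abs_def])
      then have "(\<phi> has_vector_derivative \<phi>' x) (at x)"
        by (rule has_vector_derivative_transform_within_open[where S = "{0<..}"]) (use True \<phi> in auto)
      then show ?thesis by (rule has_vector_derivative_at_within)
    next
      case False
      then have "- x > 0" using that by simp
      from F_deriv[of "- x" g2 g2' n, OF this g2'(2)[OF this]]
      have "(F n g2 has_vector_derivative F (Suc n) (k g2 g2') (- x)) (at (- x))"
        by (simp add: k_def[abs_def])
      then have "((\<lambda>x. F n g2 (- x)) has_vector_derivative - F (Suc n) (k g2 g2') (- x)) (at x)"
        by (rule has_vector_derivative_reflect)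
      moreover have "- F (Suc n) (k g2 g2') (- x) = \<phi>' x"
        using False by (simp add: \<phi>'_def F_def)
      ultimately have "((\<lambda>x. F n g2 (- x)) has_vector_derivative \<phi>' x) (at x)" by simp
      then have "(\<phi> has_vector_derivative \<phi>' x) (at x)"
        by (rule has_vector_derivative_transform_within_open[where S = "{..<0}"])
          (use \<open>- x > 0\<close> \<phi>(2)[of "- _"] in auto)
      then show ?thesis by (rule has_vector_derivative_at_within)
    qed
    ultimately show "\<exists>\<phi>'\<in>B. \<forall>x\<in>- {0}. (\<phi> has_vector_derivative \<phi>' x) (at x within - {0})"
      by auto
  next
    show "f \<in> B"
      unfolding B_def mem_Collect_eq using g f
      by (intro exI[of _ 0] exI[of _ g1] exI[of _ g2]) (auto simp: F_def weight_def)
  qed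
qed

theorem kirillov_space_iff:
  "f \<in> kirillov_space d \<longleftrightarrow> (\<exists>g1 g2. half_schwartz g1 \<and> half_schwartz g2 \<and>
     (\<forall>x>0. f x = of_real (weight d x) * g1 x \<and> f (- x) = of_real (weight d x) * g2 x))"
proof
  assume "f \<in> kirillov_space d"
  then obtain g1 g2 where f: "smooth_with (- {0}) rapidly_decreasing f"
    and g1: "smooth_with {0..} (\<lambda>_. True) g1" "\<And>x. x > 0 \<Longrightarrow> g1 x = f x / of_real (weight d x)"
    and g2: "smooth_with {0..} (\<lambda>_. True) g2" "\<And>x. x > 0 \<Longrightarrow> g2 x = f (- x) / of_real (weight d x)"
    unfolding kirillov_space_iff_weight by blast
  have "smooth_with {0<..} rapid_top f"
    by (rule smooth_with_subset_open[OF f]) (auto simp: rapidly_decreasing_iff)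
  then have "half_schwartz g1" by (rule half_schwartz_of_weighted) (use g1 in auto)
  have "smooth_with (uminus ` (- {0})) rapidly_decreasing (\<lambda>x. f (- x))"
  proof (rule smooth_with_reflect[OF f])
    fix f c assume "rapidly_decreasing f"
    then show "rapidly_decreasing (\<lambda>x. c * f (- x))"
      unfolding rapidly_decreasing_iff
      by (auto intro!: rapid_top_mult_bounded[where c = "\<lambda>_. c" and C = "norm c"])
  qed
  then have "smooth_with {0<..} rapid_top (\<lambda>x. f (- x))"
    by (rule smooth_with_subset_open) (auto simp: rapidly_decreasing_iff image_iff
      intro!: bexI[of _ "- _"])
  then have "half_schwartz g2" by (rule half_schwartz_of_weighted) (use g2 in auto)
  then show "\<exists>g1 g2. half_schwartz g1 \<and> half_schwartz g2 \<and>
     (\<forall>x>0. f x = of_real (weight d x) * g1 x \<and> f (- x) = of_real (weight d x) * g2 x)"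
    using \<open>half_schwartz g1\<close>
    by (intro exI[of _ g1] exI[of _ g2]) (simp add: g1(2) g2(2) weight_def)
qed (auto intro: kirillov_space_of_half_schwartz)

section \<open>The Hankel transform on the half-line\<close>

text \<open>At 0 this asks for boundedness only (the case \<open>N = 0\<close>), which is what can
  be shown for a smooth vector, and it still allows differentiation under the transform.\<close>

definition rapid_open :: "(real \<Rightarrow> complex) \<Rightarrow> bool" where
  "rapid_open k \<longleftrightarrow> continuous_on {0<..} k \<and> (\<forall>N. \<exists>C. \<forall>x>0. x ^ N * norm (k x) \<le> C)"

text \<open>The half-integral powers of the classical Hankel transform are split off, so that the
  kernel is entire in \<open>y\<close> and the transform can be smooth up to
  \<open>y = 0\<close>.\<close>

definition hankel :: "nat \<Rightarrow> (real \<Rightarrow> complex) \<Rightarrow> real \<Rightarrow> complex" where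
  "hankel m k y = (LINT x:{0<..}|lborel. of_real (bes m (x * y)) * k x)"

lemma set_integrable_inverse_square: "set_integrable lborel {0<..} (\<lambda>x::real. 1 / (1 + x\<^sup>2))"
proof -
  have "set_integrable lborel (einterval 0 \<infinity>) (\<lambda>x::real. 1 / (1 + x\<^sup>2))"
  proof (rule interval_integral_FTC_nonneg(1)[where F = arctan and A = 0 and B = "pi / 2"])
    show "((arctan \<circ> real_of_ereal) \<longlongrightarrow> 0) (at_right 0)"
      unfolding zero_ereal_def ereal_tendsto_simps
      by (rule tendsto_eq_intros filterlim_ident | simp)+
    show "((arctan \<circ> real_of_ereal) \<longlongrightarrow> pi / 2) (at_left \<infinity>)"
      unfolding ereal_tendsto_simps by (rule tendsto_arctan_at_top)
    show "DERIV arctan x :> 1 / (1 + x\<^sup>2)" for x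
      using DERIV_arctan[of x] by (simp add: divide_inverse)
    show "isCont (\<lambda>x. 1 / (1 + x\<^sup>2)) x" for x :: real
      using power2_less_0[of x] by (intro continuous_intros) (auto simp: add_nonneg_eq_0_iff)
  qed auto
  moreover have "einterval 0 \<infinity> = {0<..}" by (auto simp: einterval_def)
  ultimately show ?thesis by simp
qed

text \<open>The bounds for the exponents \<open>N\<close> and \<open>N + 2\<close> add up to a bound
  for \<open>(1 + x^2) x^N |k x|\<close>.\<close>

lemma rapid_open_bound:
  assumes "rapid_open k"
  obtains C where "C \<ge> 0" "\<And>x. x > 0 \<Longrightarrow> x ^ N * norm (k x) \<le> C * (1 / (1 + x\<^sup>2))"
proof -
  from assms obtain A B where A: "\<And>x. x > 0 \<Longrightarrow> x ^ N * norm (k x) \<le> A"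
    and B: "\<And>x. x > 0 \<Longrightarrow> x ^ (N + 2) * norm (k x) \<le> B"
    unfolding rapid_open_def by metis
  have "0 \<le> A + B"
    using A[of 1] B[of 1] norm_ge_zero[of "k 1"] by (simp del: norm_ge_zero)
  moreover have "x ^ N * norm (k x) \<le> (A + B) * (1 / (1 + x\<^sup>2))" if "x > 0" for x
  proof -
    have "(x ^ N * norm (k x)) * (1 + x\<^sup>2) \<le> A + B"
      using A[OF that] B[OF that] by (simp add: algebra_simps power_add power2_eq_square)
    then show ?thesis by (simp add: pos_le_divide_eq add_pos_nonneg)
  qed
  ultimately show ?thesis using that by blast
qed

lemma rapid_open_times_x: "rapid_open k \<Longrightarrow> rapid_open (\<lambda>x. of_real x * k x)"
  unfolding rapid_open_def
proof (intro conjI allI)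
  fix N assume "continuous_on {0<..} k \<and> (\<forall>N. \<exists>C. \<forall>x>0. x ^ N * norm (k x) \<le> C)"
  then obtain C where "\<And>x. x > 0 \<Longrightarrow> x ^ Suc N * norm (k x) \<le> C" by blast
  then show "\<exists>C. \<forall>x>0. x ^ N * norm (of_real x * k x) \<le> C"
    by (intro exI[of _ C]) (auto simp: norm_mult mult_ac)
qed (auto intro!: continuous_intros)

lemma rapid_open_mult_left: "rapid_open k \<Longrightarrow> rapid_open (\<lambda>x. c * k x)"
  unfolding rapid_open_def
proof (intro conjI allI)
  fix N assume "continuous_on {0<..} k \<and> (\<forall>N. \<exists>C. \<forall>x>0. x ^ N * norm (k x) \<le> C)"
  then obtain C where C: "\<And>x. x > 0 \<Longrightarrow> x ^ N * norm (k x) \<le> C" by blast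
  have "x ^ N * norm (c * k x) \<le> norm c * C" if "x > 0" for x
    using mult_left_mono[OF C[OF that], of "norm c"] by (simp add: norm_mult mult_ac)
  then show "\<exists>C. \<forall>x>0. x ^ N * norm (c * k x) \<le> C" by blast
qed (auto intro!: continuous_intros)

lemma rapid_open_mult_bounded:
  assumes "rapid_open k" "continuous_on {0<..} c" "\<And>x. x > 0 \<Longrightarrow> norm (c x) \<le> 1"
  shows "rapid_open (\<lambda>x. c x * k x)"
  unfolding rapid_open_def
proof (intro conjI allI)
  fix N
  obtain C where C: "\<And>x. x > 0 \<Longrightarrow> x ^ N * norm (k x) \<le> C"
    using assms(1) unfolding rapid_open_def by blast
  have "x ^ N * norm (c x * k x) \<le> C" if "x > 0" for x
    using mult_mono[OF assms(3)[OF that] C[OF that]] that by (simp add: norm_mult mult_ac)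
  then show "\<exists>C. \<forall>x>0. x ^ N * norm (c x * k x) \<le> C" by blast
qed (use assms in \<open>auto intro!: continuous_intros simp: rapid_open_def\<close>)

lemma half_schwartz_rapid_open:
  assumes "half_schwartz g" shows "rapid_open g"
proof -
  have "\<exists>C. \<forall>x>0. x ^ N * norm (g x) \<le> C" for N
    using half_schwartz_rapid[OF assms] unfolding rapid_half_def by (meson less_imp_le)
  then show ?thesis
    using continuous_on_subset[OF half_schwartz_continuous[OF assms], of "{0<..}"]
    by (simp add: rapid_open_def subset_eq)
qed

lemma rapid_open_integrable:
  assumes "rapid_open k"
  shows "set_integrable lborel {0<..} k"
proof -
  obtain C where C: "C \<ge> 0" "\<And>x. x > 0 \<Longrightarrow> x ^ 0 * norm (k x) \<le> C * (1 / (1 + x\<^sup>2))"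
    using rapid_open_bound[OF assms, of 0] by blast
  show ?thesis
  proof (rule set_integrable_bound)
    show "set_integrable lborel {0<..} (\<lambda>x::real. C * (1 / (1 + x\<^sup>2)))"
      by (intro set_integrable_mult_right set_integrable_inverse_square)
    show "set_borel_measurable lborel {0<..} k"
      using assms by (auto simp: set_borel_measurable_def rapid_open_def
        intro: borel_measurable_continuous_on_indicator)
    show "AE x in lborel. x \<in> {0<..} \<longrightarrow> norm (k x) \<le> norm (C * (1 / (1 + x\<^sup>2)))"
      using C by auto
  qed
qed

lemma rapid_open_power: "rapid_open k \<Longrightarrow> rapid_open (\<lambda>x. of_real (x ^ n) * k x)"
  using rapid_open_times_x[of "\<lambda>x. of_real (x ^ _) * k x"]
  by (induction n) (simp_all add: mult.assoc)

lemma rapid_open_bes: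
  assumes "rapid_open k" "y \<ge> 0"
  shows "rapid_open (\<lambda>x. of_real (bes m (x * y)) * k x)"
  using assms(2) by (intro rapid_open_mult_bounded assms(1) continuous_intros) (auto simp: abs_bes_le_1)

lemmas hankel_integrable = rapid_open_integrable[OF rapid_open_bes]

lemma hankel_bounded:
  assumes "rapid_open k"
  shows "\<exists>C. \<forall>y\<ge>0. norm (hankel m k y) \<le> C"
proof (intro exI[of _ "LINT x:{0<..}|lborel. norm (k x)"] allI impI)
  fix y :: real assume "y \<ge> 0"
  have "norm (hankel m k y) \<le> (LINT x:{0<..}|lborel. norm (of_real (bes m (x * y)) * k x))"
    unfolding hankel_def by (intro set_integral_norm_bound hankel_integrable assms \<open>y \<ge> 0\<close>)
  also have "\<dots> \<le> (LINT x:{0<..}|lborel. norm (k x))"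
  proof (rule set_integral_mono)
    fix x :: real assume "x \<in> {0<..}"
    then have "\<bar>bes m (x * y)\<bar> \<le> 1" using \<open>y \<ge> 0\<close> by (intro abs_bes_le_1) auto
    then show "norm (of_real (bes m (x * y)) * k x) \<le> norm (k x)"
      by (simp add: norm_mult mult_left_le_one_le)
  qed (intro set_integrable_norm hankel_integrable rapid_open_integrable assms \<open>y \<ge> 0\<close>)+
  finally show "norm (hankel m k y) \<le> (LINT x:{0<..}|lborel. norm (k x))" .
qed

lemma hankel_mult_left: "hankel m (\<lambda>x. c * k x) y = c * hankel m k y"
proof -
  have "hankel m (\<lambda>x. c * k x) y = (LINT x:{0<..}|lborel. c * (of_real (bes m (x * y)) * k x))"
    by (simp add: hankel_def mult_ac)
  then show ?thesis by (simp add: hankel_def)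
qed

lemma hankel_cong: "(\<And>x. x > 0 \<Longrightarrow> k x = l x) \<Longrightarrow> hankel m k y = hankel m l y"
  unfolding hankel_def by (rule set_lebesgue_integral_cong) auto

text \<open>The derivative is again a function \<open>bes\<close> up to sign, hence bounded by 1.
  This dominates the difference quotients of the kernel.\<close>

lemma bes_lipschitz:
  assumes "u \<ge> 0" "v \<ge> 0" shows "\<bar>bes m u - bes m v\<bar> \<le> \<bar>u - v\<bar>"
  using field_differentiable_bound[of "{0..}" "bes m" "\<lambda>z. - bes (Suc m) z" 1 u v] assms
  by (auto simp: abs_bes_le_1 intro: has_field_derivative_at_within bes_has_real_derivative)

lemma has_vector_derivative_iff_quotient:
  "(f has_vector_derivative D) (at y within S) \<longleftrightarrow>
    ((\<lambda>z. (f z - f y) /\<^sub>R (z - y)) \<longlongrightarrow> D) (at y within S)"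
proof -
  have "((\<lambda>z. (f z - f y) /\<^sub>R (z - y)) \<longlongrightarrow> D) (at y within S) \<longleftrightarrow>
      ((\<lambda>z. norm ((f z - f y) /\<^sub>R (z - y) - D)) \<longlongrightarrow> 0) (at y within S)"
    by (simp add: tendsto_norm_zero_iff LIM_zero_iff)
  also have "\<dots> \<longleftrightarrow>
    ((\<lambda>z. norm (f z - f y - (z - y) *\<^sub>R D) / norm (z - y)) \<longlongrightarrow> 0) (at y within S)"
  proof (rule filterlim_cong[OF refl refl])
    show "\<forall>\<^sub>F z in at y within S. norm ((f z - f y) /\<^sub>R (z - y) - D)
        = norm (f z - f y - (z - y) *\<^sub>R D) / norm (z - y)"
      unfolding eventually_at_filter
    proof (intro always_eventually allI impI)
      fix z assume "z \<noteq> y"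
      then have "(f z - f y) /\<^sub>R (z - y) - D = (f z - f y - (z - y) *\<^sub>R D) /\<^sub>R (z - y)"
        by (simp add: scaleR_diff_right)
      then show "norm ((f z - f y) /\<^sub>R (z - y) - D) = norm (f z - f y - (z - y) *\<^sub>R D) / norm (z - y)"
        by (simp add: divide_inverse mult.commute)
    qed
  qed
  finally show ?thesis
    by (simp add: has_vector_derivative_def has_derivative_iff_norm bounded_linear_scaleR_left)
qed

lemma rapid_open_measurable:
  assumes "rapid_open k" and [measurable]: "c \<in> borel_measurable borel"
  shows "(\<lambda>x. indicator {0<..} x *\<^sub>R (of_real (c x) * k x)) \<in> borel_measurable borel"
proof -
  have [measurable]: "(\<lambda>x. indicator {0<..} x *\<^sub>R k x) \<in> borel_measurable borel"
    using assms(1) unfolding rapid_open_def by (intro borel_measurable_continuous_on_indicator) auto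
  have "(\<lambda>x. of_real (c x) * (indicator {0<..} x *\<^sub>R k x)) \<in> borel_measurable borel"
    by measurable
  then show ?thesis by (simp add: mult_ac)
qed

text \<open>Dominated convergence along sequences: by \<open>bes_lipschitz\<close> the quotients of
  the integrand are at most \<open>x |k x|\<close>. Sequences inside the half-line also cover the
  one-sided derivative at \<open>y = 0\<close>.\<close>

lemma hankel_has_vector_derivative:
  assumes k: "rapid_open k" and y: "y \<ge> 0"
  shows "(hankel m k has_vector_derivative hankel (Suc m) (\<lambda>x. - (of_real x * k x)) y) (at y within {0..})"
proof -
  let ?D = "hankel (Suc m) (\<lambda>x. - (of_real x * k x)) y"
  have "((\<lambda>z. (hankel m k z - hankel m k y) /\<^sub>R (z - y)) \<longlongrightarrow> ?D) (at y within {0..})"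
    unfolding tendsto_at_iff_sequentially comp_def
  proof (intro allI impI)
    fix X :: "nat \<Rightarrow> real" assume X: "\<forall>i. X i \<in> {0..} - {y}" "X \<longlonglongrightarrow> y"
    let ?s = "\<lambda>i x. indicator {0<..} x *\<^sub>R (of_real ((bes m (x * X i) - bes m (x * y)) / (X i - y)) * k x)"
    have "(\<lambda>i. \<integral>x. ?s i x \<partial>lborel) \<longlonglongrightarrow>
      (\<integral>x. indicator {0<..} x *\<^sub>R (of_real (bes (Suc m) (x * y)) * - (of_real x * k x)) \<partial>lborel)"
    proof (rule integral_dominated_convergence)
      show "?s i \<in> borel_measurable lborel" for i
        using rapid_open_measurable[OF k, of "\<lambda>x. (bes m (x * X i) - bes m (x * y)) / (X i - y)"] by simp
      show "(\<lambda>x. indicator {0<..} x *\<^sub>R (of_real (bes (Suc m) (x * y)) * - (of_real x * k x)))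
          \<in> borel_measurable lborel"
        using rapid_open_measurable[OF k, of "\<lambda>x. - bes (Suc m) (x * y) * x"] by (simp add: mult.assoc)
      show "integrable lborel (\<lambda>x. norm (indicator {0<..} x *\<^sub>R (of_real x * k x)))"
        using rapid_open_integrable[OF rapid_open_times_x[OF k]]
        unfolding set_integrable_def by (rule integrable_norm)
      show "AE x in lborel. norm (?s i x) \<le> norm (indicator {0<..} x *\<^sub>R (of_real x * k x))" for i
      proof (intro AE_I2)
        fix x :: real
        have "X i \<ge> 0" "X i \<noteq> y" using X by auto
        show "norm (?s i x) \<le> norm (indicator {0<..} x *\<^sub>R (of_real x * k x))"
        proof (cases "x > 0")
          case True
          then have "\<bar>bes m (x * X i) - bes m (x * y)\<bar> \<le> x * \<bar>X i - y\<bar>"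
            using bes_lipschitz[of "x * X i" "x * y" m] \<open>X i \<ge> 0\<close> y
            by (simp add: abs_mult flip: right_diff_distrib)
          then have "\<bar>(bes m (x * X i) - bes m (x * y)) / (X i - y)\<bar> \<le> x"
            using \<open>X i \<noteq> y\<close> by (simp add: abs_divide pos_divide_le_eq)
          then show ?thesis
            using True mult_right_mono[of "\<bar>(bes m (x * X i) - bes m (x * y)) / (X i - y)\<bar>" x "norm (k x)"]
            by (simp add: norm_mult del: of_real_diff of_real_divide abs_divide)
        qed simp
      qed
      show "AE x in lborel. (\<lambda>i. ?s i x) \<longlonglongrightarrow>
          indicator {0<..} x *\<^sub>R (of_real (bes (Suc m) (x * y)) * - (of_real x * k x))"
      proof (intro AE_I2)
        fix x :: real
        have "((\<lambda>y. bes m (x * y)) has_real_derivative - bes (Suc m) (x * y) * x) (at y within {0..})"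
          by (rule DERIV_chain2[OF bes_has_real_derivative]) (auto intro!: derivative_eq_intros)
        then have "(\<lambda>i. (bes m (x * X i) - bes m (x * y)) / (X i - y)) \<longlonglongrightarrow> - bes (Suc m) (x * y) * x"
          using X unfolding has_field_derivative_iff tendsto_at_iff_sequentially comp_def by blast
        then have "(\<lambda>i. indicator {0<..} x *\<^sub>R (of_real ((bes m (x * X i) - bes m (x * y)) / (X i - y)) * k x))
            \<longlonglongrightarrow> indicator {0<..} x *\<^sub>R (of_real (- bes (Suc m) (x * y) * x) * k x)"
          by (intro tendsto_intros)
        then show "(\<lambda>i. ?s i x) \<longlonglongrightarrow>
          indicator {0<..} x *\<^sub>R (of_real (bes (Suc m) (x * y)) * - (of_real x * k x))"
          by (simp add: mult_ac)
      qed
    qed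
    moreover have "(\<integral>x. ?s i x \<partial>lborel) = (hankel m k (X i) - hankel m k y) /\<^sub>R (X i - y)" for i
    proof -
      have "X i \<ge> 0" using X by auto
      then have "hankel m k (X i) - hankel m k y
          = (LINT x:{0<..}|lborel. of_real (bes m (x * X i)) * k x - of_real (bes m (x * y)) * k x)"
        unfolding hankel_def by (intro set_integral_diff(2)[symmetric] hankel_integrable k y)
      also have "of_real (1 / (X i - y)) * \<dots> = (\<integral>x. ?s i x \<partial>lborel)"
        unfolding set_integral_mult_right[symmetric] unfolding set_lebesgue_integral_def
        by (intro Bochner_Integration.integral_cong) (auto simp: algebra_simps diff_divide_distrib)
      finally show ?thesis by (simp add: scaleR_conv_of_real divide_inverse)
    qed
    ultimately show "(\<lambda>i. (hankel m k (X i) - hankel m k y) /\<^sub>R (X i - y)) \<longlonglongrightarrow> ?D"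
      unfolding hankel_def set_lebesgue_integral_def by simp
  qed
  then show ?thesis by (simp only: has_vector_derivative_iff_quotient)
qed

text \<open>Smoothness in \<open>y\<close> comes from decay in \<open>x\<close>: each derivative
  costs one factor \<open>x\<close>, and \<open>rapid_open\<close> absorbs it.\<close>

lemma smooth_with_hankel:
  assumes "rapid_open k" shows "smooth_with {0..} (\<lambda>_. True) (hankel m k)"
proof (rule smooth_with_coclosed[where B = "{hankel m k |m k. rapid_open k}"])
  fix f assume "f \<in> {hankel m k |m k. rapid_open k}"
  then obtain m k where f: "f = hankel m k" and k: "rapid_open k" by blast
  have "rapid_open (\<lambda>x. - (of_real x * k x))"
    using rapid_open_mult_left[OF rapid_open_times_x[OF k], of "- 1"] by simp
  then show "\<exists>f'\<in>{hankel m k |m k. rapid_open k}.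
      \<forall>x\<in>{0..}. (f has_vector_derivative f' x) (at x within {0..})"
    unfolding f
    by (intro bexI[of _ "hankel (Suc m) (\<lambda>x. - (of_real x * k x))"] ballI
        hankel_has_vector_derivative k) auto
qed (use assms in auto)

text \<open>The recurrence merges the two terms of the product rule, as in the classical formula for
  the derivative of \<open>x^n J_n(x)\<close>.\<close>

lemma power_bes_has_derivative:
  "((\<lambda>x. x ^ Suc m * bes (Suc m) (x * y)) has_real_derivative x ^ m * bes m (x * y)) (at x)"
proof -
  have "((\<lambda>x. bes (Suc m) (x * y)) has_real_derivative - bes (Suc (Suc m)) (x * y) * y) (at x)"
    by (rule DERIV_chain2[OF bes_has_real_derivative]) (auto intro!: derivative_eq_intros)
  then have "((\<lambda>x. x ^ Suc m * bes (Suc m) (x * y)) has_real_derivative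
      real (Suc m) * x ^ m * bes (Suc m) (x * y) + - bes (Suc (Suc m)) (x * y) * y * x ^ Suc m) (at x)"
    using DERIV_mult[OF DERIV_pow[of "Suc m"]] by fastforce
  moreover have "real (Suc m) * x ^ m * bes (Suc m) (x * y) + - bes (Suc (Suc m)) (x * y) * y * x ^ Suc m
      = x ^ m * (real (Suc m) * bes (Suc m) (x * y) - (x * y) * bes (Suc (Suc m)) (x * y))"
    by (simp add: algebra_simps)
  ultimately show ?thesis
    unfolding bes_recurrence by simp
qed

text \<open>By \<open>power_bes_has_derivative\<close> the kernel with its power of \<open>x\<close>
  has an explicit antiderivative. The boundary terms vanish, at 0 by the positive power of
  \<open>x\<close> and at infinity by the decay of \<open>g\<close>.\<close>

lemma hankel_by_parts:
  assumes g: "half_schwartz g" and g': "half_schwartz g'"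
    and deriv: "\<And>x. x > 0 \<Longrightarrow> (g has_vector_derivative g' x) (at x)" and y: "y \<ge> 0"
  shows "hankel m (\<lambda>x. of_real (x ^ m) * g x) y
    = - hankel (Suc m) (\<lambda>x. of_real (x ^ Suc m) * g' x) y"
proof -
  let ?f1 = "\<lambda>x. complex_of_real (bes m (x * y)) * (of_real (x ^ m) * g x)"
  let ?f2 = "\<lambda>x. complex_of_real (bes (Suc m) (x * y)) * (of_real (x ^ Suc m) * g' x)"
  let ?F = "\<lambda>x. complex_of_real (x ^ Suc m * bes (Suc m) (x * y)) * g x"
  have int: "set_integrable lborel {0<..} ?f1" "set_integrable lborel {0<..} ?f2"
    by (intro hankel_integrable rapid_open_power half_schwartz_rapid_open g g' y)+
  have "(LBINT x=0..\<infinity>. ?f1 x + ?f2 x) = 0 - 0"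
  proof (rule interval_integral_FTC_integrable)
    fix x assume "0 < ereal x"
    then have x: "x > 0" by simp
    show "(?F has_vector_derivative ?f1 x + ?f2 x) (at x)"
      using has_vector_derivative_mult
        [OF has_vector_derivative_of_real[OF power_bes_has_derivative[of m y]] deriv[OF x]]
      by (simp add: algebra_simps)
    have "isCont g x" "isCont g' x"
      using x half_schwartz_continuous[OF g] half_schwartz_continuous[OF g']
      by (auto intro: continuous_on_interior)
    moreover have "isCont (\<lambda>x. bes n (x * y)) x" for n
      using continuous_on_bes[of UNIV "\<lambda>x. x * y" n]
      by (auto simp: continuous_on_eq_continuous_at intro: continuous_intros)
    ultimately show "isCont (\<lambda>x. ?f1 x + ?f2 x) x"
      by (intro continuous_intros)
  next
    have "einterval 0 \<infinity> = {0<..}" by (auto simp: einterval_def)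
    then show "set_integrable lborel (einterval 0 \<infinity>) (\<lambda>x. ?f1 x + ?f2 x)"
      using int by (auto intro: set_integral_add)
  next
    have "continuous_on {0..} ?F"
      by (intro continuous_intros half_schwartz_continuous g)
    then have "(?F \<longlongrightarrow> ?F 0) (at 0 within {0..})"
      unfolding continuous_on_def by (rule bspec) simp
    then have "(?F \<longlongrightarrow> 0) (at_right 0)"
      by (rule tendsto_within_subset[THEN tendsto_eq_rhs]) auto
    then show "((?F \<circ> real_of_ereal) \<longlongrightarrow> 0) (at_right 0)"
      unfolding zero_ereal_def ereal_tendsto_simps .
    have "rapid_top g" by (intro rapid_half_imp_top half_schwartz_rapid g)
    then have lim: "((\<lambda>x. x ^ Suc m *\<^sub>R g x) \<longlongrightarrow> 0) at_top"
      unfolding rapid_top_def by blast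
    have "(?F \<longlongrightarrow> 0) at_top"
    proof (rule Lim_null_comparison[OF _ tendsto_norm_zero[OF lim]])
      show "\<forall>\<^sub>F x in at_top. norm (?F x) \<le> norm (x ^ Suc m *\<^sub>R g x)"
        using eventually_ge_at_top[of 0]
      proof eventually_elim
        case (elim x)
        then have "\<bar>bes (Suc m) (x * y)\<bar> \<le> 1" using y by (intro abs_bes_le_1) auto
        then have "(\<bar>x\<bar> ^ Suc m * norm (g x)) * \<bar>bes (Suc m) (x * y)\<bar> \<le> \<bar>x\<bar> ^ Suc m * norm (g x)"
          by (intro mult_right_le_one_le) auto
        then show ?case by (simp add: norm_mult norm_power mult_ac abs_mult power_abs)
      qed
    qed
    then show "((?F \<circ> real_of_ereal) \<longlongrightarrow> 0) (at_left \<infinity>)"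
      unfolding ereal_tendsto_simps .
  qed simp
  also have "(LBINT x=0..\<infinity>. ?f1 x + ?f2 x) = (LINT x:{0<..}|lborel. ?f1 x + ?f2 x)"
    unfolding zero_ereal_def by (rule interval_integral_to_infinity_eq)
  also have "\<dots> = hankel m (\<lambda>x. of_real (x ^ m) * g x) y + hankel (Suc m) (\<lambda>x. of_real (x ^ Suc m) * g' x) y"
    unfolding hankel_def by (rule set_integral_add(2)[OF int])
  finally show ?thesis by (simp add: add_eq_0_iff2)
qed

text \<open>Two integrations by parts raise the order by 2, and the recurrence lowers it again.\<close>

lemma hankel_times_y:
  assumes g: "half_schwartz g"
  obtains g1 g2 where "half_schwartz g1" "half_schwartz g2"
    "\<And>y. y \<ge> 0 \<Longrightarrow> of_real y * hankel m (\<lambda>x. of_real (x ^ m) * g x) y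
      = hankel (Suc m) (\<lambda>x. of_real (x ^ Suc m) * g1 x) y + hankel m (\<lambda>x. of_real (x ^ m) * g2 x) y"
proof -
  obtain g' where g': "half_schwartz g'" "\<And>x. x > 0 \<Longrightarrow> (g has_vector_derivative g' x) (at x)"
    by (rule half_schwartz_derivative[OF g]) blast
  obtain g'' where g'': "half_schwartz g''" "\<And>x. x > 0 \<Longrightarrow> (g' has_vector_derivative g'' x) (at x)"
    by (rule half_schwartz_derivative[OF g'(1)]) blast
  \<comment> \<open>The recurrence at \<open>x y\<close> splits \<open>y x B_(m+2)\<close>: its
    factor \<open>m + 1\<close> goes into \<open>g1\<close>, its sign and the spare factor
    \<open>x\<close> into \<open>g2\<close>.\<close>
  define g1 where "g1 x = of_real (real (Suc m)) * g'' x" for x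
  define g2 where "g2 x = - 1 * (of_real x * g'' x)" for x
  have hs: "half_schwartz g1" "half_schwartz g2"
    unfolding g1_def g2_def by (intro half_schwartz_mult_left half_schwartz_times_x g'')+
  show ?thesis
  proof (rule that[OF hs])
    fix y :: real assume y: "y \<ge> 0"
    have "hankel m (\<lambda>x. of_real (x ^ m) * g x) y
        = hankel (Suc (Suc m)) (\<lambda>x. of_real (x ^ Suc (Suc m)) * g'' x) y"
      using hankel_by_parts[OF g g' y, of m] hankel_by_parts[OF g'(1) g'' y, of "Suc m"] by (simp only: minus_minus)
    then have "of_real y * hankel m (\<lambda>x. of_real (x ^ m) * g x) y = (LINT x:{0<..}|lborel.
        of_real y * (of_real (bes (Suc (Suc m)) (x * y)) * (of_real (x ^ Suc (Suc m)) * g'' x)))"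
      by (simp add: hankel_def)
    also have "\<dots> = (LINT x:{0<..}|lborel. of_real (bes (Suc m) (x * y)) * (of_real (x ^ Suc m) * g1 x)
        + of_real (bes m (x * y)) * (of_real (x ^ m) * g2 x))"
    proof (rule set_lebesgue_integral_cong)
      show "\<forall>x. x \<in> {0<..} \<longrightarrow>
        of_real y * (of_real (bes (Suc (Suc m)) (x * y)) * (of_real (x ^ Suc (Suc m)) * g'' x))
        = of_real (bes (Suc m) (x * y)) * (of_real (x ^ Suc m) * g1 x)
        + of_real (bes m (x * y)) * (of_real (x ^ m) * g2 x)"
      proof (intro allI impI)
        fix x :: real
        have "of_real y * (of_real (bes (Suc (Suc m)) (x * y)) * (of_real (x ^ Suc (Suc m)) * g'' x))
            = of_real (x ^ Suc m * (x * y * bes (Suc (Suc m)) (x * y))) * g'' x"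
          by (simp add: algebra_simps)
        also have "\<dots> = of_real (bes (Suc m) (x * y)) * (of_real (x ^ Suc m) * g1 x)
            + of_real (bes m (x * y)) * (of_real (x ^ m) * g2 x)"
          unfolding bes_recurrence g1_def g2_def by (simp add: algebra_simps)
        finally show "of_real y * (of_real (bes (Suc (Suc m)) (x * y)) * (of_real (x ^ Suc (Suc m)) * g'' x))
          = of_real (bes (Suc m) (x * y)) * (of_real (x ^ Suc m) * g1 x)
          + of_real (bes m (x * y)) * (of_real (x ^ m) * g2 x)" .
      qed
    qed auto
    also have "\<dots> = hankel (Suc m) (\<lambda>x. of_real (x ^ Suc m) * g1 x) y + hankel m (\<lambda>x. of_real (x ^ m) * g2 x) y"
      unfolding hankel_def
      by (intro set_integral_add(2) hankel_integrable rapid_open_power half_schwartz_rapid_open hs y)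
    finally show "of_real y * hankel m (\<lambda>x. of_real (x ^ m) * g x) y
      = hankel (Suc m) (\<lambda>x. of_real (x ^ Suc m) * g1 x) y + hankel m (\<lambda>x. of_real (x ^ m) * g2 x) y" .
  qed
qed

lemma rapid_half_hankel:
  assumes "half_schwartz g"
  shows "rapid_half (hankel m (\<lambda>x. of_real (x ^ m) * g x))"
  unfolding rapid_half_def
proof
  fix N
  show "\<exists>C. \<forall>y\<ge>0. y ^ N * norm (hankel m (\<lambda>x. of_real (x ^ m) * g x) y) \<le> C"
    using assms
  \<comment> \<open>The order is generalised because one multiplication by \<open>y\<close> yields
    transforms of orders \<open>m\<close> and \<open>m + 1\<close>.\<close>
  proof (induction N arbitrary: m g)
    case 0
    then show ?case using hankel_bounded[OF rapid_open_power[OF half_schwartz_rapid_open]] by simp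
  next
    case (Suc N)
    obtain g1 g2 where g: "half_schwartz g1" "half_schwartz g2"
      and eq: "\<And>y. y \<ge> 0 \<Longrightarrow> of_real y * hankel m (\<lambda>x. of_real (x ^ m) * g x) y
      = hankel (Suc m) (\<lambda>x. of_real (x ^ Suc m) * g1 x) y + hankel m (\<lambda>x. of_real (x ^ m) * g2 x) y"
      by (rule hankel_times_y[OF Suc.prems, of m]) blast
    obtain A where A: "\<And>y. y \<ge> 0 \<Longrightarrow> y ^ N * norm (hankel (Suc m) (\<lambda>x. of_real (x ^ Suc m) * g1 x) y) \<le> A"
      using Suc.IH[OF g(1)] by blast
    obtain B where B: "\<And>y. y \<ge> 0 \<Longrightarrow> y ^ N * norm (hankel m (\<lambda>x. of_real (x ^ m) * g2 x) y) \<le> B"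
      using Suc.IH[OF g(2)] by blast
    show ?case
    proof (intro exI[of _ "A + B"] allI impI)
      fix y :: real assume y: "y \<ge> 0"
      have "y ^ Suc N * norm (hankel m (\<lambda>x. of_real (x ^ m) * g x) y)
          = y ^ N * norm (of_real y * hankel m (\<lambda>x. of_real (x ^ m) * g x) y)"
        using y by (simp add: norm_mult)
      also have "\<dots> \<le> y ^ N * (norm (hankel (Suc m) (\<lambda>x. of_real (x ^ Suc m) * g1 x) y)
          + norm (hankel m (\<lambda>x. of_real (x ^ m) * g2 x) y))"
        unfolding eq[OF y] using y by (intro mult_left_mono norm_triangle_ineq) auto
      also have "\<dots> \<le> A + B"
        using A[OF y] B[OF y] by (simp add: distrib_left)
      finally show "y ^ Suc N * norm (hankel m (\<lambda>x. of_real (x ^ m) * g x) y) \<le> A + B" .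
    qed
  qed
qed

text \<open>A derivative raises the order and the power of \<open>x\<close> together, so the
  transforms in which both agree form a closed family.\<close>

lemma half_schwartz_hankel:
  assumes "half_schwartz g"
  shows "half_schwartz (hankel m (\<lambda>x. of_real (x ^ m) * g x))"
proof (rule smooth_with_coclosed[where B = "{hankel m (\<lambda>x. of_real (x ^ m) * g x) |m g. half_schwartz g}"])
  fix f assume "f \<in> {hankel m (\<lambda>x. of_real (x ^ m) * g x) |m g. half_schwartz g}"
  then obtain m g where f: "f = hankel m (\<lambda>x. of_real (x ^ m) * g x)" and g: "half_schwartz g" by blast
  show "rapid_half f" unfolding f by (rule rapid_half_hankel[OF g])
  have "half_schwartz (\<lambda>x. - 1 * g x)" by (rule half_schwartz_mult_left[OF g])
  moreover have "(\<lambda>x. - (of_real x * (of_real (x ^ m) * g x))) = (\<lambda>x. of_real (x ^ Suc m) * (- 1 * g x))"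
    by (simp add: mult_ac)
  ultimately show "\<exists>f'\<in>{hankel m (\<lambda>x. of_real (x ^ m) * g x) |m g. half_schwartz g}.
      \<forall>x\<in>{0..}. (f has_vector_derivative f' x) (at x within {0..})"
    unfolding f
    using hankel_has_vector_derivative[OF rapid_open_power[OF half_schwartz_rapid_open[OF g]], of _ m m]
    by (intro bexI[of _ "hankel (Suc m) (\<lambda>x. of_real (x ^ Suc m) * (- 1 * g x))"] ballI CollectI
        exI[of _ "Suc m"] exI[of _ "\<lambda>x. - 1 * g x"]) (simp_all only: atLeast_iff refl simp_thms)
qed (use assms in blast)

section \<open>The measure \<open>dx/|x|\<close>\<close>

lemma sets_mult_haar [simp, measurable_cong]: "sets mult_haar = sets borel"
  by (simp add: mult_haar_def)

lemma space_mult_haar [simp]: "space mult_haar = UNIV"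
  by (simp add: mult_haar_def)

text \<open>The density is positive off 0. At 0 it vanishes by the convention
  \<open>1 / 0 = 0\<close>, but a single point is a null set.\<close>

lemma AE_mult_haar_iff: "(AE x in mult_haar. P x) \<longleftrightarrow> (AE x in lborel. P x)"
proof -
  have "(AE x in mult_haar. P x) \<longleftrightarrow> (AE x in lborel. 0 < ennreal (1 / \<bar>x\<bar>) \<longrightarrow> P x)"
    unfolding mult_haar_def by (rule AE_density) measurable
  also have "\<dots> \<longleftrightarrow> (AE x in lborel. P x)"
  proof
    assume "AE x in lborel. 0 < ennreal (1 / \<bar>x\<bar>) \<longrightarrow> P x"
    then show "AE x in lborel. P x"
      using AE_lborel_singleton[of 0] by eventually_elim auto
  qed auto
  finally show ?thesis .
qed

lemma integral_mult_haar:
  fixes f :: "real \<Rightarrow> 'a :: {banach, second_countable_topology}"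
  assumes "f \<in> borel_measurable borel"
  shows "(\<integral>x. f x \<partial>mult_haar) = (\<integral>x. (1 / \<bar>x\<bar>) *\<^sub>R f x \<partial>lborel)"
  unfolding mult_haar_def using assms by (intro integral_density) auto

lemma integrable_mult_haar_iff:
  fixes f :: "real \<Rightarrow> 'a :: {banach, second_countable_topology}"
  assumes "f \<in> borel_measurable borel"
  shows "integrable mult_haar f \<longleftrightarrow> integrable lborel (\<lambda>x. (1 / \<bar>x\<bar>) *\<^sub>R f x)"
  unfolding mult_haar_def using assms by (intro integrable_density) auto

lemma integral_mult_haar_scale:
  fixes f :: "real \<Rightarrow> 'a :: {banach, second_countable_topology}"
  assumes "f \<in> borel_measurable borel" "c \<noteq> 0"
  shows "(\<integral>x. f (c * x) \<partial>mult_haar) = (\<integral>x. f x \<partial>mult_haar)"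
proof -
  have "(\<integral>x. f x \<partial>mult_haar) = \<bar>c\<bar> *\<^sub>R (\<integral>x. (1 / \<bar>0 + c * x\<bar>) *\<^sub>R f (0 + c * x) \<partial>lborel)"
    unfolding integral_mult_haar[OF assms(1)] by (rule lborel_integral_real_affine[OF assms(2)])
  also have "\<dots> = (\<integral>x. (1 / \<bar>x\<bar>) *\<^sub>R f (c * x) \<partial>lborel)"
    using assms(2) by (subst integral_scaleR_right[symmetric]) (simp add: abs_mult)
  also have "\<dots> = (\<integral>x. f (c * x) \<partial>mult_haar)"
    by (intro integral_mult_haar[symmetric] measurable_compose[OF _ assms(1)]) measurable
  finally show ?thesis ..
qed

lemma integrable_mult_haar_scale:
  fixes f :: "real \<Rightarrow> 'a :: {banach, second_countable_topology}"
  assumes "f \<in> borel_measurable borel" "c \<noteq> 0" "integrable mult_haar f"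
  shows "integrable mult_haar (\<lambda>x. f (c * x))"
proof -
  have "integrable lborel (\<lambda>x. (1 / \<bar>0 + c * x\<bar>) *\<^sub>R f (0 + c * x))"
    by (rule lborel_integrable_real_affine[OF _ assms(2)])
      (use assms(3) integrable_mult_haar_iff[OF assms(1)] in simp)
  then have "integrable lborel (\<lambda>x. \<bar>c\<bar> *\<^sub>R ((1 / \<bar>0 + c * x\<bar>) *\<^sub>R f (0 + c * x)))"
    by (rule integrable_scaleR_right)
  moreover have "(\<lambda>x. f (c * x)) \<in> borel_measurable borel"
    by (intro measurable_compose[OF _ assms(1)]) measurable
  ultimately show ?thesis
    using assms(2) by (simp add: integrable_mult_haar_iff abs_mult)
qed

lemma AE_lborel_scale:
  assumes "AE x in lborel. P x" "(c::real) \<noteq> 0"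
  shows "AE x in lborel. P (c * x)"
proof -
  obtain N where "{x \<in> space lborel. \<not> P x} \<subseteq> N" "emeasure lborel N = 0" "N \<in> sets lborel"
    by (rule AE_E[OF assms(1)]) blast
  then have N: "N \<in> sets borel" "emeasure lborel N = 0" "\<And>x. x \<notin> N \<Longrightarrow> P x" by auto
  then have "N \<in> null_sets lborel" by (auto simp: null_sets_def)
  then have "AE x in lborel. x \<notin> N" by (rule AE_not_in)
  then have "AE x in lborel. 0 + c * x \<notin> N"
    using N(1) assms(2) by (intro AE_borel_affine) auto
  then show ?thesis by eventually_elim (use N(3) in auto)
qed

lemma square_integrable_scale_arg:
  assumes "square_integrable f" "c \<noteq> 0" shows "square_integrable (\<lambda>x. f (c * x))"
  using assms integrable_mult_haar_scale[of "\<lambda>x. (cmod (f x))\<^sup>2" c]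
  by (auto simp: square_integrable_def)

lemma integral_mult_haar_half:
  fixes F :: "real \<Rightarrow> complex"
  assumes F: "F \<in> borel_measurable borel" and s: "\<bar>s\<bar> = 1"
    and 0: "\<And>x. x < 0 \<Longrightarrow> F (s * x) = 0"
  shows "(\<integral>x. F x \<partial>mult_haar) = (LINT x:{0<..}|lborel. F (s * x) / of_real x)"
proof -
  have "(\<integral>x. F x \<partial>mult_haar) = (\<integral>x. F (s * x) \<partial>mult_haar)"
    using s by (intro integral_mult_haar_scale[symmetric] F) auto
  also have "\<dots> = (\<integral>x. (1 / \<bar>x\<bar>) *\<^sub>R F (s * x) \<partial>lborel)"
    by (rule integral_mult_haar) (use F in measurable)
  also have "\<dots> = (LINT x:{0<..}|lborel. F (s * x) / of_real x)"
    unfolding set_lebesgue_integral_def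
  proof (rule Bochner_Integration.integral_cong)
    fix x :: real
    show "(1 / \<bar>x\<bar>) *\<^sub>R F (s * x) = indicator {0<..} x *\<^sub>R (F (s * x) / of_real x)"
      using 0[of x] by (cases "x > 0"; cases "x = 0") (auto simp: scaleR_conv_of_real divide_inverse)
  qed simp
  finally show ?thesis .
qed

lemma borel_measurable_bessel_kernel [measurable]: "bessel_kernel d \<in> borel_measurable borel"
proof -
  have "bessel_kernel d = (\<lambda>x. if x > 0 then \<i> powi (- (int d + 1)) * of_real (sqrt x ^ (d + 1) * bes d x) else 0)"
    using bessel_kernel_eq[of _ d] by (auto simp: bessel_kernel_def)
  also have "\<dots> \<in> borel_measurable borel" by measurable
  finally show ?thesis .
qed

text \<open>The kernel vanishes unless \<open>x\<close> has the sign of \<open>y\<close>, so each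
  half-line is transformed into itself. The weight is multiplicative, which splits the factor in
  \<open>y\<close> off the kernel.\<close>

lemma bessel_transform_eq:
  assumes f: "f \<in> borel_measurable borel" and y: "y \<noteq> 0"
  shows "(\<integral>x. f x * bessel_kernel d (x * y) \<partial>mult_haar)
    = \<i> powi (- (int d + 1)) * of_real (weight d y) *
      hankel d (\<lambda>x. f (sgn y * x) * of_real (weight d x / x)) \<bar>y\<bar>"
proof -
  have "(\<integral>x. f x * bessel_kernel d (x * y) \<partial>mult_haar)
      = (LINT x:{0<..}|lborel. f (sgn y * x) * bessel_kernel d (sgn y * x * y) / of_real x)"
  proof (rule integral_mult_haar_half)
    show "(\<lambda>x. f x * bessel_kernel d (x * y)) \<in> borel_measurable borel"
      using f by measurable
    show "f (sgn y * x) * bessel_kernel d (sgn y * x * y) = 0" if "x < 0" for x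
    proof -
      have "sgn y * x * y = \<bar>y\<bar> * x" by (simp add: abs_sgn mult_ac)
      also have "\<dots> \<le> 0" using that by (simp add: mult_nonneg_nonpos)
      finally show ?thesis by (simp add: bessel_kernel_def)
    qed
  qed (use y in \<open>auto simp: abs_sgn_eq\<close>)
  also have "\<dots> = (LINT x:{0<..}|lborel. (\<i> powi (- (int d + 1)) * of_real (weight d y)) *
      (of_real (bes d (x * \<bar>y\<bar>)) * (f (sgn y * x) * of_real (weight d x / x))))"
  proof (rule set_lebesgue_integral_cong)
    show "\<forall>x. x \<in> {0<..} \<longrightarrow> f (sgn y * x) * bessel_kernel d (sgn y * x * y) / of_real x
      = (\<i> powi (- (int d + 1)) * of_real (weight d y)) *
      (of_real (bes d (x * \<bar>y\<bar>)) * (f (sgn y * x) * of_real (weight d x / x)))"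
    proof (intro allI impI)
      fix x :: real assume "x \<in> {0<..}"
      then have x: "x > 0" by simp
      have *: "sgn y * x * y = x * \<bar>y\<bar>" by (simp add: abs_sgn mult_ac)
      have "bessel_kernel d (sgn y * x * y)
          = \<i> powi (- (int d + 1)) * of_real (weight d x * weight d y * bes d (x * \<bar>y\<bar>))"
        unfolding * using x y
        by (subst bessel_kernel_eq) (auto simp: weight_def real_sqrt_mult power_mult_distrib)
      then show "f (sgn y * x) * bessel_kernel d (sgn y * x * y) / of_real x
        = (\<i> powi (- (int d + 1)) * of_real (weight d y)) *
        (of_real (bes d (x * \<bar>y\<bar>)) * (f (sgn y * x) * of_real (weight d x / x)))"
        by (simp add: mult_ac)
    qed
  qed simp
  also have "\<dots> = \<i> powi (- (int d + 1)) * of_real (weight d y) *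
      hankel d (\<lambda>x. f (sgn y * x) * of_real (weight d x / x)) \<bar>y\<bar>"
    unfolding hankel_def by (rule set_integral_mult_right)
  finally show ?thesis .
qed

section \<open>Representatives of classes\<close>

lemma represents_exists: "square_integrable f \<Longrightarrow> \<exists>v. represents f v"
  by transfer (auto simp: l2_rel_def)

lemma represents_ex: "\<exists>f. represents f v"
  by transfer (auto simp: l2_rel_def)

lemma represents_unique: "represents f v \<Longrightarrow> represents f w \<Longrightarrow> v = w"
  by transfer (auto simp: l2_rel_def elim: eventually_elim2)

lemma represents_square_integrable: "represents f v \<Longrightarrow> square_integrable f"
  by transfer (auto simp: l2_rel_def)

lemma represents_measurable: "represents f v \<Longrightarrow> f \<in> borel_measurable borel"
  using represents_square_integrable by (auto simp: square_integrable_def)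

lemma represents_AE: "represents f v \<Longrightarrow> represents g v \<Longrightarrow> AE x in lborel. f x = g x"
  unfolding AE_mult_haar_iff[symmetric]
  by transfer (auto simp: l2_rel_def elim: eventually_elim2)

lemma represents_cong_AE:
  assumes "represents f v" "g \<in> borel_measurable borel" "AE x in lborel. f x = g x"
  shows "represents g v"
proof -
  have AE: "AE x in mult_haar. f x = g x" using assms(3) by (simp add: AE_mult_haar_iff)
  have "square_integrable f" by (rule represents_square_integrable[OF assms(1)])
  moreover have "integrable mult_haar (\<lambda>x. (cmod (f x))\<^sup>2) \<longleftrightarrow> integrable mult_haar (\<lambda>x. (cmod (g x))\<^sup>2)"
    using assms(2) represents_measurable AE calculation
    by (intro integrable_cong_AE) (auto simp: square_integrable_def)
  ultimately have "square_integrable g"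
    using assms(2) by (simp add: square_integrable_def)
  with assms(1) AE show ?thesis
    by transfer (auto simp: l2_rel_def elim: eventually_elim2)
qed

lemma represents_add: "represents f v \<Longrightarrow> represents g w \<Longrightarrow> represents (\<lambda>x. f x + g x) (v + w)"
  by transfer (auto simp: l2_rel_def square_integrable_add elim: eventually_elim2)

lemma represents_scaleC: "represents f v \<Longrightarrow> represents (\<lambda>x. c * f x) (scaleC_l2 c v)"
  by transfer (auto simp: l2_rel_def square_integrable_scale elim: eventually_mono)

lemma represents_scaleR: "represents f v \<Longrightarrow> represents (\<lambda>x. of_real c * f x) (c *\<^sub>R v)"
  by transfer (auto simp: l2_rel_def square_integrable_scale elim: eventually_mono)

lemma represents_diff:
  assumes "represents f v" "represents g w" shows "represents (\<lambda>x. f x - g x) (v - w)"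
  using represents_add[OF assms(1) represents_scaleR[OF assms(2), of "- 1"]] by simp

lemma represents_inner:
  "represents f v \<Longrightarrow> represents g w \<Longrightarrow> inner v w = Re (\<integral>x. f x * cnj (g x) \<partial>mult_haar)"
proof transfer
  fix f g v w :: "real \<Rightarrow> complex"
  assume *: "l2_rel v v" "l2_rel w w" "square_integrable f \<and> (AE x in mult_haar. f x = v x)"
    "square_integrable g \<and> (AE x in mult_haar. g x = w x)"
  then have AE: "AE x in mult_haar. v x * cnj (w x) = f x * cnj (g x)"
    by (auto elim: eventually_elim2)
  have "(\<integral>x. v x * cnj (w x) \<partial>mult_haar) = (\<integral>x. f x * cnj (g x) \<partial>mult_haar)"
    using * AE borel_measurable_integrable[OF integrable_mult_cnj]
    by (intro integral_cong_AE) (auto simp: l2_rel_def)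
  then show "Re (\<integral>x. v x * cnj (w x) \<partial>mult_haar) = Re (\<integral>x. f x * cnj (g x) \<partial>mult_haar)" by simp
qed

lemma represents_norm:
  assumes "represents f v" shows "(norm v)\<^sup>2 = (\<integral>x. (cmod (f x))\<^sup>2 \<partial>mult_haar)"
proof -
  have "(norm v)\<^sup>2 = Re (\<integral>x. f x * cnj (f x) \<partial>mult_haar)"
    unfolding power2_norm_eq_inner by (rule represents_inner[OF assms assms])
  also have "(\<lambda>x. f x * cnj (f x)) = (\<lambda>x. of_real ((cmod (f x))\<^sup>2))"
    by (simp add: complex_norm_square fun_eq_iff del: of_real_power)
  finally show ?thesis by (simp del: of_real_power)
qed

lemma represents_norm_scaled:
  assumes f: "represents f v" and g: "represents g w" and C: "C \<ge> 0"
    and eq: "\<And>x. x \<noteq> 0 \<Longrightarrow> cmod (f x) = C * cmod (g x)"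
  shows "norm v = C * norm w"
proof -
  have "AE x in mult_haar. (cmod (f x))\<^sup>2 = C\<^sup>2 * (cmod (g x))\<^sup>2"
    unfolding AE_mult_haar_iff using AE_lborel_singleton[of 0]
    by eventually_elim (simp add: eq power_mult_distrib)
  then have "(norm v)\<^sup>2 = (\<integral>x. C\<^sup>2 * (cmod (g x))\<^sup>2 \<partial>mult_haar)"
    unfolding represents_norm[OF f] using f g represents_measurable
    by (intro integral_cong_AE) auto
  also have "\<dots> = (C * norm w)\<^sup>2"
    by (simp add: represents_norm[OF g] power_mult_distrib)
  finally show ?thesis using C by (simp add: power2_eq_iff_nonneg)
qed

lemma norm_scaleC_l2: "norm (scaleC_l2 c v) = cmod c * norm v"
proof -
  obtain f where "represents f v" using represents_ex by blast
  from represents_norm_scaled[OF represents_scaleC[OF this] this, of "cmod c"]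
  show ?thesis by (simp add: norm_mult)
qed

lemma scaleC_l2_add_left: "scaleC_l2 (a + b) v = scaleC_l2 a v + scaleC_l2 b v"
  by transfer (auto simp: l2_rel_def square_integrable_add square_integrable_scale distrib_right)

lemma scaleC_l2_scaleR: "scaleC_l2 (of_real r) v = r *\<^sub>R v"
  by transfer (auto simp: l2_rel_def square_integrable_scale)

lemma scaleC_l2_scaleC: "scaleC_l2 a (scaleC_l2 b v) = scaleC_l2 (a * b) v"
  by transfer (auto simp: l2_rel_def square_integrable_scale mult.assoc)

lemma scaleC_l2_one [simp]: "scaleC_l2 1 v = v"
  by transfer (auto simp: l2_rel_def square_integrable_scale)

lemma bounded_linear_scaleC_l2_left: "bounded_linear (\<lambda>c. scaleC_l2 c v)"
proof (rule bounded_linear_intro[of _ "norm v"])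
  show "scaleC_l2 (r *\<^sub>R c) v = r *\<^sub>R scaleC_l2 c v" for r c
    by (simp add: scaleC_l2_scaleC scaleR_conv_of_real flip: scaleC_l2_scaleR)
qed (simp_all add: scaleC_l2_add_left norm_scaleC_l2)

lemma represents_nn_integral:
  assumes "represents f v"
  shows "(\<integral>\<^sup>+x. ennreal ((cmod (f x))\<^sup>2) \<partial>mult_haar) = ennreal ((norm v)\<^sup>2)"
  unfolding represents_norm[OF assms]
  using represents_square_integrable[OF assms]
  by (intro nn_integral_eq_integral) (auto simp: square_integrable_def)

text \<open>Fatou's lemma bounds the square norm of \<open>g - f\<close> by the limit of the square
  norms of \<open>V n - v\<close>, which is 0. This identifies a limit in norm with a pointwise one,
  and no subsequence has to be extracted.\<close>

lemma represents_limit_AE: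
  assumes V: "\<And>n. represents (F n) (V n)" "V \<longlonglongrightarrow> v" and f: "represents f v"
    and g: "g \<in> borel_measurable borel" "AE x in lborel. (\<lambda>n. F n x) \<longlonglongrightarrow> g x"
  shows "AE x in lborel. f x = g x"
proof -
  have meas: "F n \<in> borel_measurable borel" "f \<in> borel_measurable borel" for n
    using V f represents_measurable by blast+
  have "(\<integral>\<^sup>+x. ennreal ((cmod (g x - f x))\<^sup>2) \<partial>mult_haar)
      = (\<integral>\<^sup>+x. liminf (\<lambda>n. ennreal ((cmod (F n x - f x))\<^sup>2)) \<partial>mult_haar)"
  proof (rule nn_integral_cong_AE)
    show "AE x in mult_haar. ennreal ((cmod (g x - f x))\<^sup>2) = liminf (\<lambda>n. ennreal ((cmod (F n x - f x))\<^sup>2))"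
      unfolding AE_mult_haar_iff using g(2)
    proof eventually_elim
      case (elim x)
      then have "(\<lambda>n. ennreal ((cmod (F n x - f x))\<^sup>2)) \<longlonglongrightarrow> ennreal ((cmod (g x - f x))\<^sup>2)"
        by (intro tendsto_intros)
      then show ?case by (rule lim_imp_Liminf[symmetric, rotated]) simp
    qed
  qed
  also have "\<dots> \<le> liminf (\<lambda>n. \<integral>\<^sup>+x. ennreal ((cmod (F n x - f x))\<^sup>2) \<partial>mult_haar)"
    by (rule nn_integral_liminf) (use meas in measurable)
  also have "\<dots> = liminf (\<lambda>n. ennreal ((norm (V n - v))\<^sup>2))"
    using represents_nn_integral[OF represents_diff[OF V(1) f]] by simp
  also have "\<dots> = ennreal ((norm (v - v))\<^sup>2)"
    by (intro lim_imp_Liminf tendsto_intros V) simp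
  finally have "(\<integral>\<^sup>+x. ennreal ((cmod (g x - f x))\<^sup>2) \<partial>mult_haar) = 0" by simp
  then have "AE x in mult_haar. ennreal ((cmod (g x - f x))\<^sup>2) = 0"
    using meas g(1) by (subst (asm) nn_integral_0_iff_AE) auto
  then show ?thesis unfolding AE_mult_haar_iff by eventually_elim (auto simp: ennreal_eq_0_iff)
qed

lemma represents_dominated_convergence:
  assumes V: "\<And>n. represents (F n) (V n)" and f: "represents f v"
    and lim: "\<And>x. x \<noteq> 0 \<Longrightarrow> (\<lambda>n. F n x) \<longlonglongrightarrow> f x"
    and bound: "\<And>n x. x \<noteq> 0 \<Longrightarrow> cmod (F n x - f x) \<le> cmod (f x)"
  shows "V \<longlonglongrightarrow> v"
proof -
  have meas: "F n \<in> borel_measurable borel" "f \<in> borel_measurable borel" for n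
    using V f represents_measurable by blast+
  have "(\<lambda>n. \<integral>x. (cmod (F n x - f x))\<^sup>2 \<partial>mult_haar) \<longlonglongrightarrow> (\<integral>x. 0 \<partial>mult_haar)"
  proof (rule integral_dominated_convergence)
    show "integrable mult_haar (\<lambda>x. (cmod (f x))\<^sup>2)"
      using represents_square_integrable[OF f] by (simp add: square_integrable_def)
    show "AE x in mult_haar. (\<lambda>n. (cmod (F n x - f x))\<^sup>2) \<longlonglongrightarrow> 0"
      unfolding AE_mult_haar_iff using AE_lborel_singleton[of 0]
    proof eventually_elim
      case (elim x)
      then have "(\<lambda>n. (cmod (F n x - f x))\<^sup>2) \<longlonglongrightarrow> (cmod (f x - f x))\<^sup>2"
        by (intro tendsto_intros lim)
      then show ?case by simp
    qed
    show "AE x in mult_haar. norm ((cmod (F n x - f x))\<^sup>2) \<le> (cmod (f x))\<^sup>2" for n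
      unfolding AE_mult_haar_iff using AE_lborel_singleton[of 0]
      by eventually_elim (auto intro!: power_mono bound)
  qed (use meas in measurable)
  then have "(\<lambda>n. (norm (V n - v))\<^sup>2) \<longlonglongrightarrow> 0"
    using represents_norm[OF represents_diff[OF V f]] by simp
  then have "(\<lambda>n. sqrt ((norm (V n - v))\<^sup>2)) \<longlonglongrightarrow> sqrt 0" by (rule tendsto_real_sqrt)
  then show ?thesis by (simp add: LIM_zero_iff tendsto_norm_zero_iff)
qed

text \<open>The common majorant for elements of K. Against \<open>dx/|x|\<close> its square is at
  most \<open>1 / (1 + x^2)\<close>, since \<open>|x| <= 1 + x^2\<close>.\<close>

lemma integrable_mult_haar_majorant:
  "integrable mult_haar (\<lambda>x. (\<bar>x\<bar> / (1 + x\<^sup>2))\<^sup>2)"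
proof -
  have half: "set_integrable lborel {0<..} (\<lambda>x::real. 1 / (1 + x\<^sup>2))"
    by (rule set_integrable_inverse_square)
  have half': "set_integrable lborel {..<0} (\<lambda>x::real. 1 / (1 + x\<^sup>2))"
    using lborel_integrable_real_affine[OF half[unfolded set_integrable_def], of "- 1" 0]
    unfolding set_integrable_def by (auto simp: indicator_def cong: if_cong)
  have int: "integrable lborel (\<lambda>x::real. indicator {0<..} x *\<^sub>R (1 / (1 + x\<^sup>2))
      + indicator {..<0} x *\<^sub>R (1 / (1 + x\<^sup>2)))"
    using half half' unfolding set_integrable_def by (rule Bochner_Integration.integrable_add)
  have "integrable lborel (\<lambda>x. (1 / \<bar>x\<bar>) *\<^sub>R (\<bar>x\<bar> / (1 + x\<^sup>2))\<^sup>2)"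
  proof (rule Bochner_Integration.integrable_bound[OF int])
    show "AE x in lborel. norm ((1 / \<bar>x\<bar>) *\<^sub>R (\<bar>x\<bar> / (1 + x\<^sup>2))\<^sup>2)
      \<le> norm (indicator {0<..} x *\<^sub>R (1 / (1 + x\<^sup>2)) + indicator {..<0} x *\<^sub>R (1 / (1 + x\<^sup>2)))"
    proof (intro AE_I2)
      fix x :: real
      have pos: "1 + x\<^sup>2 > 0" by (simp add: add_pos_nonneg)
      have "\<bar>x\<bar> \<le> 1 + x\<^sup>2"
        using abs_le_square_iff[of 1 x] sum_squares_bound[of "\<bar>x\<bar>" 1] by auto
      then have "\<bar>x\<bar> / (1 + x\<^sup>2) \<le> 1" using pos by simp
      then have *: "(\<bar>x\<bar> / (1 + x\<^sup>2)) * (1 / (1 + x\<^sup>2)) \<le> 1 * (1 / (1 + x\<^sup>2))"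
        using pos by (intro mult_right_mono) auto
      have "(1 / t) * (t / a)\<^sup>2 = (t / a) * (1 / a)" if "t \<noteq> 0" for t a :: real
        using that by (simp add: power2_eq_square)
      then have "x = 0 \<or> (1 / \<bar>x\<bar>) * (\<bar>x\<bar> / (1 + x\<^sup>2))\<^sup>2 = (\<bar>x\<bar> / (1 + x\<^sup>2)) * (1 / (1 + x\<^sup>2))"
        by (metis abs_eq_0)
      then show "norm ((1 / \<bar>x\<bar>) *\<^sub>R (\<bar>x\<bar> / (1 + x\<^sup>2))\<^sup>2)
        \<le> norm (indicator {0<..} x *\<^sub>R (1 / (1 + x\<^sup>2)) + indicator {..<0} x *\<^sub>R (1 / (1 + x\<^sup>2)))"
        using * pos by (auto simp: indicator_def)
    qed
  qed measurable
  then show ?thesis by (subst integrable_mult_haar_iff) measurable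
qed

lemma square_integrable_majorant:
  assumes "f \<in> borel_measurable borel" "\<And>x. x \<noteq> 0 \<Longrightarrow> cmod (f x) \<le> C * (\<bar>x\<bar> / (1 + x\<^sup>2))"
  shows "square_integrable f"
  unfolding square_integrable_def
proof (rule conjI[OF assms(1)], rule Bochner_Integration.integrable_bound)
  show "integrable mult_haar (\<lambda>x. C\<^sup>2 * (\<bar>x\<bar> / (1 + x\<^sup>2))\<^sup>2)"
    by (intro integrable_mult_right integrable_mult_haar_majorant)
  show "AE x in mult_haar. norm ((cmod (f x))\<^sup>2) \<le> norm (C\<^sup>2 * (\<bar>x\<bar> / (1 + x\<^sup>2))\<^sup>2)"
    unfolding AE_mult_haar_iff using AE_lborel_singleton[of 0]
  proof eventually_elim
    case (elim x)
    have "(cmod (f x))\<^sup>2 \<le> (C * (\<bar>x\<bar> / (1 + x\<^sup>2)))\<^sup>2"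
      by (rule power_mono[OF assms(2)[OF elim]]) simp
    also have "\<dots> = C\<^sup>2 * (\<bar>x\<bar> / (1 + x\<^sup>2))\<^sup>2" by (rule power_mult_distrib)
    also have "\<dots> \<le> norm \<dots>" by simp
    finally show ?case by simp
  qed
qed (use assms in measurable)

text \<open>Turns a pointwise estimate into one in norm with a constant \<open>K\<close> independent
  of the function, so that estimates uniform in a parameter stay uniform.\<close>

lemma represents_norm_majorant:
  obtains K where "K \<ge> 0" "\<And>f v C. represents f v \<Longrightarrow> C \<ge> 0 \<Longrightarrow>
    (\<And>x. x \<noteq> 0 \<Longrightarrow> cmod (f x) \<le> C * (\<bar>x\<bar> / (1 + x\<^sup>2))) \<Longrightarrow> norm v \<le> C * K"
proof -
  define I where "I = (\<integral>x. (\<bar>x\<bar> / (1 + x\<^sup>2))\<^sup>2 \<partial>mult_haar)"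
  have I: "I \<ge> 0" unfolding I_def by simp
  have "norm v \<le> C * sqrt I" if f: "represents f v" and C: "C \<ge> 0"
    and bound: "\<And>x. x \<noteq> 0 \<Longrightarrow> cmod (f x) \<le> C * (\<bar>x\<bar> / (1 + x\<^sup>2))" for f v C
  proof -
    have "(norm v)\<^sup>2 \<le> (\<integral>x. C\<^sup>2 * (\<bar>x\<bar> / (1 + x\<^sup>2))\<^sup>2 \<partial>mult_haar)"
      unfolding represents_norm[OF f]
    proof (rule integral_mono_AE)
      show "integrable mult_haar (\<lambda>x. (cmod (f x))\<^sup>2)"
        using represents_square_integrable[OF f] by (simp add: square_integrable_def)
      show "AE x in mult_haar. (cmod (f x))\<^sup>2 \<le> C\<^sup>2 * (\<bar>x\<bar> / (1 + x\<^sup>2))\<^sup>2"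
        unfolding AE_mult_haar_iff using AE_lborel_singleton[of 0]
        by eventually_elim (use bound in \<open>auto simp flip: power_mult_distrib intro!: power_mono\<close>)
    qed (intro integrable_mult_right integrable_mult_haar_majorant)
    also have "\<dots> = (C * sqrt I)\<^sup>2"
      using I by (simp add: I_def power_mult_distrib)
    finally show ?thesis by (rule power2_le_imp_le) (use C I in simp)
  qed
  then show ?thesis using that[of "sqrt I"] I by (simp del: norm_le_zero_iff)
qed

section \<open>Weak derivatives along the dilations\<close>

text \<open>The positive and negative parts of \<open>h\<close> (the densities for
  \<open>s = 1\<close> and \<open>s = - 1\<close>) give every ray the same finite mass. The two
  measures are therefore equal, and so are their densities almost everywhere.\<close>

lemma AE_zero_of_ray_integrals:
  fixes h :: "real \<Rightarrow> real"
  assumes h: "integrable lborel h" and 0: "\<And>a. (\<integral>x. indicator {a<..} x * h x \<partial>lborel) = 0"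
  shows "AE x in lborel. h x = 0"
proof -
  have [measurable]: "h \<in> borel_measurable borel" using h by auto
  let ?d = "\<lambda>s. density lborel (\<lambda>x. ennreal (max 0 (s * h x)))"
  have int: "integrable lborel (\<lambda>x. indicator {a<..} x * max 0 (s * h x))" for a s
  proof (rule Bochner_Integration.integrable_bound)
    show "integrable lborel (\<lambda>x. s * h x)" using h by simp
    show "AE x in lborel. norm (indicator {a<..} x * max 0 (s * h x)) \<le> norm (s * h x)"
      by (auto simp: indicator_def)
  qed measurable
  have ray: "emeasure (?d s) {a<..} = ennreal (\<integral>x. indicator {a<..} x * max 0 (s * h x) \<partial>lborel)" for s a
  proof -
    have "emeasure (?d s) {a<..} = (\<integral>\<^sup>+x. ennreal (indicator {a<..} x * max 0 (s * h x)) \<partial>lborel)"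
      by (subst emeasure_density) (auto intro!: nn_integral_cong simp: indicator_def)
    also have "\<dots> = ennreal (\<integral>x. indicator {a<..} x * max 0 (s * h x) \<partial>lborel)"
      by (intro nn_integral_eq_integral int) auto
    finally show ?thesis .
  qed
  have "?d 1 = ?d (- 1)"
  proof (rule measure_eqI_lessThan)
    fix a
    have "(\<integral>x. indicator {a<..} x * max 0 (1 * h x) \<partial>lborel) - (\<integral>x. indicator {a<..} x * max 0 (- 1 * h x) \<partial>lborel)
        = (\<integral>x. indicator {a<..} x * max 0 (1 * h x) - indicator {a<..} x * max 0 (- 1 * h x) \<partial>lborel)"
      by (rule Bochner_Integration.integral_diff[symmetric, OF int int])
    also have "\<dots> = (\<integral>x. indicator {a<..} x * h x \<partial>lborel)"
      by (intro Bochner_Integration.integral_cong) (auto simp: max_def indicator_def)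
    finally show "emeasure (?d 1) {a<..} = emeasure (?d (- 1)) {a<..}"
      unfolding ray 0 by simp
    show "emeasure (?d 1) {a<..} < \<infinity>" unfolding ray by simp
  qed auto
  then have "AE x in lborel. ennreal (max 0 (1 * h x)) = ennreal (max 0 (- 1 * h x))"
    by (intro sigma_finite_measure.density_unique sigma_finite_lborel) measurable
  then show ?thesis
    by eventually_elim (auto simp: max_def ennreal_eq_0_iff split: if_splits)
qed

definition locally_integrable :: "(real \<Rightarrow> complex) \<Rightarrow> bool" where
  "locally_integrable q \<longleftrightarrow> q \<in> borel_measurable borel \<and> (\<forall>a b. 0 < a \<longrightarrow> set_integrable lborel {a..b} q)"

lemma AE_zero_of_interval_integrals:
  assumes q: "locally_integrable q"
    and 0: "\<And>a b. 0 < a \<Longrightarrow> a < b \<Longrightarrow> (LINT x:{a..b}|lborel. q x) = 0"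
  shows "AE x in lborel. 0 < x \<longrightarrow> q x = 0"
proof -
  have 0: "(LINT x:{a..b}|lborel. q x) = 0" if "0 < a" for a b
  proof (cases "a < b")
    case False
    have "AE x in lborel. indicator {a..b} x *\<^sub>R q x = 0"
      using AE_lborel_singleton[of a] by eventually_elim (use False in \<open>auto simp: indicator_def\<close>)
    then show ?thesis
      unfolding set_lebesgue_integral_def by (rule integral_eq_zero_AE)
  qed (use 0 that in auto)
  \<comment> \<open>The intervals \<open>[1/n, n]\<close> exhaust the open half-line; on each of
    them the real and the imaginary part are treated separately through the functional
    \<open>T\<close>.\<close>
  have "AE x in lborel. indicator {1 / real (Suc n)..real (Suc n)} x *\<^sub>R q x = 0" for n
  proof -
    let ?I = "{1 / real (Suc n)..real (Suc n)}"
    let ?h = "\<lambda>T x. T (indicator ?I x *\<^sub>R q x) :: real"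
    have int: "integrable lborel (\<lambda>x. indicator ?I x *\<^sub>R q x)"
      using q unfolding locally_integrable_def set_integrable_def by auto
    have *: "AE x in lborel. ?h T x = 0" if T: "bounded_linear T" for T
    proof (rule AE_zero_of_ray_integrals)
      show "integrable lborel (?h T)" by (rule integrable_bounded_linear[OF T int])
      fix a :: real
      \<comment> \<open>The part of \<open>?I\<close> on the ray, up to the endpoint
        \<open>a\<close>.\<close>
      let ?J = "{max a (1 / real (Suc n))..real (Suc n)}"
      have intJ: "integrable lborel (\<lambda>x. indicator ?J x *\<^sub>R q x)"
        using q unfolding locally_integrable_def set_integrable_def
        by (auto simp: less_max_iff_disj simp del: of_nat_Suc)
      have "(\<integral>x. indicator {a<..} x * ?h T x \<partial>lborel) = (\<integral>x. T (indicator ?J x *\<^sub>R q x) \<partial>lborel)"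
      proof (rule integral_cong_AE)
        show "AE x in lborel. indicator {a<..} x * ?h T x = T (indicator ?J x *\<^sub>R q x)"
          using AE_lborel_singleton[of a]
          by eventually_elim
            (auto simp: indicator_def linear_0[OF bounded_linear.linear[OF T]])
        have [measurable]: "T \<in> borel_measurable borel"
          by (intro borel_measurable_continuous_onI linear_continuous_on T)
        have [measurable]: "q \<in> borel_measurable borel"
          using q by (simp add: locally_integrable_def)
        show "(\<lambda>x. indicator {a<..} x * ?h T x) \<in> borel_measurable lborel"
          "(\<lambda>x. T (indicator ?J x *\<^sub>R q x)) \<in> borel_measurable lborel"
          by measurable
      qed
      also have "\<dots> = T (\<integral>x. indicator ?J x *\<^sub>R q x \<partial>lborel)"
        by (rule integral_bounded_linear[OF T intJ])
      also have "(\<integral>x. indicator ?J x *\<^sub>R q x \<partial>lborel) = 0"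
        using 0[of "max a (1 / real (Suc n))" "real (Suc n)"]
        by (simp add: set_lebesgue_integral_def less_max_iff_disj del: of_nat_Suc)
      finally show "(\<integral>x. indicator {a<..} x * ?h T x \<partial>lborel) = 0"
        by (simp add: linear_0[OF bounded_linear.linear[OF T]])
    qed
    show ?thesis
      using *[OF bounded_linear_Re] *[OF bounded_linear_Im]
      by eventually_elim (auto simp: complex_eq_iff)
  qed
  then have "AE x in lborel. \<forall>n. indicator {1 / real (Suc n)..real (Suc n)} x *\<^sub>R q x = 0"
    unfolding AE_all_countable by blast
  then show ?thesis
  proof eventually_elim
    case (elim x)
    show ?case
    proof
      assume x: "0 < x"
      obtain n where n: "max x (1 / x) < real n" using reals_Archimedean2 by blast
      then have "x \<le> real (Suc n)" "1 / x \<le> real (Suc n)" by auto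
      then have "x \<in> {1 / real (Suc n)..real (Suc n)}"
        using x by (auto simp: field_simps)
      with elim show "q x = 0" by (auto dest!: spec[of _ n] simp del: of_nat_Suc)
    qed
  qed
qed

lemma primitive_exists:
  assumes q: "locally_integrable q"
  shows "\<exists>P. continuous_on {0<..} P \<and>
    (\<forall>a b. 0 < a \<longrightarrow> a \<le> b \<longrightarrow> (LINT x:{a..b}|lborel. q x) = P b - P a)"
proof -
  have int: "q integrable_on {a..b}" "(LINT x:{a..b}|lborel. q x) = integral {a..b} q" if "0 < a" for a b
    using q that set_borel_integral_eq_integral[of "{a..b}" q] by (auto simp: locally_integrable_def)
  define P where "P x = (if 1 \<le> x then integral {1..x} q else - integral {x..1} q)" for x
  have P: "integral {a..b} q = P b - P a" if "0 < a" "a \<le> b" for a b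
  proof -
    have comb: "integral {a..c} q + integral {c..b} q = integral {a..b} q"
      if "0 < a" "a \<le> c" "c \<le> b" for a b c
      using that by (intro Henstock_Kurzweil_Integration.integral_combine int) auto
    show ?thesis
      using that comb[of 1 a b] comb[of a 1 b] comb[of a b 1]
      by (auto simp: P_def algebra_simps)
  qed
  have "isCont P x" if "x > 0" for x
  proof -
    have "continuous_on {x / 2..x + 1} (\<lambda>y. P (x / 2) + integral {x / 2..y} q)"
      using that by (intro continuous_intros indefinite_integral_continuous_1 int) auto
    then have "continuous_on {x / 2..x + 1} P"
      by (rule continuous_on_eq) (use P[of "x / 2"] that in auto)
    then show ?thesis using that by (auto intro: continuous_on_interior)
  qed
  then have "continuous_on {0<..} P" by (simp add: continuous_at_imp_continuous_on)
  then show ?thesis using int P by (intro exI[of _ P]) auto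
qed

lemma antiderivative_exists:
  fixes G :: "real \<Rightarrow> complex"
  assumes "continuous_on UNIV G"
  shows "\<exists>P. \<forall>t. (P has_vector_derivative G t) (at t)"
proof -
  have "\<exists>P. \<forall>x::real. -\<infinity> < ereal x \<longrightarrow> ereal x < \<infinity> \<longrightarrow> (P has_vector_derivative G x) (at x)"
    by (rule einterval_antiderivative) (use assms in \<open>auto simp: continuous_on_eq_continuous_at\<close>)
  then show ?thesis by auto
qed

text \<open>A continuous function that satisfies \<open>F' = G\<close> up to a constant in the sense of differences
  has derivative \<open>G\<close> up to a constant: \<open>K = F - \<integral>G\<close> has constant increments, and integrating
  the increments over a unit interval shows that \<open>K\<close> is differentiable.\<close>

lemma derivative_of_difference_derivative:
  fixes F G :: "real \<Rightarrow> complex"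
  assumes F: "continuous_on UNIV F" and G: "continuous_on UNIV G"
    and D: "\<And>a b. a < b \<Longrightarrow> ((\<lambda>h. F (b + h) - F (a + h)) has_vector_derivative G b - G a) (at 0)"
  shows "\<exists>\<alpha>. \<forall>t. (F has_vector_derivative \<alpha> + G t) (at t)"
proof -
  obtain P where P: "\<And>t. (P has_vector_derivative G t) (at t)"
    using antiderivative_exists[OF G] by blast
  define K where "K t = F t - P t" for t
  have "continuous_on UNIV P"
    using P by (auto simp: continuous_on_eq_continuous_at intro: has_vector_derivative_continuous)
  then have K: "continuous_on UNIV K"
    unfolding K_def by (intro continuous_intros F)
  have const_M: "M s = M t" if "\<And>t. (M has_vector_derivative 0) (at t)" for M :: "real \<Rightarrow> complex" and s t
    using has_vector_derivative_zero_constant[of UNIV M] that by (metis UNIV_I convex_UNIV)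
  have translate: "((\<lambda>t. c + t) has_vector_derivative 1) (at t)" for c t :: real
    by (auto intro!: derivative_eq_intros)
  have shift: "((\<lambda>t. P (c + t)) has_vector_derivative G (c + t)) (at t)"
    if "\<And>t. (P has_vector_derivative G t) (at t)" for P G :: "real \<Rightarrow> complex" and c t
    using vector_diff_chain_at[OF translate[of c t] that[of "c + t"]] by (simp add: o_def)
  have D': "((\<lambda>t. F (x + t) - F t) has_vector_derivative G (x + t) - G t) (at t)" for x t
  proof -
    have *: "((\<lambda>h. F (b + (- t + h)) - F (a + (- t + h))) has_vector_derivative G b - G a) (at t)"
      if "a < b" for a b t
      using vector_diff_chain_at[OF translate[of "- t" t], of "\<lambda>h. F (b + h) - F (a + h)" "G b - G a"]
        D[OF that] by (simp add: o_def)
    consider "x > 0" | "x = 0" | "x < 0" by linarith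
    then show ?thesis
    proof cases
      case 1
      then show ?thesis using *[of t "x + t" t] by (simp add: algebra_simps)
    next
      case 3
      then show ?thesis
        using has_vector_derivative_minus[OF *[of "x + t" t t]] by (simp add: algebra_simps)
    qed simp
  qed
  have "((\<lambda>t. K (x + t) - K t) has_vector_derivative 0) (at t)" for x t
    using has_vector_derivative_diff[OF D'[of x t] has_vector_derivative_diff[OF shift[OF P, of x t] P[of t]]]
    by (simp add: K_def algebra_simps)
  then have K_diff: "K (x + t) - K t = K x - K 0" for x t
    using const_M[of "\<lambda>t. K (x + t) - K t" t 0] by simp
  obtain L where L: "\<And>t. (L has_vector_derivative K t) (at t)"
    using antiderivative_exists[OF K] by blast
  have K_pt: "K x = L (1 + x) - L x + (K 0 - L 1 + L 0)" for x
  proof -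
    let ?M = "\<lambda>c. L (x + c) - L c - c *\<^sub>R (K x - K 0)"
    have M: "(?M has_vector_derivative K (x + c) - K c - (K x - K 0)) (at c)" for c
      by (intro has_vector_derivative_diff shift L) (auto intro!: derivative_eq_intros)
    have "(?M has_vector_derivative 0) (at c)" for c
      using M[of c] K_diff[of x c] by simp
    then have "?M 1 = ?M 0" by (rule const_M)
    then show ?thesis by (simp add: algebra_simps)
  qed
  have K_eq: "(\<lambda>x. L (1 + x) - L x + (K 0 - L 1 + L 0)) = K" by (rule ext, rule K_pt[symmetric])
  \<comment> \<open>The derivative \<open>K (1 + t) - K t\<close> is the constant increment
    \<open>K 1 - K 0\<close>, which becomes \<open>\<alpha>\<close>.\<close>
  have "(K has_vector_derivative K 1 - K 0) (at t)" for t
    using has_vector_derivative_add[OF has_vector_derivative_diff[OF shift[OF L, of 1 t] L[of t]]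
        has_vector_derivative_const[of "K 0 - L 1 + L 0"]]
    unfolding K_eq K_diff by simp
  from has_vector_derivative_add[OF this P]
  have "((\<lambda>t. K t + P t) has_vector_derivative (K 1 - K 0) + G t) (at t)" for t .
  then show ?thesis by (intro exI[of _ "K 1 - K 0"]) (simp add: K_def)
qed

text \<open>With \<open>x = exp t\<close>, dilations become translations and \<open>dx / x\<close>
  becomes \<open>dt\<close>, so the hypothesis is one on differences of primitives \<open>P\<close>
  of \<open>\<phi> / x\<close> and \<open>Q\<close> of \<open>\<psi> / x\<close>. It follows that
  \<open>P (exp t)\<close> has derivative \<open>\<alpha> + Q (exp t)\<close>, hence
  \<open>\<phi> = \<alpha> + Q\<close> almost everywhere, with \<open>\<alpha>\<close> undetermined
  because only differences were differentiated. The last conclusion is conditional on a continuous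
  version \<open>\<eta>\<close> of \<open>\<psi>\<close>; in the application it is obtained from
  this lemma for the next vector.\<close>

lemma weak_dilation_derivative:
  assumes \<phi>: "locally_integrable (\<lambda>x. \<phi> x / of_real x)" and \<psi>: "locally_integrable (\<lambda>x. \<psi> x / of_real x)"
    and D: "\<And>a b. 0 < a \<Longrightarrow> a < b \<Longrightarrow>
      ((\<lambda>h. LINT x:{a * exp h..b * exp h}|lborel. \<phi> x / of_real x) has_vector_derivative
        (LINT x:{a..b}|lborel. \<psi> x / of_real x)) (at 0)"
  obtains \<rho> where "continuous_on {0<..} \<rho>" "AE x in lborel. 0 < x \<longrightarrow> \<phi> x = \<rho> x"
    "\<And>\<eta> x. continuous_on {0<..} \<eta> \<Longrightarrow> AE x in lborel. 0 < x \<longrightarrow> \<psi> x = \<eta> x \<Longrightarrow> 0 < x \<Longrightarrow>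
      (\<rho> has_vector_derivative \<eta> x / of_real x) (at x)"
proof -
  obtain P where P: "continuous_on {0<..} P"
    "\<And>a b. 0 < a \<Longrightarrow> a \<le> b \<Longrightarrow> (LINT x:{a..b}|lborel. \<phi> x / of_real x) = P b - P a"
    using primitive_exists[OF \<phi>] by blast
  obtain Q where Q: "continuous_on {0<..} Q"
    "\<And>a b. 0 < a \<Longrightarrow> a \<le> b \<Longrightarrow> (LINT x:{a..b}|lborel. \<psi> x / of_real x) = Q b - Q a"
    using primitive_exists[OF \<psi>] by blast
  have "\<exists>\<alpha>. \<forall>t. ((\<lambda>t. P (exp t)) has_vector_derivative \<alpha> + Q (exp t)) (at t)"
  proof (rule derivative_of_difference_derivative)
    show "continuous_on UNIV (\<lambda>t. P (exp t))"
      by (rule continuous_on_compose2[OF P(1)]) (auto intro: continuous_intros)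
    show "continuous_on UNIV (\<lambda>t. Q (exp t))"
      by (rule continuous_on_compose2[OF Q(1)]) (auto intro: continuous_intros)
    fix a b :: real assume "a < b"
    then show "((\<lambda>h. P (exp (b + h)) - P (exp (a + h))) has_vector_derivative Q (exp b) - Q (exp a)) (at 0)"
      using D[of "exp a" "exp b"] by (simp add: P(2) Q(2) exp_add)
  qed
  then obtain \<alpha> where \<alpha>: "\<And>t. ((\<lambda>t. P (exp t)) has_vector_derivative \<alpha> + Q (exp t)) (at t)"
    by blast
  define \<rho> where "\<rho> x = \<alpha> + Q x" for x
  have \<rho>: "continuous_on {0<..} \<rho>"
    unfolding \<rho>_def by (intro continuous_intros Q)
  have P_deriv: "(P has_vector_derivative \<rho> x / of_real x) (at x)" if "x > 0" for x
  proof -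
    have "(ln has_vector_derivative (1 / x)) (at x)"
      using DERIV_ln_divide[OF that] by (simp add: has_real_derivative_iff_has_vector_derivative)
    from vector_diff_chain_at[OF this \<alpha>[of "ln x"]]
    have "((\<lambda>x. P (exp (ln x))) has_vector_derivative \<rho> x / of_real x) (at x)"
      using that by (simp add: o_def \<rho>_def scaleR_conv_of_real)
    then show ?thesis
      by (rule has_vector_derivative_transform_within_open[where S = "{0<..}"]) (use that in auto)
  qed
  have cont: "continuous_on {a..b} (\<lambda>x. \<rho> x / of_real x)" if "0 < a" for a b
    using that by (intro continuous_intros continuous_on_subset[OF \<rho>]) auto
  have \<rho>_int: "set_integrable lborel {a..b} (\<lambda>x. \<rho> x / of_real x)"
    "(LINT x:{a..b}|lborel. \<rho> x / of_real x) = P b - P a" if "0 < a" "a \<le> b" for a b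
  proof -
    show int: "set_integrable lborel {a..b} (\<lambda>x. \<rho> x / of_real x)"
      unfolding set_integrable_def by (intro borel_integrable_compact cont) (use that in auto)
    have "((\<lambda>x. \<rho> x / of_real x) has_integral P b - P a) {a..b}"
      by (rule fundamental_theorem_of_calculus[OF that(2)], rule has_vector_derivative_at_within[OF P_deriv])
        (use that in auto)
    then show "(LINT x:{a..b}|lborel. \<rho> x / of_real x) = P b - P a"
      using set_borel_integral_eq_integral(2)[OF int] by (simp add: integral_unique)
  qed
  \<comment> \<open>Local integrability includes measurability on the whole line, whereas
    \<open>\<rho>\<close> is controlled for positive arguments only.\<close>
  define \<rho>0 where "\<rho>0 x = (if x \<in> {0<..} then \<rho> x / of_real x else 0)" for x :: real
  have \<rho>0_meas: "\<rho>0 \<in> borel_measurable borel"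
    unfolding \<rho>0_def
    by (intro borel_measurable_continuous_on_if continuous_intros continuous_on_subset[OF \<rho>]) auto
  have \<rho>0_cong: "set_integrable lborel {a..b} \<rho>0 \<longleftrightarrow> set_integrable lborel {a..b} (\<lambda>x. \<rho> x / of_real x)"
    "(LINT x:{a..b}|lborel. \<rho>0 x) = (LINT x:{a..b}|lborel. \<rho> x / of_real x)" if "a > 0" for a b
    by (rule set_integrable_cong, use that in \<open>auto simp: \<rho>0_def\<close>)
      (rule set_lebesgue_integral_cong, use that in \<open>auto simp: \<rho>0_def\<close>)
  have "set_integrable lborel {a..b} \<rho>0" if "a > 0" for a b
    using \<rho>0_cong(1)[OF that] \<rho>_int(1)[OF that, of b]
    by (cases "a \<le> b") (auto simp: set_integrable_def)
  then have "AE x in lborel. 0 < x \<longrightarrow> \<phi> x / of_real x - \<rho>0 x = 0"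
    using \<phi> \<rho>0_meas \<rho>0_cong(2) \<rho>_int(2) P(2)
    by (intro AE_zero_of_interval_integrals) (auto simp: locally_integrable_def)
  then have "AE x in lborel. 0 < x \<longrightarrow> \<phi> x = \<rho> x"
    by eventually_elim (auto simp: \<rho>0_def)
  moreover have "(\<rho> has_vector_derivative \<eta> x / of_real x) (at x)"
    if \<eta>: "continuous_on {0<..} \<eta>" "AE x in lborel. 0 < x \<longrightarrow> \<psi> x = \<eta> x" "0 < x" for \<eta> x
  proof -
    \<comment> \<open>Any base point strictly between 0 and \<open>x\<close> would do:
      \<open>x\<close> has to be interior to an interval that stays away from 0.\<close>
    let ?a = "x / 2"
    have a: "0 < ?a" using \<eta>(3) by simp
    have cont: "continuous_on {?a..x + 1} (\<lambda>x. \<eta> x / of_real x)"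
      using \<eta>(3) by (intro continuous_intros continuous_on_subset[OF \<eta>(1)]) auto
    have eq: "\<rho> y = \<rho> ?a + integral {?a..y} (\<lambda>x. \<eta> x / of_real x)" if y: "y \<in> {?a..x + 1}" for y
    proof -
      have int: "set_integrable lborel {?a..y} (\<lambda>x. \<eta> x / of_real x)"
        unfolding set_integrable_def
        by (intro borel_integrable_compact continuous_on_subset[OF cont]) (use y in auto)
      have meas: "(\<lambda>x. \<psi> x / of_real x) \<in> borel_measurable borel"
        using \<psi> by (simp add: locally_integrable_def)
      have "\<rho> y - \<rho> ?a = (LINT x:{?a..y}|lborel. \<psi> x / of_real x)"
        using Q(2)[OF a, of y] y by (simp add: \<rho>_def)
      also have "\<dots> = (LINT x:{?a..y}|lborel. \<eta> x / of_real x)"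
        unfolding set_lebesgue_integral_def
      proof (rule integral_cong_AE)
        show "AE x in lborel. indicator {?a..y} x *\<^sub>R (\<psi> x / of_real x) = indicator {?a..y} x *\<^sub>R (\<eta> x / of_real x)"
          using \<eta>(2) by eventually_elim (use a in \<open>auto simp: indicator_def\<close>)
        show "(\<lambda>x. indicator {?a..y} x *\<^sub>R (\<psi> x / of_real x)) \<in> borel_measurable lborel"
          using meas by simp
        show "(\<lambda>x. indicator {?a..y} x *\<^sub>R (\<eta> x / of_real x)) \<in> borel_measurable lborel"
          using int by (auto simp: set_integrable_def)
      qed
      also have "\<dots> = integral {?a..y} (\<lambda>x. \<eta> x / of_real x)"
        by (rule set_borel_integral_eq_integral(2)[OF int])
      finally show ?thesis by (simp add: algebra_simps)
    qed
    have "((\<lambda>y. integral {?a..y} (\<lambda>x. \<eta> x / of_real x)) has_vector_derivative \<eta> x / of_real x)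
        (at x within {?a..x + 1})"
      by (rule integral_has_vector_derivative[OF cont]) (use \<eta>(3) in auto)
    then have "((\<lambda>y. \<rho> ?a + integral {?a..y} (\<lambda>x. \<eta> x / of_real x)) has_vector_derivative 0 + \<eta> x / of_real x)
        (at x within {?a..x + 1})"
      by (intro has_vector_derivative_add has_vector_derivative_const)
    then have "(\<rho> has_vector_derivative \<eta> x / of_real x) (at x within {?a..x + 1})"
      unfolding add_0
      using has_vector_derivative_transform[of x "{?a..x + 1}" \<rho>, OF _ eq] \<eta>(3) by simp
    then show ?thesis
      using \<eta>(3) at_within_interior[of x "{?a..x + 1}"] by simp
  qed
  ultimately show ?thesis using that[of \<rho>] \<rho> by blast
qed

text \<open>Since \<open>f1 = x f'\<close>, the derivative of \<open>|f|^2\<close> is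
  \<open>2 Re (f1 * cnj f) / x\<close>, which is integrable as \<open>f\<close> and
  \<open>f1\<close> are square integrable for \<open>dx/|x|\<close>. So \<open>|f|^2\<close> varies
  by at most the integral \<open>M\<close> of its absolute value.\<close>

lemma bounded_of_square_integrable_derivative:
  assumes f: "square_integrable f" "square_integrable f1"
    and deriv: "\<And>x. 0 < x \<Longrightarrow> (f has_vector_derivative f1 x / of_real x) (at x)"
  shows "\<exists>C. \<forall>x>0. cmod (f x) \<le> C"
proof -
  let ?r = "\<lambda>x. 2 * Re (f1 x * cnj (f x)) / x"
  have meas: "f \<in> borel_measurable borel" "f1 \<in> borel_measurable borel"
    using f by (auto simp: square_integrable_def)
  have "integrable mult_haar (\<lambda>x. 2 * Re (f1 x * cnj (f x)))"
    by (intro integrable_mult_right integrable_Re integrable_mult_cnj f)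
  then have "integrable lborel (\<lambda>x. (1 / \<bar>x\<bar>) *\<^sub>R (2 * Re (f1 x * cnj (f x))))"
    using meas borel_measurable_integrable[OF integrable_mult_cnj[OF f(2,1)]]
    by (subst (asm) integrable_mult_haar_iff) auto
  then have int: "set_integrable lborel {0<..} (\<lambda>x. (1 / \<bar>x\<bar>) *\<^sub>R (2 * Re (f1 x * cnj (f x))))"
    unfolding set_integrable_def by (intro integrable_mult_indicator) auto
  then have int: "set_integrable lborel {0<..} ?r"
    by (rule set_integrable_cong[THEN iffD1, rotated 3]) auto
  define M where "M = (LINT x:{0<..}|lborel. \<bar>?r x\<bar>)"
  have N_deriv: "((\<lambda>x. (cmod (f x))\<^sup>2) has_vector_derivative ?r x) (at x)" if "0 < x" for x
  proof -
    have "((\<lambda>x. Re (f x * cnj (f x))) has_vector_derivative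
        Re (f x * cnj (f1 x / of_real x) + f1 x / of_real x * cnj (f x))) (at x)"
      by (intro bounded_linear.has_vector_derivative[OF bounded_linear_Re] has_vector_derivative_mult
          has_vector_derivative_cnj deriv that)
    moreover have "Re (f x * cnj (f1 x / of_real x) + f1 x / of_real x * cnj (f x)) = ?r x"
      using that by (simp add: field_simps)
    moreover have "(\<lambda>x. Re (f x * cnj (f x))) = (\<lambda>x. (cmod (f x))\<^sup>2)"
      by (simp add: complex_mult_cnj cmod_power2)
    ultimately show ?thesis by simp
  qed
  have bound: "\<bar>(cmod (f b))\<^sup>2 - (cmod (f a))\<^sup>2\<bar> \<le> M" if "0 < a" "a \<le> b" for a b
  proof -
    have int_ab: "set_integrable lborel {a..b} ?r"
      by (rule set_integrable_subset[OF int]) (use that in auto)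
    have "(?r has_integral (cmod (f b))\<^sup>2 - (cmod (f a))\<^sup>2) {a..b}"
      by (rule fundamental_theorem_of_calculus[OF that(2)], rule has_vector_derivative_at_within[OF N_deriv])
        (use that in auto)
    then have "(cmod (f b))\<^sup>2 - (cmod (f a))\<^sup>2 = (LINT x:{a..b}|lborel. ?r x)"
      using set_borel_integral_eq_integral(2)[OF int_ab] by (simp add: integral_unique)
    also have "\<bar>\<dots>\<bar> \<le> (LINT x:{a..b}|lborel. \<bar>?r x\<bar>)"
      using set_integral_norm_bound[OF int_ab] by simp
    also have "\<dots> \<le> M"
      unfolding M_def set_lebesgue_integral_def
    proof (rule integral_mono)
      show "integrable lborel (\<lambda>x. indicator {a..b} x *\<^sub>R \<bar>?r x\<bar>)"
        using set_integrable_abs[OF int_ab] by (simp only: set_integrable_def)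
      show "integrable lborel (\<lambda>x. indicator {0<..} x *\<^sub>R \<bar>?r x\<bar>)"
        using set_integrable_abs[OF int] by (simp only: set_integrable_def)
      show "indicator {a..b} x *\<^sub>R \<bar>?r x\<bar> \<le> indicator {0<..} x *\<^sub>R \<bar>?r x\<bar>" for x
        using that by (intro scaleR_right_mono) (auto simp: indicator_def)
    qed
    finally show ?thesis by simp
  qed
  show ?thesis
  proof (intro exI[of _ "sqrt ((cmod (f 1))\<^sup>2 + M)"] allI impI)
    fix x :: real assume "x > 0"
    then have "(cmod (f x))\<^sup>2 \<le> (cmod (f 1))\<^sup>2 + M"
      using bound[of 1 x] bound[of x 1] by (cases "x \<ge> 1") auto
    then show "cmod (f x) \<le> sqrt ((cmod (f 1))\<^sup>2 + M)" by (rule real_le_rsqrt)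
  qed
qed

section \<open>Functions in the space K\<close>

lemma sqrt_power_le:
  assumes "x > 0" shows "sqrt x ^ n \<le> 1 + x ^ n"
proof (cases "x \<ge> 1")
  case True
  then have "sqrt x \<le> x" by (simp add: real_le_lsqrt power2_eq_square)
  then have "sqrt x ^ n \<le> x ^ n" using assms by (intro power_mono) auto
  then show ?thesis by simp
next
  case False
  then have "sqrt x ^ n \<le> 1" using assms by (intro power_le_one) auto
  then show ?thesis using assms by (simp add: add_increasing2)
qed

lemma rapid_open_sqrt_power:
  assumes "rapid_open k" shows "rapid_open (\<lambda>x. of_real (sqrt x ^ n) * k x)"
  unfolding rapid_open_def
proof (intro conjI allI)
  show "continuous_on {0<..} (\<lambda>x. of_real (sqrt x ^ n) * k x)"
    using assms by (auto simp: rapid_open_def intro!: continuous_intros)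
  fix N
  obtain A where A: "\<And>x. x > 0 \<Longrightarrow> x ^ N * norm (k x) \<le> A"
    using assms unfolding rapid_open_def by blast
  obtain B where B: "\<And>x. x > 0 \<Longrightarrow> x ^ (N + n) * norm (k x) \<le> B"
    using assms unfolding rapid_open_def by blast
  have "x ^ N * norm (of_real (sqrt x ^ n) * k x) \<le> A + B" if x: "x > 0" for x
  proof -
    have "sqrt x ^ n \<le> 1 + x ^ n" by (rule sqrt_power_le[OF x])
    then have "sqrt x ^ n * (x ^ N * norm (k x)) \<le> (1 + x ^ n) * (x ^ N * norm (k x))"
      using x by (intro mult_right_mono) auto
    also have "\<dots> \<le> A + B"
      using A[OF x] B[OF x] by (simp add: algebra_simps power_add)
    finally show ?thesis using x by (simp add: norm_mult norm_power mult_ac)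
  qed
  then show "\<exists>C. \<forall>x>0. x ^ N * norm (of_real (sqrt x ^ n) * k x) \<le> C" by blast
qed

lemma weight_mult_self: "x > 0 \<Longrightarrow> weight d x * weight d x = x ^ (d + 1)"
  unfolding weight_def power_mult_distrib[symmetric] by simp

text \<open>The full factor \<open>x\<close> available for \<open>d > 0\<close>: it yields the
  majorant of K and cancels the density \<open>1 / x\<close> in the transform.\<close>

lemma weight_eq: "x > 0 \<Longrightarrow> d > 0 \<Longrightarrow> weight d x = x * sqrt x ^ (d - 1)"
  by (cases d) (auto simp: weight_def)

lemma kirillov_space_add: "f \<in> kirillov_space d \<Longrightarrow> g \<in> kirillov_space d \<Longrightarrow> (\<lambda>x. f x + g x) \<in> kirillov_space d"
proof -
  assume "f \<in> kirillov_space d" "g \<in> kirillov_space d"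
  then obtain f1 f2 g1 g2 where "half_schwartz f1" "half_schwartz f2" "half_schwartz g1" "half_schwartz g2"
    "\<forall>x>0. f x = of_real (weight d x) * f1 x \<and> f (- x) = of_real (weight d x) * f2 x"
    "\<forall>x>0. g x = of_real (weight d x) * g1 x \<and> g (- x) = of_real (weight d x) * g2 x"
    unfolding kirillov_space_iff by blast
  then show ?thesis
    by (intro kirillov_space_of_half_schwartz[of "\<lambda>x. f1 x + g1 x" "\<lambda>x. f2 x + g2 x"] half_schwartz_add)
      (auto simp: algebra_simps)
qed

lemma kirillov_space_mult_left: "f \<in> kirillov_space d \<Longrightarrow> (\<lambda>x. c * f x) \<in> kirillov_space d"
proof -
  assume "f \<in> kirillov_space d"
  then obtain f1 f2 where "half_schwartz f1" "half_schwartz f2"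
    "\<forall>x>0. f x = of_real (weight d x) * f1 x \<and> f (- x) = of_real (weight d x) * f2 x"
    unfolding kirillov_space_iff by blast
  then show ?thesis
    by (intro kirillov_space_of_half_schwartz[of "\<lambda>x. c * f1 x" "\<lambda>x. c * f2 x"] half_schwartz_mult_left)
      (auto simp: algebra_simps)
qed

lemma kirillov_space_times_x: "f \<in> kirillov_space d \<Longrightarrow> (\<lambda>x. of_real x * f x) \<in> kirillov_space d"
proof -
  assume "f \<in> kirillov_space d"
  then obtain f1 f2 where "half_schwartz f1" "half_schwartz f2"
    "\<forall>x>0. f x = of_real (weight d x) * f1 x \<and> f (- x) = of_real (weight d x) * f2 x"
    unfolding kirillov_space_iff by blast
  then show ?thesis
    by (intro kirillov_space_of_half_schwartz[of "\<lambda>x. of_real x * f1 x" "\<lambda>x. - 1 * (of_real x * f2 x)"]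
        half_schwartz_mult_left half_schwartz_times_x) (auto simp: algebra_simps)
qed

text \<open>The witness is \<open>x f'\<close>. The Euler operator multiplies the weight by
  \<open>(d + 1) / 2\<close> and so preserves K, while \<open>d/dx\<close> alone would leave
  \<open>g(x) / x\<close> next to the weight.\<close>

lemma kirillov_space_euler_derivative:
  assumes "f \<in> kirillov_space d"
  shows "\<exists>f1\<in>kirillov_space d. \<forall>x. x \<noteq> 0 \<longrightarrow> (f has_vector_derivative f1 x / of_real x) (at x)"
proof -
  obtain g1 g2 where g: "half_schwartz g1" "half_schwartz g2"
    and f: "\<And>x. x > 0 \<Longrightarrow> f x = of_real (weight d x) * g1 x"
      "\<And>x. x > 0 \<Longrightarrow> f (- x) = of_real (weight d x) * g2 x"
    using assms unfolding kirillov_space_iff by blast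
  obtain g1' where g1': "half_schwartz g1'" "\<And>x. x > 0 \<Longrightarrow> (g1 has_vector_derivative g1' x) (at x)"
    by (rule half_schwartz_derivative[OF g(1)]) blast
  obtain g2' where g2': "half_schwartz g2'" "\<And>x. x > 0 \<Longrightarrow> (g2 has_vector_derivative g2' x) (at x)"
    by (rule half_schwartz_derivative[OF g(2)]) blast
  define k where "k g g' x = complex_of_real ((real d + 1) / 2) * g x + complex_of_real x * g' x"
    for g g' :: "real \<Rightarrow> complex" and x :: real
  have k: "half_schwartz (k g1 g1')" "half_schwartz (k g2 g2')"
    unfolding k_def by (intro half_schwartz_add half_schwartz_mult_left half_schwartz_times_x g g1' g2')+
  have deriv: "((\<lambda>x. of_real (weight d x) * g x) has_vector_derivative of_real (weight d x) * k g g' x / of_real x) (at x)"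
    if x: "x > 0" and g: "(g has_vector_derivative g' x) (at x)" for g g' x
  proof -
    have "((\<lambda>x. sqrt x ^ (d + 1)) has_real_derivative (real d + 1) / 2 * weight d x / x) (at x)"
      using sqrt_power_has_derivative[OF x, of d 0] x by (simp add: weight_def)
    then have "(weight d has_real_derivative (real d + 1) / 2 * weight d x / x) (at x)"
      by (rule has_field_derivative_transform_within_open[where S = "{0<..}"]) (use x in \<open>auto simp: weight_def\<close>)
    from has_vector_derivative_mult[OF has_vector_derivative_of_real[OF this] g]
    show ?thesis using x by (simp add: k_def field_simps)
  qed
  \<comment> \<open>The Euler operator commutes with reflection, so no sign appears on the negative
    side.\<close>
  define f1 where "f1 x = of_real (weight d x) * (if x > 0 then k g1 g1' x else k g2 g2' (- x))" for x
  have "f1 \<in> kirillov_space d"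
    by (rule kirillov_space_of_half_schwartz[OF k]) (auto simp: f1_def)
  moreover have "(f has_vector_derivative f1 x / of_real x) (at x)" if "x \<noteq> 0" for x
  proof (cases "x > 0")
    case True
    then have "((\<lambda>x. of_real (weight d x) * g1 x) has_vector_derivative f1 x / of_real x) (at x)"
      using deriv[of x g1 g1', OF True g1'(2)[OF True]] by (simp add: f1_def)
    then show ?thesis
      by (rule has_vector_derivative_transform_within_open[where S = "{0<..}"]) (use True f in auto)
  next
    case False
    then have x: "- x > 0" using that by simp
    have "((\<lambda>x. of_real (weight d x) * g2 (- x)) has_vector_derivative f1 x / of_real x) (at x)"
      using has_vector_derivative_reflect[OF deriv[of "- x" g2 g2', OF x g2'(2)[OF x]]] x
      by (simp add: f1_def)
    then show ?thesis
      by (rule has_vector_derivative_transform_within_open[where S = "{..<0}"])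
        (use x f(2)[of "- _"] in auto)
  qed
  ultimately show ?thesis by blast
qed

lemma kirillov_space_measurable:
  assumes "f \<in> kirillov_space d" shows "f \<in> borel_measurable borel"
proof -
  have "continuous_on (- {0}) f"
    using assms unfolding kirillov_space_iff_weight by (blast intro: smooth_with_continuous_on)
  then show ?thesis by (intro borel_measurable_continuous_countable_exceptions[of "{0}"]) auto
qed

lemma kirillov_space_bound:
  assumes "f \<in> kirillov_space d" "d > 0"
  shows "\<exists>C\<ge>0. \<forall>x. x \<noteq> 0 \<longrightarrow> cmod (f x) \<le> C * (\<bar>x\<bar> / (1 + x\<^sup>2))"
proof -
  obtain g1 g2 where g: "half_schwartz g1" "half_schwartz g2"
    and f: "\<And>x. x > 0 \<Longrightarrow> f x = of_real (weight d x) * g1 x"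
      "\<And>x. x > 0 \<Longrightarrow> f (- x) = of_real (weight d x) * g2 x"
    using assms unfolding kirillov_space_iff by blast
  have *: "\<exists>C\<ge>0. \<forall>x>0. cmod (of_real (weight d x) * g x) \<le> C * (x / (1 + x\<^sup>2))" if hs: "half_schwartz g" for g
  proof -
    obtain C where C: "C \<ge> 0" "\<And>x. x > 0 \<Longrightarrow> x ^ 0 * norm (of_real (sqrt x ^ (d - 1)) * g x) \<le> C * (1 / (1 + x\<^sup>2))"
      by (rule rapid_open_bound[OF rapid_open_sqrt_power[OF half_schwartz_rapid_open[OF hs]], of 0 "d - 1"]) blast
    have "cmod (of_real (weight d x) * g x) \<le> C * (x / (1 + x\<^sup>2))" if x: "x > 0" for x
    proof -
      have "cmod (of_real (weight d x) * g x) = x * norm (of_real (sqrt x ^ (d - 1)) * g x)"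
        using x assms(2) by (simp add: weight_eq norm_mult)
      also have "\<dots> \<le> x * (C * (1 / (1 + x\<^sup>2)))"
        using C(2)[OF x] x by (intro mult_left_mono) auto
      finally show ?thesis by (simp add: mult_ac)
    qed
    then show ?thesis using C(1) by blast
  qed
  obtain A where A: "A \<ge> 0" "\<And>x. x > 0 \<Longrightarrow> cmod (f x) \<le> A * (x / (1 + x\<^sup>2))"
    using *[OF g(1)] f(1) by auto
  obtain B where B: "B \<ge> 0" "\<And>x. x > 0 \<Longrightarrow> cmod (f (- x)) \<le> B * (x / (1 + x\<^sup>2))"
    using *[OF g(2)] f(2) by auto
  have "cmod (f x) \<le> max A B * (\<bar>x\<bar> / (1 + x\<^sup>2))" if "x \<noteq> 0" for x
  proof (cases "x > 0")
    case True
    then have "A * (x / (1 + x\<^sup>2)) \<le> max A B * (x / (1 + x\<^sup>2))"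
      by (intro mult_right_mono) auto
    then show ?thesis using A(2)[OF True] True by simp
  next
    case False
    then have x: "- x > 0" using that by simp
    then have "B * (- x / (1 + (- x)\<^sup>2)) \<le> max A B * (- x / (1 + (- x)\<^sup>2))"
      by (intro mult_right_mono divide_nonneg_nonneg) auto
    then show ?thesis using B(2)[OF x] x by simp
  qed
  then show ?thesis using A(1) by (intro exI[of _ "max A B"]) auto
qed

lemma kirillov_space_represents:
  assumes "f \<in> kirillov_space d" "d > 0" shows "\<exists>v. represents f v"
proof -
  obtain C where "\<And>x. x \<noteq> 0 \<Longrightarrow> cmod (f x) \<le> C * (\<bar>x\<bar> / (1 + x\<^sup>2))"
    using kirillov_space_bound[OF assms] by blast
  then show ?thesis
    by (intro represents_exists square_integrable_majorant[of f C] kirillov_space_measurable[OF assms(1)])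
qed

section \<open>Second order Taylor estimates in the Hilbert space\<close>

text \<open>The mean value inequality, applied to \<open>\<phi>1\<close> and then to
  \<open>\<phi>\<close> minus its linear part, gives the constant \<open>B\<close>; the sharp
  \<open>B / 2\<close> is not worth an integral remainder here.\<close>

lemma taylor_bound:
  fixes \<phi> :: "real \<Rightarrow> complex"
  assumes "\<And>s. \<bar>s\<bar> \<le> 1 \<Longrightarrow> (\<phi> has_vector_derivative \<phi>1 s) (at s)"
    "\<And>s. \<bar>s\<bar> \<le> 1 \<Longrightarrow> (\<phi>1 has_vector_derivative \<phi>2 s) (at s)"
    "\<And>s. \<bar>s\<bar> \<le> 1 \<Longrightarrow> norm (\<phi>2 s) \<le> B" and t: "\<bar>t\<bar> \<le> 1"
  shows "norm (\<phi> t - \<phi> 0 - t *\<^sub>R \<phi>1 0) \<le> B * t\<^sup>2"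
proof -
  have bound: "norm (f u - f 0) \<le> C * \<bar>u\<bar>"
    if "\<And>s. \<bar>s\<bar> \<le> \<bar>t\<bar> \<Longrightarrow> (f has_vector_derivative f' s) (at s)" "\<And>s. \<bar>s\<bar> \<le> \<bar>t\<bar> \<Longrightarrow> norm (f' s) \<le> C"
      "\<bar>u\<bar> \<le> \<bar>t\<bar>"
    for f f' :: "real \<Rightarrow> complex" and C u
  proof -
    have "norm (f u - f 0) \<le> C * norm (u - 0)"
    proof (rule differentiable_bound[of "{- \<bar>t\<bar>..\<bar>t\<bar>}" f "\<lambda>s h. h *\<^sub>R f' s"])
      fix s assume "s \<in> {- \<bar>t\<bar>..\<bar>t\<bar>}"
      then have s: "\<bar>s\<bar> \<le> \<bar>t\<bar>" by auto
      show "(f has_derivative (\<lambda>h. h *\<^sub>R f' s)) (at s within {- \<bar>t\<bar>..\<bar>t\<bar>})"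
        using that(1)[OF s] unfolding has_vector_derivative_def by (rule has_derivative_at_withinI)
      show "onorm (\<lambda>h. h *\<^sub>R f' s) \<le> C"
        using mult_left_mono[OF that(2)[OF s]] by (intro onorm_le) (simp add: mult.commute[of C])
    qed (use that in auto)
    then show ?thesis by simp
  qed
  have B: "0 \<le> B" using assms(3)[of 0] norm_ge_zero[of "\<phi>2 0"] by (simp del: norm_ge_zero)
  have \<phi>1: "norm (\<phi>1 s - \<phi>1 0) \<le> B * \<bar>t\<bar>" if s: "\<bar>s\<bar> \<le> \<bar>t\<bar>" for s
  proof -
    have "norm (\<phi>1 s - \<phi>1 0) \<le> B * \<bar>s\<bar>"
      by (rule bound[of \<phi>1 \<phi>2]) (use assms t s in auto)
    also have "\<dots> \<le> B * \<bar>t\<bar>" using s B by (rule mult_left_mono)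
    finally show ?thesis .
  qed
  have \<phi>': "((\<lambda>s. \<phi> s - s *\<^sub>R \<phi>1 0) has_vector_derivative \<phi>1 s - \<phi>1 0) (at s)" if "\<bar>s\<bar> \<le> \<bar>t\<bar>" for s
    using that t by (intro has_vector_derivative_diff assms(1)) (auto intro!: derivative_eq_intros)
  have "norm ((\<phi> t - t *\<^sub>R \<phi>1 0) - (\<phi> 0 - 0 *\<^sub>R \<phi>1 0)) \<le> (B * \<bar>t\<bar>) * \<bar>t\<bar>"
    by (rule bound[of "\<lambda>s. \<phi> s - s *\<^sub>R \<phi>1 0", OF \<phi>' \<phi>1]) auto
  then show ?thesis by (simp add: algebra_simps power2_eq_square flip: abs_mult)
qed

lemma has_vector_derivative_of_quadratic_bound:
  assumes "\<And>t. \<bar>t\<bar> \<le> 1 \<Longrightarrow> norm (V t - V 0 - t *\<^sub>R D) \<le> B * t\<^sup>2"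
  shows "(V has_vector_derivative D) (at 0)"
  unfolding has_vector_derivative_def has_derivative_iff_norm
proof (intro conjI bounded_linear_scaleR_left)
  have "\<forall>\<^sub>F t in at (0::real). \<bar>t\<bar> \<le> 1"
    by (rule eventually_at_ball'[of 1, THEN eventually_mono]) (auto simp: dist_real_def)
  then have bound: "\<forall>\<^sub>F t in at 0. norm (norm (V t - V 0 - (t - 0) *\<^sub>R D) / norm (t - 0)) \<le> B * \<bar>t\<bar>"
    unfolding eventually_at_filter
  proof eventually_elim
    case (elim t)
    show ?case
    proof (intro impI)
      assume "t \<noteq> 0"
      then have "norm (V t - V 0 - t *\<^sub>R D) \<le> (B * \<bar>t\<bar>) * \<bar>t\<bar>"
        using assms[of t] elim by (simp add: power2_eq_square mult.assoc flip: abs_mult)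
      then show "norm (norm (V t - V 0 - (t - 0) *\<^sub>R D) / norm (t - 0)) \<le> B * \<bar>t\<bar>"
        using \<open>t \<noteq> 0\<close> by (simp add: pos_divide_le_eq)
    qed
  qed
  have "((\<lambda>t::real. B * \<bar>t\<bar>) \<longlongrightarrow> B * \<bar>0\<bar>) (at 0)"
    by (intro tendsto_intros)
  then have lim: "((\<lambda>t::real. B * \<bar>t\<bar>) \<longlongrightarrow> 0) (at 0)" by simp
  from bound lim show "((\<lambda>t. norm (V t - V 0 - (t - 0) *\<^sub>R D) / norm (t - 0)) \<longlongrightarrow> 0) (at 0)"
    by (rule Lim_null_comparison)
qed

text \<open>Pointwise derivatives do not give a derivative in norm. A second derivative with a
  square integrable majorant uniform in \<open>s\<close> does, as it makes the remainder quadratic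
  in norm.\<close>

lemma represents_taylor:
  fixes \<phi> \<phi>1 \<phi>2 :: "real \<Rightarrow> real \<Rightarrow> complex"
  assumes C: "C \<ge> 0"
    and \<phi>: "\<And>x s. x \<noteq> 0 \<Longrightarrow> \<bar>s\<bar> \<le> 1 \<Longrightarrow> ((\<lambda>s. \<phi> s x) has_vector_derivative \<phi>1 s x) (at s)"
    and \<phi>1: "\<And>x s. x \<noteq> 0 \<Longrightarrow> \<bar>s\<bar> \<le> 1 \<Longrightarrow> ((\<lambda>s. \<phi>1 s x) has_vector_derivative \<phi>2 s x) (at s)"
    and \<phi>2: "\<And>x s. x \<noteq> 0 \<Longrightarrow> \<bar>s\<bar> \<le> 1 \<Longrightarrow> norm (\<phi>2 s x) \<le> C * (\<bar>x\<bar> / (1 + x\<^sup>2))"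
    and V: "\<And>t. represents (\<phi> t) (V t)" and D: "represents (\<phi>1 0) D"
  shows "(V has_vector_derivative D) (at 0)"
proof -
  obtain K where K: "K \<ge> 0" "\<And>f v C. represents f v \<Longrightarrow> C \<ge> 0 \<Longrightarrow>
    (\<And>x. x \<noteq> 0 \<Longrightarrow> cmod (f x) \<le> C * (\<bar>x\<bar> / (1 + x\<^sup>2))) \<Longrightarrow> norm v \<le> C * K"
    by (rule represents_norm_majorant) blast
  show ?thesis
  proof (rule has_vector_derivative_of_quadratic_bound)
    fix t :: real assume t: "\<bar>t\<bar> \<le> 1"
    have rep: "represents (\<lambda>x. \<phi> t x - \<phi> 0 x - of_real t * \<phi>1 0 x) (V t - V 0 - t *\<^sub>R D)"
      by (intro represents_diff represents_scaleR V D)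
    have "norm (V t - V 0 - t *\<^sub>R D) \<le> (C * t\<^sup>2) * K"
    proof (rule K(2)[OF rep])
      fix x :: real assume x: "x \<noteq> 0"
      have "norm (\<phi> t x - \<phi> 0 x - t *\<^sub>R \<phi>1 0 x) \<le> (C * (\<bar>x\<bar> / (1 + x\<^sup>2))) * t\<^sup>2"
        by (rule taylor_bound[OF \<phi>[OF x] \<phi>1[OF x] \<phi>2[OF x] t])
      then show "cmod (\<phi> t x - \<phi> 0 x - of_real t * \<phi>1 0 x) \<le> (C * t\<^sup>2) * (\<bar>x\<bar> / (1 + x\<^sup>2))"
        by (simp add: scaleR_conv_of_real mult_ac)
    qed (use C in simp)
    then show "norm (V t - V 0 - t *\<^sub>R D) \<le> (C * K) * t\<^sup>2" by (simp add: mult_ac)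
  qed
qed

section \<open>Two by two matrices\<close>

lemma mat2_nth [simp]:
  "mat2 a b c e $ 1 $ 1 = a" "mat2 a b c e $ 1 $ 2 = b"
  "mat2 a b c e $ 2 $ 1 = c" "mat2 a b c e $ 2 $ 2 = e"
  by (simp_all add: mat2_def vector_2)

lemma mat2_eqI:
  fixes g h :: "real^2^2"
  assumes "g $ 1 $ 1 = h $ 1 $ 1" "g $ 1 $ 2 = h $ 1 $ 2" "g $ 2 $ 1 = h $ 2 $ 1" "g $ 2 $ 2 = h $ 2 $ 2"
  shows "g = h"
  using assms by (simp add: vec_eq_iff forall_2)

lemma mat2_mult:
  "mat2 a b c e ** mat2 a' b' c' e' = mat2 (a * a' + b * c') (a * b' + b * e') (c * a' + e * c') (c * b' + e * e')"
  by (rule mat2_eqI) (simp_all add: matrix_matrix_mult_def sum_2)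

lemma mat_1_eq_mat2: "mat 1 = mat2 1 0 0 1"
  by (rule mat2_eqI) (simp_all add: mat_def)

lemma GL2_iff: "g \<in> GL2 \<longleftrightarrow> g $ 1 $ 1 * g $ 2 $ 2 - g $ 1 $ 2 * g $ 2 $ 1 \<noteq> 0"
  by (simp add: GL2_def invertible_det_nz det_2)

lemma GL2_mult: "g \<in> GL2 \<Longrightarrow> h \<in> GL2 \<Longrightarrow> g ** h \<in> GL2"
  by (simp add: GL2_def invertible_mult)

lemma open_GL2: "open GL2"
proof -
  have "GL2 = (\<lambda>g. g $ 1 $ 1 * g $ 2 $ 2 - g $ 1 $ 2 * g $ 2 $ 1) -` (- {0})"
    by (auto simp: GL2_iff)
  also have "open \<dots>"
    by (intro open_vimage continuous_intros open_Compl closed_singleton)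
  finally show ?thesis .
qed

lemma mat_1_GL2: "mat 1 \<in> GL2"
  by (simp add: GL2_iff mat_1_eq_mat2)

section \<open>Differentiating products of operators\<close>

lemma has_derivative_operator_family:
  fixes T :: "real \<Rightarrow> 'b \<Rightarrow> 'b :: real_normed_vector" and p :: "'e :: euclidean_space \<Rightarrow> real"
  assumes lin: "\<And>t. \<bar>t\<bar> \<le> 1 \<Longrightarrow> linear (T t)" and bound: "\<And>t u. \<bar>t\<bar> \<le> 1 \<Longrightarrow> norm (T t u) \<le> C * norm u"
    and p: "(p has_derivative p') (at x0)" "p x0 = 0"
    and F: "(F has_derivative F') (at x0)"
    and T0: "\<And>u. T 0 u = u"
    and D: "((\<lambda>t. T t (F x0)) has_vector_derivative D) (at 0)"
    and cont: "\<And>h. isCont (\<lambda>t. T t (F' h)) 0"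
  shows "((\<lambda>x. T (p x) (F x)) has_derivative (\<lambda>h. p' h *\<^sub>R D + F' h)) (at x0)"
proof -
  have p_lim: "(p \<longlongrightarrow> 0) (at x0)"
    using has_derivative_continuous[OF p(1)] p(2) by (simp add: continuous_at)
  have small: "\<forall>\<^sub>F x in at x0. \<bar>p x\<bar> \<le> 1"
    using tendstoD[OF p_lim, of 1] by (auto simp: dist_real_def elim!: eventually_mono)
  have F'_lin: "linear F'" using F by (rule has_derivative_linear)
  have comp: "((\<lambda>x. T (p x) (F x0)) has_derivative (\<lambda>h. p' h *\<^sub>R D)) (at x0)"
    using has_derivative_compose[OF p(1), of "\<lambda>t. T t (F x0)" "\<lambda>t. t *\<^sub>R D"] D p(2)
    by (simp add: has_vector_derivative_def)
  let ?e1 = "\<lambda>x. norm (F x - F x0 - F' (x - x0)) / norm (x - x0)"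
  let ?e2 = "\<lambda>x. norm (T (p x) (F x0) - T (p x0) (F x0) - p' (x - x0) *\<^sub>R D) / norm (x - x0)"
  let ?e3 = "\<lambda>x. \<Sum>b\<in>Basis. norm (T (p x) (F' b) - F' b)"
  have e3: "(?e3 \<longlongrightarrow> 0) (at x0)"
  proof -
    have "((\<lambda>x. T (p x) (F' b)) \<longlongrightarrow> T 0 (F' b)) (at x0)" for b
      using isCont_tendsto_compose[OF cont p_lim] by simp
    then have "(?e3 \<longlongrightarrow> (\<Sum>b\<in>Basis. norm (T 0 (F' b) - F' b))) (at x0)"
      by (intro tendsto_intros)
    then show ?thesis by (simp add: T0)
  qed
  have lim: "((\<lambda>x. C * ?e1 x + ?e2 x + ?e3 x) \<longlongrightarrow> C * 0 + 0 + 0) (at x0)"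
    by (intro tendsto_intros e3) (use F comp in \<open>auto simp: has_derivative_iff_norm\<close>)
  have "\<forall>\<^sub>F x in at x0. norm (norm (T (p x) (F x) - T (p x0) (F x0) - (p' (x - x0) *\<^sub>R D + F' (x - x0)))
      / norm (x - x0)) \<le> C * ?e1 x + ?e2 x + ?e3 x"
    using small unfolding eventually_at_filter
  proof eventually_elim
    case (elim x)
    show ?case
    proof (intro impI)
      assume "x \<noteq> x0" "x \<in> UNIV"
      define h where "h = x - x0"
      have h: "norm h > 0" using \<open>x \<noteq> x0\<close> by (simp add: h_def)
      have small: "\<bar>p x\<bar> \<le> 1" using elim \<open>x \<noteq> x0\<close> by simp
      interpret T: linear "T (p x)" by (rule lin[OF small])
      interpret F': linear F' by (rule F'_lin)
      let ?S = "\<lambda>u. T (p x) u - u"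
      \<comment> \<open>Strong continuity is known vector by vector; expanding \<open>h\<close> in
        the finite basis makes it uniform in the direction.\<close>
      have "?S (F' h) = (\<Sum>b\<in>Basis. (h \<bullet> b) *\<^sub>R ?S (F' b))"
      proof -
        have "F' h = (\<Sum>b\<in>Basis. (h \<bullet> b) *\<^sub>R F' b)"
          by (metis (no_types, lifting) F'.sum F'.scale euclidean_representation sum.cong)
        then show ?thesis
          by (simp add: T.sum T.scale scaleR_diff_right sum_subtractf)
      qed
      then have "norm (?S (F' h)) \<le> (\<Sum>b\<in>Basis. \<bar>h \<bullet> b\<bar> * norm (?S (F' b)))"
        using norm_sum[of "\<lambda>b. (h \<bullet> b) *\<^sub>R ?S (F' b)" Basis] by simp
      also have "\<dots> \<le> (\<Sum>b\<in>Basis. norm h * norm (?S (F' b)))"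
        by (intro sum_mono mult_right_mono Basis_le_norm) auto
      finally have S: "norm (?S (F' h)) \<le> norm h * ?e3 x" by (simp add: sum_distrib_left)
      have "T (p x) (F x) - T (p x0) (F x0) - (p' h *\<^sub>R D + F' h)
          = T (p x) (F x - F x0 - F' h) + (T (p x) (F x0) - T (p x0) (F x0) - p' h *\<^sub>R D) + ?S (F' h)"
        by (simp add: T.diff)
      then have "norm (T (p x) (F x) - T (p x0) (F x0) - (p' h *\<^sub>R D + F' h))
          \<le> norm (T (p x) (F x - F x0 - F' h)) + norm (T (p x) (F x0) - T (p x0) (F x0) - p' h *\<^sub>R D)
            + norm (?S (F' h))"
        by (metis norm_triangle_le add_mono norm_triangle_ineq order_refl)
      also have "\<dots> \<le> C * norm (F x - F x0 - F' h) + norm (T (p x) (F x0) - T (p x0) (F x0) - p' h *\<^sub>R D)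
            + norm h * ?e3 x"
        by (intro add_mono bound[OF small] S order_refl)
      finally have "norm (T (p x) (F x) - T (p x0) (F x0) - (p' h *\<^sub>R D + F' h)) / norm h
          \<le> (C * norm (F x - F x0 - F' h) + norm (T (p x) (F x0) - T (p x0) (F x0) - p' h *\<^sub>R D)
            + norm h * ?e3 x) / norm h"
        using h by (intro divide_right_mono) auto
      also have "\<dots> = C * (norm (F x - F x0 - F' h) / norm h)
          + norm (T (p x) (F x0) - T (p x0) (F x0) - p' h *\<^sub>R D) / norm h + ?e3 x"
        using h by (simp add: add_divide_distrib)
      finally show "norm (norm (T (p x) (F x) - T (p x0) (F x0) - (p' (x - x0) *\<^sub>R D + F' (x - x0)))
          / norm (x - x0)) \<le> C * ?e1 x + ?e2 x + ?e3 x"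
        by (simp add: h_def)
    qed
  qed
  then have "((\<lambda>x. norm (T (p x) (F x) - T (p x0) (F x0) - (p' (x - x0) *\<^sub>R D + F' (x - x0)))
      / norm (x - x0)) \<longlongrightarrow> 0) (at x0)"
    by (rule Lim_null_comparison) (use lim in simp)
  moreover have "bounded_linear (\<lambda>h. p' h *\<^sub>R D + F' h)"
    by (intro bounded_linear_add bounded_linear_scaleR_const has_derivative_bounded_linear[OF p(1)]
        has_derivative_bounded_linear[OF F])
  ultimately show ?thesis by (simp add: has_derivative_iff_norm)
qed

section \<open>The one-parameter subgroups\<close>

lemma exp_curve_has_vector_derivative:
  "((\<lambda>s. exp (c * of_real s)) has_vector_derivative c * exp (c * of_real s)) (at s)" for c :: complex
proof -
  have "((\<lambda>z. exp (c * z)) has_field_derivative c * exp (c * of_real s)) (at (of_real s))"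
    by (auto intro!: derivative_eq_intros)
  from field_vector_diff_chain_at[OF has_vector_derivative_of_real[OF DERIV_ident] this]
  show ?thesis by (simp add: o_def)
qed

locale kirillov =
  fixes d :: nat and s1 s2 :: complex and m1 m2 \<epsilon> :: int and R :: "real^2^2 \<Rightarrow> l2 \<Rightarrow> l2"
  assumes d_pos: "d > 0" and rep: "kirillov_rep d s1 s2 m1 m2 \<epsilon> R"
begin

abbreviation upper :: "real \<Rightarrow> real^2^2" where "upper y \<equiv> mat2 1 y 0 1"
abbreviation diag :: "real \<Rightarrow> real^2^2" where "diag a \<equiv> mat2 a 0 0 1"
abbreviation scalar :: "real \<Rightarrow> real^2^2" where "scalar b \<equiv> mat2 b 0 0 b"
abbreviation w :: "real^2^2" where "w \<equiv> mat2 0 (-1) 1 0"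

definition \<sigma> :: complex where "\<sigma> = (s1 + s2 + 1) / 2"

definition KV :: "l2 set" where "KV = {v. \<exists>f\<in>kirillov_space d. represents f v}"

lemma R_bounded_linear: "g \<in> GL2 \<Longrightarrow> bounded_linear (R g)"
  using rep by (simp add: kirillov_rep_def GL2_representation_def)

lemma R_one [simp]: "R (mat 1) v = v"
  using rep by (simp add: kirillov_rep_def GL2_representation_def)

lemma R_mult: "g \<in> GL2 \<Longrightarrow> h \<in> GL2 \<Longrightarrow> R (g ** h) v = R g (R h v)"
  using rep by (simp add: kirillov_rep_def GL2_representation_def)

lemma GL2_generators [simp]:
  "upper y \<in> GL2" "a \<noteq> 0 \<Longrightarrow> diag a \<in> GL2" "a \<noteq> 0 \<Longrightarrow> scalar a \<in> GL2" "w \<in> GL2" "mat2 1 0 y 1 \<in> GL2"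
  by (simp_all add: GL2_iff)

lemma represents_upper:
  "represents f v \<Longrightarrow> represents (\<lambda>x. exp (\<i> * of_real (y * x)) * f x) (R (upper y) v)"
  using rep unfolding kirillov_rep_def by blast

lemma represents_diag_exp:
  assumes "represents f v"
  shows "represents (\<lambda>x. exp (\<sigma> * of_real t) * f (exp t * x)) (R (diag (exp t)) v)"
proof -
  have "represents (\<lambda>x. of_real \<bar>exp t\<bar> powr ((s1 + s2 + 1) / 2) * f (exp t * x)) (R (diag (exp t)) v)"
    using rep assms unfolding kirillov_rep_def by (metis exp_not_eq_zero)
  moreover have "of_real \<bar>exp t\<bar> powr ((s1 + s2 + 1) / 2) = exp (\<sigma> * of_real t)"
    by (simp add: powr_def \<sigma>_def Ln_of_real flip: exp_of_real)
  ultimately show ?thesis by simp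
qed

lemma R_scalar:
  assumes "b \<noteq> 0" shows "R (scalar b) v = scaleC_l2 (quasichar (s1 + s2 + 1) (m1 + m2) b) v"
proof -
  obtain f where f: "represents f v" using represents_ex by blast
  then have "represents (\<lambda>x. quasichar (s1 + s2 + 1) (m1 + m2) b * f x) (R (scalar b) v)"
    using rep assms unfolding kirillov_rep_def by blast
  then show ?thesis
    using represents_scaleC[OF f] by (rule represents_unique)
qed

lemma R_scalar_exp: "R (scalar (exp t)) v = scaleC_l2 (exp (2 * \<sigma> * of_real t)) v"
proof -
  have "2 * \<sigma> = s1 + s2 + 1" by (simp add: \<sigma>_def)
  then show ?thesis by (simp add: R_scalar quasichar_def powr_def Ln_of_real flip: exp_of_real)
qed

lemma represents_w:
  "f \<in> kirillov_space d \<Longrightarrow> represents f v \<Longrightarrow>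
    represents (\<lambda>y. of_real (sgn y) powi \<epsilon> * (\<integral>x. f x * bessel_kernel d (x * y) \<partial>mult_haar)) (R w v)"
  using rep unfolding kirillov_rep_def by blast

lemma norm_R_upper: "norm (R (upper y) v) = norm v"
proof -
  obtain f where "represents f v" using represents_ex by blast
  from represents_norm_scaled[OF represents_upper[OF this] this, of 1]
  show ?thesis by (simp add: norm_mult)
qed

text \<open>The measure \<open>dx/|x|\<close> is invariant under dilations, so only the modulus of
  the scalar factor remains.\<close>

lemma norm_R_diag_exp: "norm (R (diag (exp t)) v) = exp (Re \<sigma> * t) * norm v"
proof -
  obtain f where f: "represents f v" using represents_ex by blast
  have meas: "(\<lambda>x. (cmod (f x))\<^sup>2) \<in> borel_measurable borel"
    using represents_measurable[OF f] by measurable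
  have "represents (\<lambda>x. exp (\<sigma> * of_real t) * f (exp t * x)) (R (diag (exp t)) v)"
    by (rule represents_diag_exp[OF f])
  then have "(norm (R (diag (exp t)) v))\<^sup>2 = (\<integral>x. (cmod (exp (\<sigma> * of_real t)))\<^sup>2 * (cmod (f (exp t * x)))\<^sup>2 \<partial>mult_haar)"
    by (subst represents_norm) (auto simp: norm_mult power_mult_distrib)
  also have "\<dots> = (cmod (exp (\<sigma> * of_real t)))\<^sup>2 * (norm v)\<^sup>2"
    using integral_mult_haar_scale[OF meas, of "exp t"] by (simp add: represents_norm[OF f])
  also have "\<dots> = (exp (Re \<sigma> * t) * norm v)\<^sup>2"
    by (simp add: power_mult_distrib)
  finally show ?thesis by (simp add: power2_eq_iff_nonneg)
qed

section \<open>Stability of K under the generators and under \<open>w\<close>\<close>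

lemma KV_add: "u \<in> KV \<Longrightarrow> v \<in> KV \<Longrightarrow> u + v \<in> KV"
  unfolding KV_def using kirillov_space_add represents_add by blast

lemma KV_scaleC: "v \<in> KV \<Longrightarrow> scaleC_l2 c v \<in> KV"
  unfolding KV_def using kirillov_space_mult_left represents_scaleC by blast

lemma KV_scaleR: "v \<in> KV \<Longrightarrow> r *\<^sub>R v \<in> KV"
  using KV_scaleC[of v "of_real r"] by (simp add: scaleC_l2_scaleR)

lemma KV_upper_derivative:
  assumes "v \<in> KV"
  shows "\<exists>D\<in>KV. ((\<lambda>y. R (upper y) v) has_vector_derivative D) (at 0)"
proof -
  obtain f where f: "f \<in> kirillov_space d" "represents f v" using assms by (auto simp: KV_def)
  \<comment> \<open>The infinitesimal generator. It preserves K, so the second derivative, which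
    involves \<open>A (A f)\<close>, has the majorant.\<close>
  define A where "A f x = \<i> * (of_real x * f x)" for f :: "real \<Rightarrow> complex" and x
  have A: "A f \<in> kirillov_space d" if "f \<in> kirillov_space d" for f
    unfolding A_def by (intro kirillov_space_mult_left kirillov_space_times_x that)
  obtain D where D: "represents (A f) D" using kirillov_space_represents[OF A[OF f(1)] d_pos] by blast
  obtain C where C: "C \<ge> 0" "\<And>x. x \<noteq> 0 \<Longrightarrow> cmod (A (A f) x) \<le> C * (\<bar>x\<bar> / (1 + x\<^sup>2))"
    using kirillov_space_bound[OF A[OF A[OF f(1)]] d_pos] by blast
  have deriv: "((\<lambda>s. exp (\<i> * of_real (s * x)) * f x) has_vector_derivative exp (\<i> * of_real (s * x)) * A f x) (at s)"
    for f x s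
  proof -
    show ?thesis
      using has_vector_derivative_mult_left[OF exp_curve_has_vector_derivative[of "\<i> * of_real x" s], of "f x"]
      by (simp add: A_def mult_ac)
  qed
  have "((\<lambda>y. R (upper y) v) has_vector_derivative D) (at 0)"
  proof (rule represents_taylor[OF C(1) deriv deriv])
    show "norm (exp (\<i> * of_real (s * x)) * A (A f) x) \<le> C * (\<bar>x\<bar> / (1 + x\<^sup>2))" if "x \<noteq> 0" for x s
      using C(2)[OF that] by (simp add: norm_mult)
  qed (use represents_upper[OF f(2)] D in auto)
  then show ?thesis using D A[OF f(1)] unfolding KV_def by blast
qed

text \<open>\<open>27 = 3 * 9\<close>: both \<open>exp s\<close> and \<open>exp (- s)\<close> are at
  most 3, so the numerator changes by a factor of at most 3 and the quadratic denominator by at most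
  9.\<close>

lemma majorant_dilate:
  fixes s x :: real
  assumes "\<bar>s\<bar> \<le> 1" shows "\<bar>exp s * x\<bar> / (1 + (exp s * x)\<^sup>2) \<le> 27 * (\<bar>x\<bar> / (1 + x\<^sup>2))"
proof -
  have pos: "1 + x\<^sup>2 > 0" for x :: real by (auto intro: add_pos_nonneg)
  have "exp u \<le> 3" if "\<bar>u\<bar> \<le> 1" for u :: real
  proof -
    have "exp u \<le> exp 1" using that by auto
    then show ?thesis using exp_le by linarith
  qed
  then have e: "exp s \<le> 3" "exp (- s) \<le> 3" using assms by auto
  have "1 + x\<^sup>2 \<le> 9 * (1 + (exp s * x)\<^sup>2)"
  proof -
    have "\<bar>x\<bar> = exp (- s) * \<bar>exp s * x\<bar>" by (simp add: abs_mult exp_minus)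
    also have "\<dots> \<le> 3 * \<bar>exp s * x\<bar>" using e by (intro mult_right_mono) auto
    finally have "\<bar>x\<bar>\<^sup>2 \<le> (3 * \<bar>exp s * x\<bar>)\<^sup>2" by (intro power_mono) auto
    then show ?thesis by (simp add: power_mult_distrib)
  qed
  moreover have "\<bar>exp s * x\<bar> \<le> 3 * \<bar>x\<bar>"
    using e by (simp add: abs_mult mult_right_mono)
  ultimately have "\<bar>exp s * x\<bar> * (1 + x\<^sup>2) \<le> (3 * \<bar>x\<bar>) * (9 * (1 + (exp s * x)\<^sup>2))"
    by (intro mult_mono) auto
  then show ?thesis using pos[of x] pos[of "exp s * x"] by (simp add: field_simps)
qed

lemma KV_diag_derivative:
  assumes "v \<in> KV"
  shows "\<exists>D\<in>KV. ((\<lambda>t. R (diag (exp t)) v) has_vector_derivative D) (at 0)"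
proof -
  obtain f where f: "f \<in> kirillov_space d" "represents f v" using assms by (auto simp: KV_def)
  have deriv: "((\<lambda>s. exp (\<sigma> * of_real s) * f (exp s * x)) has_vector_derivative
      exp (\<sigma> * of_real s) * (\<sigma> * f (exp s * x) + f1 (exp s * x))) (at s)"
    if "x \<noteq> 0" and f1: "\<forall>x. x \<noteq> 0 \<longrightarrow> (f has_vector_derivative f1 x / of_real x) (at x)" for f f1 x s
  proof -
    have "((\<lambda>s. exp s * x) has_vector_derivative exp s * x) (at s)"
      by (auto intro!: derivative_eq_intros simp flip: has_real_derivative_iff_has_vector_derivative)
    from vector_diff_chain_at[OF this f1[rule_format, of "exp s * x"]] \<open>x \<noteq> 0\<close>
    have 1: "((\<lambda>s. f (exp s * x)) has_vector_derivative f1 (exp s * x)) (at s)"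
      by (simp add: o_def scaleR_conv_of_real)
    have 2: "((\<lambda>s. exp (\<sigma> * of_real s)) has_vector_derivative \<sigma> * exp (\<sigma> * of_real s)) (at s)"
      by (rule exp_curve_has_vector_derivative)
    from has_vector_derivative_mult[OF 2 1] show ?thesis by (simp add: algebra_simps)
  qed
  \<comment> \<open>The generator is \<open>\<sigma> + x d/dx\<close>. It is applied twice, for the
    first and the second derivative along the subgroup.\<close>
  have step: "\<exists>f'\<in>kirillov_space d. \<forall>x s. x \<noteq> 0 \<longrightarrow>
      ((\<lambda>s. exp (\<sigma> * of_real s) * f (exp s * x)) has_vector_derivative exp (\<sigma> * of_real s) * f' (exp s * x)) (at s)"
    if f: "f \<in> kirillov_space d" for f
  proof -
    obtain f1 where f1: "f1 \<in> kirillov_space d" "\<forall>x. x \<noteq> 0 \<longrightarrow> (f has_vector_derivative f1 x / of_real x) (at x)"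
      using kirillov_space_euler_derivative[OF f] by blast
    show ?thesis
      using deriv[of _ f f1] f1(2)
      by (intro bexI[of _ "\<lambda>x. \<sigma> * f x + f1 x"] kirillov_space_add kirillov_space_mult_left f f1) simp
  qed
  obtain f1 where f1: "f1 \<in> kirillov_space d" "\<And>x s. x \<noteq> 0 \<Longrightarrow>
      ((\<lambda>s. exp (\<sigma> * of_real s) * f (exp s * x)) has_vector_derivative exp (\<sigma> * of_real s) * f1 (exp s * x)) (at s)"
    using step[OF f(1)] by blast
  obtain f2 where f2: "f2 \<in> kirillov_space d" "\<And>x s. x \<noteq> 0 \<Longrightarrow>
      ((\<lambda>s. exp (\<sigma> * of_real s) * f1 (exp s * x)) has_vector_derivative exp (\<sigma> * of_real s) * f2 (exp s * x)) (at s)"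
    using step[OF f1(1)] by blast
  obtain D where D: "represents f1 D" using kirillov_space_represents[OF f1(1) d_pos] by blast
  obtain C where C: "C \<ge> 0" "\<And>x. x \<noteq> 0 \<Longrightarrow> cmod (f2 x) \<le> C * (\<bar>x\<bar> / (1 + x\<^sup>2))"
    using kirillov_space_bound[OF f2(1) d_pos] by blast
  have "((\<lambda>t. R (diag (exp t)) v) has_vector_derivative D) (at 0)"
  proof (rule represents_taylor[OF _ f1(2) f2(2)])
    fix x s :: real assume x: "x \<noteq> 0" and s: "\<bar>s\<bar> \<le> 1"
    have "Re \<sigma> * s \<le> \<bar>Re \<sigma>\<bar>"
      using mult_left_mono[OF s, of "\<bar>Re \<sigma>\<bar>"] abs_ge_self[of "Re \<sigma> * s"] by (simp add: abs_mult)
    then have e: "cmod (exp (\<sigma> * of_real s)) \<le> exp \<bar>Re \<sigma>\<bar>" by simp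
    have "cmod (f2 (exp s * x)) \<le> C * (\<bar>exp s * x\<bar> / (1 + (exp s * x)\<^sup>2))"
      using x by (intro C) auto
    also have "\<dots> \<le> C * (27 * (\<bar>x\<bar> / (1 + x\<^sup>2)))"
      by (intro mult_left_mono majorant_dilate s C)
    finally have "cmod (exp (\<sigma> * of_real s)) * cmod (f2 (exp s * x)) \<le> exp \<bar>Re \<sigma>\<bar> * (C * (27 * (\<bar>x\<bar> / (1 + x\<^sup>2))))"
      using e by (intro mult_mono) auto
    then show "norm (exp (\<sigma> * of_real s) * f2 (exp s * x)) \<le> (exp \<bar>Re \<sigma>\<bar> * C * 27) * (\<bar>x\<bar> / (1 + x\<^sup>2))"
      by (simp add: norm_mult mult_ac)
  qed (use represents_diag_exp[OF f(2)] D C in auto)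
  then show ?thesis using D f1(1) unfolding KV_def by blast
qed

lemma KV_scalar_derivative:
  assumes "v \<in> KV"
  shows "\<exists>D\<in>KV. ((\<lambda>t. R (scalar (exp t)) v) has_vector_derivative D) (at 0)"
proof -
  have "((\<lambda>t. exp (2 * \<sigma> * of_real t)) has_vector_derivative 2 * \<sigma>) (at 0)"
    using exp_curve_has_vector_derivative[of "2 * \<sigma>" 0] by simp
  from bounded_linear.has_vector_derivative[OF bounded_linear_scaleC_l2_left this]
  have "((\<lambda>t. R (scalar (exp t)) v) has_vector_derivative scaleC_l2 (2 * \<sigma>) v) (at 0)"
    unfolding R_scalar_exp .
  then show ?thesis using KV_scaleC[OF assms] by blast
qed

text \<open>The weight of \<open>f\<close>, the weight in the kernel and the density combine to
  \<open>weight^2 / x = x^d\<close>, exactly the power that goes with order \<open>d\<close> in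
  \<open>half_schwartz_hankel\<close>.\<close>

lemma bessel_transform_half_schwartz:
  assumes g: "half_schwartz g1" "half_schwartz g2"
    and f: "\<And>x. x > 0 \<Longrightarrow> f x = of_real (weight d x) * g1 x"
      "\<And>x. x > 0 \<Longrightarrow> f (- x) = of_real (weight d x) * g2 x" and y: "y > 0"
  shows "hankel d (\<lambda>x. f x * of_real (weight d x / x)) y = hankel d (\<lambda>x. of_real (x ^ d) * g1 x) y"
    "hankel d (\<lambda>x. f (- x) * of_real (weight d x / x)) y = hankel d (\<lambda>x. of_real (x ^ d) * g2 x) y"
proof -
  have "of_real (weight d x) * g x * of_real (weight d x / x) = of_real (x ^ d) * g x" if "x > 0" for x and g :: "real \<Rightarrow> complex"
  proof -
    have "of_real (weight d x) * g x * of_real (weight d x / x) = of_real (weight d x * weight d x / x) * g x"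
      by (simp add: mult_ac)
    then show ?thesis using that by (simp add: weight_mult_self)
  qed
  then show "hankel d (\<lambda>x. f x * of_real (weight d x / x)) y = hankel d (\<lambda>x. of_real (x ^ d) * g1 x) y"
    "hankel d (\<lambda>x. f (- x) * of_real (weight d x / x)) y = hankel d (\<lambda>x. of_real (x ^ d) * g2 x) y"
    using f by (auto intro!: hankel_cong)
qed

lemma KV_w:
  assumes "v \<in> KV" shows "R w v \<in> KV"
proof -
  obtain f where f: "f \<in> kirillov_space d" "represents f v" using assms by (auto simp: KV_def)
  obtain g1 g2 where g: "half_schwartz g1" "half_schwartz g2"
    and fg: "\<And>x. x > 0 \<Longrightarrow> f x = of_real (weight d x) * g1 x"
      "\<And>x. x > 0 \<Longrightarrow> f (- x) = of_real (weight d x) * g2 x"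
    using f(1) unfolding kirillov_space_iff by blast
  let ?F = "\<lambda>y. of_real (sgn y) powi \<epsilon> * (\<integral>x. f x * bessel_kernel d (x * y) \<partial>mult_haar)"
  let ?c = "\<i> powi (- (int d + 1))"
  have "?F \<in> kirillov_space d"
  proof (rule kirillov_space_of_half_schwartz)
    show "half_schwartz (\<lambda>y. ?c * hankel d (\<lambda>x. of_real (x ^ d) * g1 x) y)"
      "half_schwartz (\<lambda>y. (((- 1) powi \<epsilon>) * ?c) * hankel d (\<lambda>x. of_real (x ^ d) * g2 x) y)"
      by (intro half_schwartz_mult_left half_schwartz_hankel g)+
    fix y :: real assume y: "y > 0"
    show "?F y = of_real (weight d y) * (?c * hankel d (\<lambda>x. of_real (x ^ d) * g1 x) y)"
      using bessel_transform_eq[OF represents_measurable[OF f(2)], of y d] y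
        bessel_transform_half_schwartz(1)[OF g fg y] by simp
    show "?F (- y) = of_real (weight d y) * ((((- 1) powi \<epsilon>) * ?c) * hankel d (\<lambda>x. of_real (x ^ d) * g2 x) y)"
      using bessel_transform_eq[OF represents_measurable[OF f(2)], of "- y" d] y
        bessel_transform_half_schwartz(2)[OF g fg y] by simp
  qed
  then show ?thesis using represents_w[OF f] unfolding KV_def by blast
qed

text \<open>As \<open>w\<close> squares to minus the identity, its inverse is
  \<open>scalar (- 1) ** w\<close>; this is the conjugate of an upper unipotent by
  \<open>w\<close>.\<close>

lemma R_lower: "R (mat2 1 0 c 1) v = R w (R (upper (- c)) (R (scalar (- 1)) (R w v)))"
proof -
  have "mat2 1 0 c 1 = w ** (upper (- c) ** (scalar (- 1) ** w))"
    by (simp add: mat2_mult)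
  then show ?thesis by (simp add: R_mult GL2_mult)
qed

lemma KV_lower_derivative:
  assumes "v \<in> KV"
  shows "\<exists>D\<in>KV. ((\<lambda>c. R (mat2 1 0 c 1) v) has_vector_derivative D) (at 0)"
proof -
  let ?u = "R (scalar (- 1)) (R w v)"
  have "?u \<in> KV" using KV_w[OF assms] by (simp add: R_scalar KV_scaleC)
  then obtain D where D: "D \<in> KV" "((\<lambda>y. R (upper y) ?u) has_vector_derivative D) (at 0)"
    using KV_upper_derivative by blast
  have "((\<lambda>c. R (upper (- c)) ?u) has_vector_derivative (- 1) *\<^sub>R D) (at 0)"
    using has_vector_derivative_reflect[of "\<lambda>y. R (upper y) ?u" D 0] D(2) by simp
  from bounded_linear.has_vector_derivative[OF R_bounded_linear this, of w]
  have "((\<lambda>c. R (mat2 1 0 c 1) v) has_vector_derivative R w ((- 1) *\<^sub>R D)) (at 0)"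
    unfolding R_lower by simp
  moreover have "R w ((- 1) *\<^sub>R D) \<in> KV" by (intro KV_w KV_scaleR D)
  ultimately show ?thesis by blast
qed

end

section \<open>Smooth maps on open sets\<close>

text \<open>On an open set the derivative within \<open>S\<close> is the full one, so any formula
  \<open>D\<close> may replace the chosen \<open>frechet_derivative\<close>.\<close>

lemma Ck_on_Suc_open:
  assumes "open S" and "\<And>x. x \<in> S \<Longrightarrow> (f has_derivative D x) (at x)"
  shows "Ck_on (Suc k) S f \<longleftrightarrow> (\<forall>v. Ck_on k S (\<lambda>x. D x v))"
proof -
  have "f differentiable_on S"
    using assms unfolding differentiable_on_def differentiable_def
    by (blast intro: has_derivative_at_withinI)
  moreover have "frechet_derivative f (at x within S) = D x" if "x \<in> S" for x
    using frechet_derivative_at[OF assms(2)[OF that]] at_within_open[OF that assms(1)] by simp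
  then have "Ck_on k S (\<lambda>x. frechet_derivative f (at x within S) v) \<longleftrightarrow> Ck_on k S (\<lambda>x. D x v)" for v
    by (intro Ck_on_cong) simp
  ultimately show ?thesis by simp
qed

lemma Ck_on_SucD_open:
  assumes "open S" "Ck_on (Suc k) S f"
  obtains D where "\<And>x. x \<in> S \<Longrightarrow> (f has_derivative D x) (at x)" "\<And>v. Ck_on k S (\<lambda>x. D x v)"
proof -
  have "(f has_derivative frechet_derivative f (at x within S)) (at x)" if "x \<in> S" for x
    using assms that at_within_open[OF that assms(1)]
    by (auto simp: differentiable_on_def frechet_derivative_works)
  then show ?thesis using that[of "\<lambda>x. frechet_derivative f (at x within S)"] assms(2) by simp
qed

lemma Ck_on_add:
  assumes S: "open S" and "Ck_on k S f" "Ck_on k S g"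
  shows "Ck_on k S (\<lambda>x. f x + g x)"
  using assms(2,3)
proof (induction k arbitrary: f g)
  case 0
  then show ?case by (auto intro: continuous_intros)
next
  case (Suc k)
  obtain D where D: "\<And>x. x \<in> S \<Longrightarrow> (f has_derivative D x) (at x)" "\<And>v. Ck_on k S (\<lambda>x. D x v)"
    by (rule Ck_on_SucD_open[OF S Suc.prems(1)]) blast
  obtain E where E: "\<And>x. x \<in> S \<Longrightarrow> (g has_derivative E x) (at x)" "\<And>v. Ck_on k S (\<lambda>x. E x v)"
    by (rule Ck_on_SucD_open[OF S Suc.prems(2)]) blast
  have "((\<lambda>x. f x + g x) has_derivative (\<lambda>v. D x v + E x v)) (at x)" if "x \<in> S" for x
    by (intro has_derivative_add D E that)
  from Ck_on_Suc_open[OF S this, of k] show ?case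
    using Suc.IH[OF D(2) E(2)] by blast
qed

text \<open>The derivative of the composite in direction \<open>v\<close> is the derivative of
  \<open>f\<close> in direction \<open>A v\<close>, again composed with \<open>A\<close>, so the
  induction needs no product rule. It is applied to right translation by \<open>w\<close>.\<close>

lemma Ck_on_compose_linear:
  assumes S: "open S" and A: "bounded_linear A" "\<And>x. x \<in> S \<Longrightarrow> A x \<in> S" and "Ck_on k S f"
  shows "Ck_on k S (\<lambda>x. f (A x))"
  using assms(4)
proof (induction k arbitrary: f)
  case 0
  have "continuous_on S A" by (rule linear_continuous_on[OF A(1)])
  then show ?case using 0 A(2) by (auto intro: continuous_on_compose2)
next
  case (Suc k)
  obtain D where D: "\<And>x. x \<in> S \<Longrightarrow> (f has_derivative D x) (at x)" "\<And>v. Ck_on k S (\<lambda>x. D x v)"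
    by (rule Ck_on_SucD_open[OF S Suc.prems]) blast
  have "((\<lambda>x. f (A x)) has_derivative (\<lambda>v. D (A x) (A v))) (at x)" if "x \<in> S" for x
    by (rule has_derivative_compose[OF bounded_linear_imp_has_derivative[OF A(1)] D(1)[OF A(2)[OF that]]])
  from Ck_on_Suc_open[OF S this, of k] show ?case
    using Suc.IH[OF D(2)] by blast
qed

lemma smooth_on_derivative:
  assumes S: "open S" and f: "smooth_on S f"
  obtains D where "\<And>x. x \<in> S \<Longrightarrow> (f has_derivative D x) (at x)" "\<And>v. smooth_on S (\<lambda>x. D x v)"
proof -
  have f: "Ck_on (Suc k) S f" for k using f by (simp only: smooth_on_def)
  obtain D where D: "\<And>x. x \<in> S \<Longrightarrow> (f has_derivative D x) (at x)"
    by (rule Ck_on_SucD_open[OF S f]) blast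
  have "smooth_on S (\<lambda>x. D x v)" for v
    using f Ck_on_Suc_open[OF S D] unfolding smooth_on_def by blast
  then show ?thesis using that D by blast
qed

text \<open>The coordinate ring of GL(2): polynomials in the entries and the inverse determinant. It
  contains the entries of the inverse matrix and is closed under derivatives.\<close>

inductive_set regular_functions :: "(real^2^2 \<Rightarrow> real) set" where
  const: "(\<lambda>g. c) \<in> regular_functions"
| entry: "(\<lambda>g. g $ i $ j) \<in> regular_functions"
| inverse_det: "(\<lambda>g. inverse (g $ 1 $ 1 * g $ 2 $ 2 - g $ 1 $ 2 * g $ 2 $ 1)) \<in> regular_functions"
| add: "\<phi> \<in> regular_functions \<Longrightarrow> \<psi> \<in> regular_functions \<Longrightarrow> (\<lambda>g. \<phi> g + \<psi> g) \<in> regular_functions"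
| mult: "\<phi> \<in> regular_functions \<Longrightarrow> \<psi> \<in> regular_functions \<Longrightarrow> (\<lambda>g. \<phi> g * \<psi> g) \<in> regular_functions"

lemma has_derivative_entry: "((\<lambda>g::real^2^2. g $ i $ j) has_derivative (\<lambda>X. X $ i $ j)) F"
  by (intro bounded_linear_imp_has_derivative bounded_linear_compose[OF bounded_linear_vec_nth bounded_linear_vec_nth])

lemma regular_functions_derivative:
  assumes "\<phi> \<in> regular_functions"
  shows "\<exists>\<Phi>. (\<forall>X. \<Phi> X \<in> regular_functions) \<and> (\<forall>g\<in>GL2. (\<phi> has_derivative (\<lambda>X. \<Phi> X g)) (at g))"
  using assms
proof induction
  case (const c)
  show ?case
    by (rule exI[of _ "\<lambda>X g. 0"]) (auto intro: regular_functions.const)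
next
  case (entry i j)
  show ?case
    by (rule exI[of _ "\<lambda>X g. X $ i $ j"]) (auto intro: regular_functions.const has_derivative_entry)
next
  case inverse_det
  let ?d = "\<lambda>g::real^2^2. g $ 1 $ 1 * g $ 2 $ 2 - g $ 1 $ 2 * g $ 2 $ 1"
  \<comment> \<open>Differences are written with \<open>- 1 *\<close>, since the class has
    introduction rules for sums and products only.\<close>
  let ?\<Phi> = "\<lambda>X g. - 1 * ((inverse (?d g) * inverse (?d g)) *
    ((g $ 1 $ 1 * X $ 2 $ 2 + X $ 1 $ 1 * g $ 2 $ 2) + - 1 * (g $ 1 $ 2 * X $ 2 $ 1 + X $ 1 $ 2 * g $ 2 $ 1)))"
  have "((\<lambda>g. inverse (?d g)) has_derivative (\<lambda>X. ?\<Phi> X g)) (at g)" if "g \<in> GL2" for g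
  proof -
    have "(?d has_derivative (\<lambda>X. (g $ 1 $ 1 * X $ 2 $ 2 + X $ 1 $ 1 * g $ 2 $ 2)
        - (g $ 1 $ 2 * X $ 2 $ 1 + X $ 1 $ 2 * g $ 2 $ 1))) (at g)"
      by (intro has_derivative_diff has_derivative_mult has_derivative_entry)
    from Deriv.has_derivative_inverse[OF _ this] that show ?thesis
      by (simp add: GL2_iff algebra_simps)
  qed
  moreover have "?\<Phi> X \<in> regular_functions" for X
    by (intro regular_functions.intros)
  ultimately show ?case by (intro exI[of _ ?\<Phi>]) blast
next
  case (add \<phi> \<psi>)
  then obtain \<Phi> \<Psi> where "\<forall>X. \<Phi> X \<in> regular_functions" "\<forall>g\<in>GL2. (\<phi> has_derivative (\<lambda>X. \<Phi> X g)) (at g)"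
    "\<forall>X. \<Psi> X \<in> regular_functions" "\<forall>g\<in>GL2. (\<psi> has_derivative (\<lambda>X. \<Psi> X g)) (at g)"
    by blast
  then show ?case
    by (intro exI[of _ "\<lambda>X g. \<Phi> X g + \<Psi> X g"]) (auto intro: regular_functions.add has_derivative_add)
next
  case (mult \<phi> \<psi>)
  then obtain \<Phi> \<Psi> where "\<forall>X. \<Phi> X \<in> regular_functions" "\<forall>g\<in>GL2. (\<phi> has_derivative (\<lambda>X. \<Phi> X g)) (at g)"
    "\<forall>X. \<Psi> X \<in> regular_functions" "\<forall>g\<in>GL2. (\<psi> has_derivative (\<lambda>X. \<Psi> X g)) (at g)"
    by blast
  with mult.hyps show ?case
    by (intro exI[of _ "\<lambda>X g. \<phi> g * \<Psi> X g + \<Phi> X g * \<psi> g"])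
      (auto intro!: regular_functions.add regular_functions.mult has_derivative_mult)
qed

text \<open>Both \<open>\<phi>\<close> and \<open>F\<close> are generalised in the induction, as the
  product rule differentiates either of them.\<close>

lemma Ck_on_regular_function_scaleR:
  assumes "\<phi> \<in> regular_functions" "smooth_on GL2 F"
  shows "Ck_on k GL2 (\<lambda>g. \<phi> g *\<^sub>R F g)"
  using assms
proof (induction k arbitrary: \<phi> F)
  case (0 \<phi> F)
  obtain \<Phi> where "\<forall>g\<in>GL2. (\<phi> has_derivative (\<lambda>X. \<Phi> X g)) (at g)"
    using regular_functions_derivative[OF 0(1)] by blast
  then have "continuous_on GL2 \<phi>"
    by (auto intro: continuous_at_imp_continuous_on has_derivative_continuous)
  moreover have "Ck_on 0 GL2 F" using 0(2) by (simp only: smooth_on_def)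
  ultimately show ?case by (auto intro: continuous_intros)
next
  case (Suc k)
  obtain \<Phi> where \<Phi>: "\<And>X. \<Phi> X \<in> regular_functions" "\<And>g. g \<in> GL2 \<Longrightarrow> (\<phi> has_derivative (\<lambda>X. \<Phi> X g)) (at g)"
    using regular_functions_derivative[OF Suc.prems(1)] by blast
  obtain D where D: "\<And>g. g \<in> GL2 \<Longrightarrow> (F has_derivative D g) (at g)" "\<And>X. smooth_on GL2 (\<lambda>g. D g X)"
    by (rule smooth_on_derivative[OF open_GL2 Suc.prems(2)]) blast
  have "((\<lambda>g. \<phi> g *\<^sub>R F g) has_derivative (\<lambda>X. \<phi> g *\<^sub>R D g X + \<Phi> X g *\<^sub>R F g)) (at g)" if "g \<in> GL2" for g
    by (intro has_derivative_scaleR \<Phi> D that)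
  from Ck_on_Suc_open[OF open_GL2 this, of k] show ?case
    using Suc.IH[OF Suc.prems(1) D(2)] Suc.IH[OF \<Phi>(1) Suc.prems(2)] Ck_on_add[OF open_GL2] by blast
qed

text \<open>Cramer's formula, arranged so that its entries are regular functions by the introduction
  rules alone.\<close>

definition inverse2 :: "real^2^2 \<Rightarrow> real^2^2" where
  "inverse2 g = (let \<delta> = inverse (g $ 1 $ 1 * g $ 2 $ 2 - g $ 1 $ 2 * g $ 2 $ 1) in
    mat2 (\<delta> * g $ 2 $ 2) (- 1 * (\<delta> * g $ 1 $ 2)) (- 1 * (\<delta> * g $ 2 $ 1)) (\<delta> * g $ 1 $ 1))"

lemma inverse2:
  assumes "g \<in> GL2" shows "g ** inverse2 g = mat 1" "inverse2 g ** g = mat 1" "inverse2 g \<in> GL2"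
proof -
  define \<Delta> where "\<Delta> = g $ 1 $ 1 * g $ 2 $ 2 - g $ 1 $ 2 * g $ 2 $ 1"
  have \<Delta>: "\<Delta> \<noteq> 0" using assms by (simp add: GL2_iff \<Delta>_def)
  have inv: "inverse2 g = mat2 (inverse \<Delta> * g $ 2 $ 2) (- (inverse \<Delta> * g $ 1 $ 2)) (- (inverse \<Delta> * g $ 2 $ 1)) (inverse \<Delta> * g $ 1 $ 1)"
    by (simp add: inverse2_def Let_def \<Delta>_def)
  have \<Delta>': "inverse \<Delta> * (g $ 1 $ 1 * g $ 2 $ 2 - g $ 1 $ 2 * g $ 2 $ 1) = 1"
    using \<Delta> by (simp add: \<Delta>_def)
  show "g ** inverse2 g = mat 1"
    unfolding inv by (rule mat2_eqI) (use \<Delta>' in \<open>simp_all add: matrix_matrix_mult_def sum_2 mat_def algebra_simps\<close>)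
  moreover show "inverse2 g ** g = mat 1"
    unfolding inv by (rule mat2_eqI) (use \<Delta>' in \<open>simp_all add: matrix_matrix_mult_def sum_2 mat_def algebra_simps\<close>)
  ultimately show "inverse2 g \<in> GL2" by (auto simp: GL2_def invertible_def)
qed

lemma regular_functions_inverse2:
  "(\<lambda>g. (inverse2 g ** X) $ i $ j) \<in> regular_functions"
proof -
  have "(\<lambda>g. (inverse2 g ** X) $ i $ j) = (\<lambda>g. inverse2 g $ i $ 1 * X $ 1 $ j + inverse2 g $ i $ 2 * X $ 2 $ j)"
    by (simp add: matrix_matrix_mult_def sum_2)
  moreover have "(\<lambda>g. inverse2 g $ i $ k) \<in> regular_functions" for k
  proof -
    have "\<forall>i k. (\<lambda>g. inverse2 g $ i $ k) \<in> regular_functions"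
      unfolding forall_2 by (auto simp only: inverse2_def Let_def mat2_nth intro!: regular_functions.intros)
    then show ?thesis by blast
  qed
  ultimately show ?thesis by (auto intro!: regular_functions.intros)
qed

lemma bounded_linear_matrix_mult_left: "bounded_linear (\<lambda>g. (h :: real^2^2) ** (g :: real^2^2))"
  unfolding linear_conv_bounded_linear[symmetric]
  by (rule linearI) (simp_all add: matrix_add_ldistrib matrix_scalar_ac scalar_matrix_assoc)

lemma bounded_linear_matrix_mult_right: "bounded_linear (\<lambda>g. (g :: real^2^2) ** (h :: real^2^2))"
  unfolding linear_conv_bounded_linear[symmetric]
  by (rule linearI; rule mat2_eqI) (simp_all add: matrix_matrix_mult_def sum_2 algebra_simps)

lemma linear_mat2_expansion:
  fixes Z :: "real^2^2"
  assumes "linear D"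
  shows "D Z = Z $ 1 $ 1 *\<^sub>R D (mat2 1 0 0 0) + Z $ 1 $ 2 *\<^sub>R D (mat2 0 1 0 0)
    + Z $ 2 $ 1 *\<^sub>R D (mat2 0 0 1 0) + Z $ 2 $ 2 *\<^sub>R D (mat2 0 0 0 1)"
proof -
  have "Z = Z $ 1 $ 1 *\<^sub>R mat2 1 0 0 0 + Z $ 1 $ 2 *\<^sub>R mat2 0 1 0 0
    + Z $ 2 $ 1 *\<^sub>R mat2 0 0 1 0 + Z $ 2 $ 2 *\<^sub>R mat2 0 0 0 1"
    by (rule mat2_eqI) simp_all
  then have "D Z = D (Z $ 1 $ 1 *\<^sub>R mat2 1 0 0 0 + Z $ 1 $ 2 *\<^sub>R mat2 0 1 0 0
    + Z $ 2 $ 1 *\<^sub>R mat2 0 0 1 0 + Z $ 2 $ 2 *\<^sub>R mat2 0 0 0 1)" by simp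
  then show ?thesis
    by (simp only: linear_add[OF assms] linear_scale[OF assms])
qed

section \<open>Vectors of the space K are smooth\<close>

context kirillov
begin

lemma R_linear: "g \<in> GL2 \<Longrightarrow> linear (R g)"
  using R_bounded_linear bounded_linear.linear by blast

text \<open>The derivative must take values in \<open>KV\<close> because the next operator family is
  known to be strongly continuous at 0 only on vectors of \<open>KV\<close>.\<close>

definition KV_differentiable :: "(real^2^2 \<Rightarrow> l2) \<Rightarrow> bool" where
  "KV_differentiable F \<longleftrightarrow> F (mat 1) \<in> KV \<and>
     (\<exists>F'. (F has_derivative F') (at (mat 1)) \<and> (\<forall>h. F' h \<in> KV))"

lemma KV_differentiable_step:
  assumes T: "\<And>t. linear (T t)" "\<And>t u. \<bar>t\<bar> \<le> 1 \<Longrightarrow> norm (T t u) \<le> C * norm u" "\<And>u. T 0 u = u"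
    and T_deriv: "\<And>u. u \<in> KV \<Longrightarrow> \<exists>D\<in>KV. ((\<lambda>t. T t u) has_vector_derivative D) (at 0)"
    and p: "p differentiable (at (mat 1 :: real^2^2))" "p (mat 1) = 0"
    and F: "KV_differentiable F"
  shows "KV_differentiable (\<lambda>g. T (p g) (F g))"
proof -
  obtain F' where F1: "F (mat 1) \<in> KV"
    and F': "(F has_derivative F') (at (mat 1))" "\<And>h. F' h \<in> KV"
    using F unfolding KV_differentiable_def by blast
  obtain p' where p': "(p has_derivative p') (at (mat 1))" using p(1) by (auto simp: differentiable_def)
  obtain D where D: "D \<in> KV" "((\<lambda>t. T t (F (mat 1))) has_vector_derivative D) (at 0)"
    using T_deriv[OF F1] by blast
  have "isCont (\<lambda>t. T t (F' h)) 0" for h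
    using T_deriv[OF F'(2)[of h]] by (auto intro: has_vector_derivative_continuous)
  then have "((\<lambda>g. T (p g) (F g)) has_derivative (\<lambda>h. p' h *\<^sub>R D + F' h)) (at (mat 1))"
    using T D(2) by (intro has_derivative_operator_family[OF _ _ p' p(2) F'(1)]) auto
  moreover have "p' h *\<^sub>R D + F' h \<in> KV" for h
    by (intro KV_add KV_scaleR D F')
  ultimately show ?thesis
    using F1 unfolding KV_differentiable_def p(2) T(3) by blast
qed

lemma KV_derivative_one:
  assumes v: "v \<in> KV"
  shows "\<exists>D. ((\<lambda>g. R g v) has_derivative D) (at (mat 1)) \<and> (\<forall>X. D X \<in> KV)"
proof -
  let ?det = "\<lambda>g::real^2^2. g $ 1 $ 1 * g $ 2 $ 2 - g $ 1 $ 2 * g $ 2 $ 1"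
  \<comment> \<open>Gauss coordinates: \<open>g\<close> is \<open>upper y\<close> times
    \<open>diag (det / g22^2)\<close> times \<open>scalar g22\<close> times the lower unipotent with
    entry \<open>c\<close>. The logarithms make all four parameters vanish at 1.\<close>
  let ?y = "\<lambda>g::real^2^2. g $ 1 $ 2 / g $ 2 $ 2" and ?c = "\<lambda>g::real^2^2. g $ 2 $ 1 / g $ 2 $ 2"
  let ?a = "\<lambda>g::real^2^2. ln (?det g / (g $ 2 $ 2 * g $ 2 $ 2))" and ?b = "\<lambda>g::real^2^2. ln (g $ 2 $ 2)"
  have one: "(mat 1 :: real^2^2) $ 1 $ 1 = 1" "(mat 1 :: real^2^2) $ 1 $ 2 = 0"
    "(mat 1 :: real^2^2) $ 2 $ 1 = 0" "(mat 1 :: real^2^2) $ 2 $ 2 = 1"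
    by (simp_all add: mat_def)
  have entry: "(\<lambda>g::real^2^2. g $ i $ j) differentiable (at (mat 1))" for i j
    using has_derivative_entry by (auto simp: differentiable_def)
  have ln: "(\<lambda>g. ln (q g)) differentiable (at (mat 1))"
    if "q differentiable (at (mat 1))" "q (mat 1) > 0" for q :: "real^2^2 \<Rightarrow> real"
    using that has_derivative_ln unfolding differentiable_def by blast
  have det: "?det differentiable (at (mat 1))"
    by (intro differentiable_diff differentiable_mult entry)
  have p: "?y differentiable (at (mat 1))" "?c differentiable (at (mat 1))"
    "?a differentiable (at (mat 1))" "?b differentiable (at (mat 1))"
    by (intro ln differentiable_divide differentiable_mult det entry; simp add: one)+
  have p0: "?y (mat 1) = 0" "?c (mat 1) = 0" "?a (mat 1) = 0" "?b (mat 1) = 0"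
    by (simp_all add: one)
  \<comment> \<open>The factors are adjoined from the right. The lower unipotent comes first and
    acts on the fixed vector \<open>v\<close>, so the chain rule suffices for it; the other three
    families have explicit norm bounds.\<close>
  let ?F1 = "\<lambda>g. R (mat2 1 0 (?c g) 1) v"
  let ?F2 = "\<lambda>g. R (scalar (exp (?b g))) (?F1 g)"
  let ?F3 = "\<lambda>g. R (diag (exp (?a g))) (?F2 g)"
  let ?F4 = "\<lambda>g. R (upper (?y g)) (?F3 g)"
  have id: "mat2 1 0 0 1 = mat 1" by (simp add: mat_1_eq_mat2)
  have F1: "KV_differentiable ?F1"
    unfolding KV_differentiable_def
  proof
    show "?F1 (mat 1) \<in> KV" using v by (simp add: p0 id)
    obtain D where D: "D \<in> KV" "((\<lambda>c. R (mat2 1 0 c 1) v) has_vector_derivative D) (at 0)"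
      using KV_lower_derivative[OF v] by blast
    obtain p' where p': "(?c has_derivative p') (at (mat 1))"
      using p(2) by (auto simp: differentiable_def)
    have "(?F1 has_derivative (\<lambda>h. p' h *\<^sub>R D)) (at (mat 1))"
      using has_derivative_compose[OF p', of "\<lambda>c. R (mat2 1 0 c 1) v" "\<lambda>t. t *\<^sub>R D"] D(2)
      by (simp add: has_vector_derivative_def p0)
    then show "\<exists>F'. (?F1 has_derivative F') (at (mat 1)) \<and> (\<forall>h. F' h \<in> KV)"
      using KV_scaleR[OF D(1)] by blast
  qed
  have exp_bound: "exp (r * t) \<le> exp \<bar>r\<bar>" if "\<bar>t\<bar> \<le> 1" for r t :: real
    using mult_left_mono[OF that, of "\<bar>r\<bar>"] abs_ge_self[of "r * t"] by (simp add: abs_mult)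
  have F2: "KV_differentiable ?F2"
  proof (rule KV_differentiable_step[OF _ _ _ KV_scalar_derivative p(4) p0(4) F1])
    show "norm (R (scalar (exp t)) u) \<le> exp \<bar>Re (2 * \<sigma>)\<bar> * norm u" if "\<bar>t\<bar> \<le> 1" for t u
      using exp_bound[OF that, of "Re (2 * \<sigma>)"] by (simp add: R_scalar_exp norm_scaleC_l2 mult_right_mono)
  qed (simp_all add: R_linear id)
  have F3: "KV_differentiable ?F3"
  proof (rule KV_differentiable_step[OF _ _ _ KV_diag_derivative p(3) p0(3) F2])
    show "norm (R (diag (exp t)) u) \<le> exp \<bar>Re \<sigma>\<bar> * norm u" if "\<bar>t\<bar> \<le> 1" for t u
      using exp_bound[OF that, of "Re \<sigma>"] by (simp add: norm_R_diag_exp mult_right_mono)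
  qed (simp_all add: R_linear id)
  have F4: "KV_differentiable ?F4"
  proof (rule KV_differentiable_step[OF _ _ _ KV_upper_derivative p(1) p0(1) F3])
    show "norm (R (upper t) u) \<le> 1 * norm u" for t u by (simp add: norm_R_upper)
  qed (simp_all add: R_linear id)
  define U where "U = {g. 0 < g $ 2 $ 2 \<and> 0 < ?det g}"
  have "open U"
    unfolding U_def by (intro open_Collect_conj open_Collect_less continuous_intros)
  have "mat 1 \<in> U" by (simp add: U_def one)
  have F4_eq: "?F4 g = R g v" if "g \<in> U" for g
  proof -
    let ?A = "?det g / (g $ 2 $ 2 * g $ 2 $ 2)"
    have pos: "0 < g $ 2 $ 2" "0 < ?det g" using that by (auto simp: U_def)
    have "g = upper (?y g) ** (diag ?A ** (scalar (g $ 2 $ 2) ** mat2 1 0 (?c g) 1))"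
      unfolding mat2_mult using pos by (intro mat2_eqI) (auto simp: field_simps)
    then have "R g v = R (upper (?y g) ** (diag ?A ** (scalar (g $ 2 $ 2) ** mat2 1 0 (?c g) 1))) v"
      by simp
    also have "\<dots> = R (upper (?y g)) (R (diag ?A) (R (scalar (g $ 2 $ 2)) (?F1 g)))"
      using pos by (simp add: R_mult GL2_mult)
    finally show ?thesis using pos by simp
  qed
  obtain D where D: "(?F4 has_derivative D) (at (mat 1))" "\<forall>h. D h \<in> KV"
    using F4 unfolding KV_differentiable_def by blast
  have "((\<lambda>g. R g v) has_derivative D) (at (mat 1))"
    by (rule has_derivative_transform_within_open[OF D(1) \<open>open U\<close> \<open>mat 1 \<in> U\<close> F4_eq])
  then show ?thesis using D(2) by blast
qed

text \<open>Left translation: near \<open>g\<close> the orbit map is \<open>R g\<close> applied to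
  the orbit map at \<open>inverse2 g ** h\<close>, and \<open>R g\<close> is bounded.\<close>

lemma R_derivative:
  assumes D: "((\<lambda>h. R h v) has_derivative D) (at (mat 1))" and g: "g \<in> GL2"
  shows "((\<lambda>h. R h v) has_derivative (\<lambda>X. R g (D (inverse2 g ** X)))) (at g)"
proof -
  have "((\<lambda>h. inverse2 g ** h) has_derivative (\<lambda>X. inverse2 g ** X)) (at g)"
    by (intro bounded_linear_imp_has_derivative bounded_linear_matrix_mult_left)
  from has_derivative_compose[OF this, of "\<lambda>h. R h v" D] D inverse2(2)[OF g]
  have "((\<lambda>h. R (inverse2 g ** h) v) has_derivative (\<lambda>X. D (inverse2 g ** X))) (at g)"
    by simp
  from bounded_linear.has_derivative[OF R_bounded_linear[OF g] this]
  have "((\<lambda>h. R g (R (inverse2 g ** h) v)) has_derivative (\<lambda>X. R g (D (inverse2 g ** X)))) (at g)" .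
  then show ?thesis
  proof (rule has_derivative_transform_within_open[OF _ open_GL2 g])
    fix h assume h: "h \<in> GL2"
    have "g ** (inverse2 g ** h) = h"
      by (simp add: matrix_mul_assoc inverse2[OF g])
    then show "R g (R (inverse2 g ** h) v) = R h v"
      using R_mult[OF g GL2_mult[OF inverse2(3)[OF g] h], of v] by simp
  qed
qed

text \<open>The factor \<open>\<phi>\<close> makes the statement reproduce itself: a derivative is a
  combination of terms of the same form with new \<open>\<phi>\<close> and new vectors in
  \<open>KV\<close>.\<close>

lemma Ck_on_regular_function_KV:
  assumes "\<phi> \<in> regular_functions" "v \<in> KV"
  shows "Ck_on k GL2 (\<lambda>g. \<phi> g *\<^sub>R R g v)"
  using assms
proof (induction k arbitrary: \<phi> v)
  case (0 \<phi> v)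
  obtain \<Phi> where "\<forall>g\<in>GL2. (\<phi> has_derivative (\<lambda>X. \<Phi> X g)) (at g)"
    using regular_functions_derivative[OF 0(1)] by blast
  then have "continuous_on GL2 \<phi>"
    by (auto intro: continuous_at_imp_continuous_on has_derivative_continuous)
  moreover obtain D where "((\<lambda>g. R g v) has_derivative D) (at (mat 1))"
    using KV_derivative_one[OF 0(2)] by blast
  then have "continuous_on GL2 (\<lambda>g. R g v)"
    by (auto intro: continuous_at_imp_continuous_on has_derivative_continuous R_derivative)
  ultimately show ?case by (auto intro: continuous_intros)
next
  case (Suc k)
  obtain \<Phi> where \<Phi>: "\<And>X. \<Phi> X \<in> regular_functions" "\<And>g. g \<in> GL2 \<Longrightarrow> (\<phi> has_derivative (\<lambda>X. \<Phi> X g)) (at g)"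
    using regular_functions_derivative[OF Suc.prems(1)] by blast
  obtain D where D: "((\<lambda>g. R g v) has_derivative D) (at (mat 1))" "\<And>X. D X \<in> KV"
    using KV_derivative_one[OF Suc.prems(2)] by blast
  have D_lin: "linear D" using D(1) by (rule has_derivative_linear)
  have deriv: "((\<lambda>g. \<phi> g *\<^sub>R R g v) has_derivative
      (\<lambda>X. \<phi> g *\<^sub>R R g (D (inverse2 g ** X)) + \<Phi> X g *\<^sub>R R g v)) (at g)" if "g \<in> GL2" for g
    by (intro has_derivative_scaleR \<Phi> R_derivative D that)
  have "Ck_on k GL2 (\<lambda>g. \<phi> g *\<^sub>R R g (D (inverse2 g ** X)) + \<Phi> X g *\<^sub>R R g v)" for X
  proof -
    \<comment> \<open>Expanding the argument of \<open>D\<close> in matrix units moves the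
      dependence on \<open>g\<close> into regular coefficients and leaves the fixed vectors
      \<open>D E\<close>.\<close>
    let ?t = "\<lambda>i j E g. (\<phi> g * (inverse2 g ** X) $ i $ j) *\<^sub>R R g (D E)"
    have t: "Ck_on k GL2 (?t i j E)" for i j E
      by (intro Suc.IH regular_functions.mult Suc.prems regular_functions_inverse2 D)
    have "Ck_on k GL2 (\<lambda>g. ?t 1 1 (mat2 1 0 0 0) g + ?t 1 2 (mat2 0 1 0 0) g
        + ?t 2 1 (mat2 0 0 1 0) g + ?t 2 2 (mat2 0 0 0 1) g + \<Phi> X g *\<^sub>R R g v)"
      by (intro Ck_on_add open_GL2 t Suc.IH \<Phi> Suc.prems)
    also have "?this \<longleftrightarrow> Ck_on k GL2 (\<lambda>g. \<phi> g *\<^sub>R R g (D (inverse2 g ** X)) + \<Phi> X g *\<^sub>R R g v)"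
    proof (rule Ck_on_cong)
      fix g assume "g \<in> GL2"
      then have lin: "linear (R g)" by (rule R_linear)
      show "?t 1 1 (mat2 1 0 0 0) g + ?t 1 2 (mat2 0 1 0 0) g
        + ?t 2 1 (mat2 0 0 1 0) g + ?t 2 2 (mat2 0 0 0 1) g + \<Phi> X g *\<^sub>R R g v
        = \<phi> g *\<^sub>R R g (D (inverse2 g ** X)) + \<Phi> X g *\<^sub>R R g v"
        unfolding linear_mat2_expansion[OF D_lin, of "inverse2 g ** X"]
        by (simp add: linear_add[OF lin] linear_scale[OF lin] scaleR_add_right)
    qed
    finally show ?thesis .
  qed
  with Ck_on_Suc_open[OF open_GL2 deriv, of k] show ?case by blast
qed

lemma KV_smooth: "KV \<subseteq> smooth_vectors R"
proof
  fix v assume "v \<in> KV"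
  from Ck_on_regular_function_KV[OF regular_functions.const this, of _ 1]
  show "v \<in> smooth_vectors R"
    by (simp add: smooth_vectors_def smooth_on_def)
qed

end

section \<open>Continuous versions, cutoffs flat at 0, and pairings with intervals\<close>

lemma continuous_on_punctured:
  fixes a b :: "real \<Rightarrow> complex"
  assumes a: "continuous_on {0<..} a" and b: "continuous_on {0<..} b"
  shows "continuous_on (- {0}) (\<lambda>x. if x > 0 then a x else b (- x))"
proof -
  have "continuous_on {..<0} (\<lambda>x. b (- x))"
    by (rule continuous_on_compose2[OF b]) (auto intro!: continuous_intros)
  then have "continuous_on {..<0} (\<lambda>x. if x > 0 then a x else b (- x))"
    by (rule continuous_on_eq) auto
  moreover have "continuous_on {0<..} (\<lambda>x. if x > 0 then a x else b (- x))"
    by (rule continuous_on_eq[OF a]) auto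
  ultimately have "continuous_on ({..<0} \<union> {0<..}) (\<lambda>x. if x > 0 then a x else b (- x))"
    by (intro continuous_on_open_Un) auto
  moreover have "{..<0} \<union> {0<..} = - {0 :: real}" by auto
  ultimately show ?thesis by simp
qed

text \<open>The set where the two functions differ is open and negligible, hence empty.\<close>

lemma continuous_AE_eq:
  fixes f g :: "real \<Rightarrow> complex"
  assumes S: "open S" and cont: "continuous_on S f" "continuous_on S g"
    and AE: "AE x in lborel. x \<in> S \<longrightarrow> f x = g x" and x: "x \<in> S"
  shows "f x = g x"
proof -
  let ?T = "S \<inter> (\<lambda>x. f x - g x) -` (- {0})"
  have "open ?T"
    by (intro continuous_open_preimage continuous_intros cont S open_Compl closed_singleton)
  obtain N where N: "{x \<in> space lborel. \<not> (x \<in> S \<longrightarrow> f x = g x)} \<subseteq> N" "emeasure lborel N = 0" "N \<in> sets lborel"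
    by (rule AE_E[OF AE]) blast
  then have "N \<in> null_sets lborel" by blast
  then have "negligible N"
    unfolding negligible_iff_null_sets by (rule null_sets_completionI)
  moreover have "?T \<subseteq> N" using N(1) by auto
  ultimately have "negligible ?T" by (rule negligible_subset)
  then have "?T = {}" using open_not_negligible[OF \<open>open ?T\<close>] by blast
  then show ?thesis using x by auto
qed

lemma rapid_top_of_bound:
  assumes "\<And>N. \<exists>C. \<forall>x>0. x ^ N * norm (f x) \<le> C" shows "rapid_top f"
proof -
  have "rapid_half (\<lambda>x. if x > 0 then f x else 0)"
    unfolding rapid_half_def
  proof
    fix N
    obtain C where "\<And>x. x > 0 \<Longrightarrow> x ^ N * norm (f x) \<le> C" using assms by blast
    then show "\<exists>C. \<forall>x\<ge>0. x ^ N * norm (if x > 0 then f x else 0) \<le> C"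
      by (intro exI[of _ "max C 0"]) (auto simp: le_max_iff_disj)
  qed
  then have "rapid_top (\<lambda>x. if x > 0 then f x else 0)" by (rule rapid_half_imp_top)
  then show ?thesis by (rule rapid_top_cong[THEN iffD1, rotated]) simp
qed

lemma exp_cutoff_bound:
  fixes \<delta> :: real
  assumes "\<delta> > 0"
  shows "\<exists>C\<ge>0. \<forall>x>0. (1 / sqrt x) ^ n * exp (- \<delta> / x) \<le> C * x\<^sup>2"
proof -
  have *: "t ^ m * exp (- \<delta> * t) \<le> fact m / \<delta> ^ m" if "t > 0" for t :: real and m
  proof -
    have "(\<delta> * t) ^ m / fact m \<le> exp (\<delta> * t)"
    proof -
      have "(\<Sum>k\<in>{m}. (\<delta> * t) ^ k /\<^sub>R fact k) \<le> (\<Sum>k. (\<delta> * t) ^ k /\<^sub>R fact k)"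
        using assms that by (intro sum_le_suminf summable_exp_generic) auto
      then show ?thesis by (simp add: exp_def divide_inverse mult.commute)
    qed
    then have "(\<delta> * t) ^ m \<le> fact m * exp (\<delta> * t)" by (simp add: divide_le_eq mult.commute)
    then have "t ^ m * \<delta> ^ m \<le> fact m * exp (\<delta> * t)" by (simp add: power_mult_distrib mult.commute)
    then show ?thesis using assms by (simp add: exp_minus field_simps)
  qed
  show ?thesis
  \<comment> \<open>In terms of \<open>t = 1 / x\<close> the factor \<open>x^2\<close> costs
    \<open>t^2\<close>, and \<open>sqrt t ^ n <= 1 + t ^ n\<close> leaves the powers 2 and
    \<open>n + 2\<close>. Each is bounded by \<open>fact m / \<delta>^m\<close>, from a single term
    of the exponential series.\<close>
  proof (intro exI[of _ "fact 2 / \<delta> ^ 2 + fact (n + 2) / \<delta> ^ (n + 2)"] conjI allI impI)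
    fix x :: real assume x: "x > 0"
    define t where "t = 1 / x"
    have t: "t > 0" "x = 1 / t" using x by (auto simp: t_def)
    have "sqrt t ^ n \<le> 1 + t ^ n" by (rule sqrt_power_le[OF t(1)])
    then have "t\<^sup>2 * (sqrt t ^ n * exp (- \<delta> * t)) \<le> t\<^sup>2 * ((1 + t ^ n) * exp (- \<delta> * t))"
      by (intro mult_left_mono mult_right_mono) auto
    also have "\<dots> = t ^ 2 * exp (- \<delta> * t) + t ^ (n + 2) * exp (- \<delta> * t)"
      by (simp add: algebra_simps power_add power2_eq_square)
    also have "\<dots> \<le> fact 2 / \<delta> ^ 2 + fact (n + 2) / \<delta> ^ (n + 2)"
      by (intro add_mono * t)
    finally have "sqrt t ^ n * exp (- \<delta> * t) \<le> (fact 2 / \<delta> ^ 2 + fact (n + 2) / \<delta> ^ (n + 2)) / t\<^sup>2"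
      using t by (simp add: pos_le_divide_eq mult.commute)
    moreover have "1 / sqrt x = sqrt t" "- \<delta> / x = - \<delta> * t"
      by (simp_all add: t_def real_sqrt_divide)
    ultimately show "(1 / sqrt x) ^ n * exp (- \<delta> / x) \<le> (fact 2 / \<delta> ^ 2 + fact (n + 2) / \<delta> ^ (n + 2)) * x\<^sup>2"
      by (simp add: t_def power_divide)
  qed (use assms in auto)
qed

text \<open>Nothing is assumed at 0 beyond boundedness: the factor \<open>exp (- \<delta> / x)\<close> is flat there.\<close>

lemma half_schwartz_cutoff:
  assumes deriv: "\<And>k. k \<in> W \<Longrightarrow> \<exists>k1\<in>W. \<forall>x>0. (k has_vector_derivative (k1 x - \<sigma> * k x) / of_real x) (at x)"
    and bound: "\<And>k N. k \<in> W \<Longrightarrow> \<exists>C. \<forall>x>0. x ^ N * norm (k x) \<le> C"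
    and \<delta>: "\<delta> > 0" and k: "k \<in> W"
  shows "half_schwartz (\<lambda>x. if x > 0 then of_real ((1 / sqrt x) ^ n * exp (- \<delta> / x)) * k x else 0)"
proof -
  define E where "E c n k x = (if x > 0 then c * of_real ((1 / sqrt x) ^ n * exp (- \<delta> / x)) * k x else 0)"
    for c n and k :: "real \<Rightarrow> complex" and x :: real
  define B where "B = {E c n k |c n k. k \<in> W}"
  have E_bound: "\<exists>C\<ge>0. \<forall>x>0. x ^ N * norm (E c n k x) \<le> C * x\<^sup>2" if k: "k \<in> W" for c n k N
  proof -
    obtain C where C: "C \<ge> 0" "\<And>x. x > 0 \<Longrightarrow> (1 / sqrt x) ^ n * exp (- \<delta> / x) \<le> C * x\<^sup>2"
      using exp_cutoff_bound[OF \<delta>, of n] by blast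
    obtain K where K: "\<And>x. x > 0 \<Longrightarrow> x ^ N * norm (k x) \<le> K" using bound[OF k] by blast
    have "K \<ge> 0" using K[of 1] norm_ge_zero[of "k 1"] by (simp del: norm_ge_zero)
    moreover have "x ^ N * norm (E c n k x) \<le> (norm c * C * K) * x\<^sup>2" if x: "x > 0" for x
    proof -
      have "x ^ N * norm (E c n k x) = norm c * (((1 / sqrt x) ^ n * exp (- \<delta> / x)) * (x ^ N * norm (k x)))"
        using x by (simp add: E_def norm_mult norm_divide norm_power mult_ac)
      also have "\<dots> \<le> norm c * ((C * x\<^sup>2) * K)"
        by (intro mult_left_mono mult_mono[OF C(2)[OF x] K[OF x]]) (use C(1) x in auto)
      finally show ?thesis by (simp add: mult_ac)
    qed
    ultimately show ?thesis using C(1) by (intro exI[of _ "norm c * C * K"]) auto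
  qed
  have E_deriv: "\<exists>E'\<in>sums_of B. \<forall>x\<in>{0..}. (E c n k has_vector_derivative E' x) (at x within {0..})"
    if k: "k \<in> W" for c n k
  proof -
    obtain k1 where k1: "k1 \<in> W" "\<And>x. x > 0 \<Longrightarrow> (k has_vector_derivative (k1 x - \<sigma> * k x) / of_real x) (at x)"
      using deriv[OF k] by blast
    \<comment> \<open>The terms come from the power and the \<open>\<sigma>\<close> part of
      \<open>k'\<close> (a factor \<open>1 / x\<close>, so \<open>n + 2\<close>), from the
      exponential (\<open>\<delta> / x^2\<close>, so \<open>n + 4\<close>), and from
      \<open>k1\<close>.\<close>
    let ?E' = "\<lambda>x. (E (c * (- of_real (real n / 2) - \<sigma>)) (n + 2) k x + E (c * of_real \<delta>) (n + 4) k x) + E c (n + 2) k1 x"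
    have "?E' \<in> sums_of B"
      by (intro sums_of.add sums_of.base) (use k k1 in \<open>auto simp: B_def\<close>)
    moreover have "(E c n k has_vector_derivative ?E' x) (at x within {0..})" if "x \<ge> 0" for x
    proof (cases "x > 0")
      case True
      have r2: "(1 / sqrt x) ^ 2 = 1 / x" using True by (simp add: power_divide)
      have r4: "(1 / sqrt x) ^ 4 = 1 / x\<^sup>2"
      proof -
        have "sqrt x ^ 4 = (sqrt x ^ 2) ^ 2" by (simp flip: power_mult)
        then show ?thesis using True by (simp add: power_divide)
      qed
      have "((\<lambda>x. exp (- \<delta> / x)) has_real_derivative \<delta> * (1 / sqrt x) ^ 4 * exp (- \<delta> / x)) (at x)"
        unfolding r4 using True by (auto intro!: derivative_eq_intros simp: power2_eq_square)
      from DERIV_mult[OF inverse_sqrt_power_has_derivative[OF True, of n] this]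
      have "((\<lambda>x. (1 / sqrt x) ^ n * exp (- \<delta> / x)) has_real_derivative
          (- (real n / 2) * (1 / sqrt x) ^ (n + 2) + \<delta> * (1 / sqrt x) ^ (n + 4)) * exp (- \<delta> / x)) (at x)"
        by (rule DERIV_cong) (simp add: power_add algebra_simps)
      from has_vector_derivative_mult_right[OF has_vector_derivative_mult[OF has_vector_derivative_of_real[OF this] k1(2)[OF True]], of c]
      have "((\<lambda>x. c * (of_real ((1 / sqrt x) ^ n * exp (- \<delta> / x)) * k x)) has_vector_derivative
          c * (of_real ((1 / sqrt x) ^ n * exp (- \<delta> / x)) * ((k1 x - \<sigma> * k x) / of_real x) +
          of_real ((- (real n / 2) * (1 / sqrt x) ^ (n + 2) + \<delta> * (1 / sqrt x) ^ (n + 4)) * exp (- \<delta> / x)) * k x)) (at x)" .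
      moreover have "c * (of_real ((1 / sqrt x) ^ n * exp (- \<delta> / x)) * ((k1 x - \<sigma> * k x) / of_real x) +
          of_real ((- (real n / 2) * (1 / sqrt x) ^ (n + 2) + \<delta> * (1 / sqrt x) ^ (n + 4)) * exp (- \<delta> / x)) * k x) = ?E' x"
      proof -
        define q where "q = complex_of_real ((1 / sqrt x) ^ n)"
        define e where "e = complex_of_real (exp (- \<delta> / x))"
        define z where "z = complex_of_real (1 / x)"
        have q2: "complex_of_real ((1 / sqrt x) ^ (n + 2)) = q * z"
          unfolding power_add r2 by (simp add: q_def z_def)
        have q4: "complex_of_real ((1 / sqrt x) ^ (n + 4)) = q * (z * z)"
          unfolding power_add r4 by (simp add: q_def z_def power2_eq_square)
        have z_div: "a / complex_of_real x = z * a" for a by (simp add: z_def divide_inverse)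
        have if_eq: "(if x > 0 then a else 0) = a" for a :: complex using True by simp
        show ?thesis
          unfolding E_def if_eq of_real_mult of_real_add q2 q4 z_div q_def[symmetric] e_def[symmetric]
          by (simp add: algebra_simps)
      qed
      ultimately have "((\<lambda>x. c * (of_real ((1 / sqrt x) ^ n * exp (- \<delta> / x)) * k x)) has_vector_derivative ?E' x) (at x)"
        by simp
      then have "(E c n k has_vector_derivative ?E' x) (at x)"
        by (rule has_vector_derivative_transform_within_open[where S = "{0<..}"]) (use True in \<open>auto simp: E_def\<close>)
      then show ?thesis by (rule has_vector_derivative_at_within)
    next
      case False
      then have x: "x = 0" using that by simp
      obtain C where C: "C \<ge> 0" "\<And>x. x > 0 \<Longrightarrow> x ^ 0 * norm (E c n k x) \<le> C * x\<^sup>2"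
        using E_bound[OF k, of 0 c n] by blast
      \<comment> \<open>The quadratic bound makes the difference quotient at 0 of size
        \<open>z\<close>, so the derivative there is 0, which is also the value of
        \<open>?E'\<close> at 0.\<close>
      have "((\<lambda>z. (E c n k z - E c n k 0) /\<^sub>R (z - 0)) \<longlongrightarrow> 0) (at 0 within {0..})"
      proof (rule Lim_null_comparison)
        show "\<forall>\<^sub>F z in at 0 within {0..}. norm ((E c n k z - E c n k 0) /\<^sub>R (z - 0)) \<le> C * z"
          unfolding eventually_at_filter
        proof (intro always_eventually allI impI)
          fix z :: real assume "z \<noteq> 0" "z \<in> {0..}"
          then have z: "z > 0" by simp
          then show "norm ((E c n k z - E c n k 0) /\<^sub>R (z - 0)) \<le> C * z"
            using C(2)[OF z] by (simp add: E_def[of c n k 0] field_simps power2_eq_square)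
        qed
        have "((\<lambda>z. C * z) \<longlongrightarrow> C * 0) (at 0 within {0..})" by (intro tendsto_intros)
        then show "((\<lambda>z. C * z) \<longlongrightarrow> 0) (at 0 within {0..})" by simp
      qed
      then have "(E c n k has_vector_derivative 0) (at 0 within {0..})"
        by (simp only: has_vector_derivative_iff_quotient)
      moreover have "?E' 0 = 0" by (simp add: E_def)
      ultimately show ?thesis unfolding x by simp
    qed
    ultimately show ?thesis by (intro bexI[of _ ?E']) auto
  qed
  have "half_schwartz (E 1 n k)"
  proof (rule smooth_with_sums_of[where B = B])
    fix f assume "f \<in> B"
    then obtain c n k where f: "f = E c n k" and k: "k \<in> W" unfolding B_def by blast
    show "rapid_half f"
      unfolding rapid_half_def f
    proof
      fix N
      obtain K where K: "\<And>x. x > 0 \<Longrightarrow> x ^ N * norm (E c n k x) \<le> K * x\<^sup>2" "K \<ge> 0"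
        using E_bound[OF k] by blast
      obtain C where C: "C \<ge> 0" "\<And>x. x > 0 \<Longrightarrow> (1 / sqrt x) ^ n * exp (- \<delta> / x) \<le> C * x\<^sup>2"
        using exp_cutoff_bound[OF \<delta>, of n] by blast
      \<comment> \<open>\<open>E_bound\<close> still contains \<open>x^2\<close>. To bound the
        function for large \<open>x\<close> this factor is absorbed into the decay of
        \<open>k\<close> at exponent \<open>N + 2\<close>.\<close>
      obtain L where L: "\<And>x. x > 0 \<Longrightarrow> x ^ (N + 2) * norm (k x) \<le> L" using bound[OF k] by blast
      have "x ^ N * norm (E c n k x) \<le> max 0 (norm c * C * L)" if "x \<ge> 0" for x
      proof (cases "x > 0")
        case True
        have "x ^ N * norm (E c n k x) = norm c * (((1 / sqrt x) ^ n * exp (- \<delta> / x)) * (x ^ N * norm (k x)))"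
          using True by (simp add: E_def norm_mult norm_divide norm_power mult_ac)
        also have "\<dots> \<le> norm c * ((C * x\<^sup>2) * (x ^ N * norm (k x)))"
          using C(2)[OF True] True by (intro mult_left_mono mult_right_mono) auto
        also have "\<dots> = (norm c * C) * (x ^ (N + 2) * norm (k x))"
          by (simp add: power_add power2_eq_square mult_ac)
        also have "\<dots> \<le> (norm c * C) * L"
          using C(1) L[OF True] by (intro mult_left_mono) auto
        finally show ?thesis by simp
      qed (simp add: E_def)
      then show "\<exists>C. \<forall>x\<ge>0. x ^ N * norm (E c n k x) \<le> C" by blast
    qed
    show "\<exists>f'\<in>sums_of B. \<forall>x\<in>{0..}. (f has_vector_derivative f' x) (at x within {0..})"
      unfolding f by (rule E_deriv[OF k])
  next
    show "E 1 n k \<in> sums_of B" using k by (intro sums_of.base) (auto simp: B_def)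
  qed (rule rapid_half_add)
  then show ?thesis unfolding E_def[abs_def] mult_1 .
qed

lemma hankel_cutoff_limit:
  assumes k: "rapid_open k" and y: "y \<ge> 0"
  shows "(\<lambda>n. hankel m (\<lambda>x. of_real (exp (- (1 / real (Suc n)) / x)) * k x) y) \<longlonglongrightarrow> hankel m k y"
proof -
  define e where "e n x = exp (- (1 / real (Suc n)) / x)" for n and x :: real
  have e: "0 \<le> e n x" "e n x \<le> 1" if "x > 0" for n x
    using that by (auto simp: e_def divide_nonpos_pos simp del: of_nat_Suc)
  have e_lim: "(\<lambda>n. e n x) \<longlonglongrightarrow> 1" if "x > 0" for x
  proof -
    have "(\<lambda>n. e n x) \<longlonglongrightarrow> exp (- 0 / x)"
      unfolding e_def using that LIMSEQ_inverse_real_of_nat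
      by (intro tendsto_intros) (auto simp: inverse_eq_divide)
    then show ?thesis by simp
  qed
  have [measurable]: "e n \<in> borel_measurable borel" for n
    unfolding e_def by measurable
  let ?b = "\<lambda>x. of_real (bes m (x * y)) :: complex" and ?I = "indicator {0<..} :: real \<Rightarrow> real"
  have "(\<lambda>n. hankel m (\<lambda>x. of_real (e n x) * k x) y) \<longlonglongrightarrow> hankel m k y"
    unfolding hankel_def set_lebesgue_integral_def
  proof (rule integral_dominated_convergence)
    show "(\<lambda>x. ?I x *\<^sub>R (?b x * k x)) \<in> borel_measurable lborel"
      using rapid_open_measurable[OF k, of "\<lambda>x. bes m (x * y)"] by simp
    show "(\<lambda>x. ?I x *\<^sub>R (?b x * (of_real (e n x) * k x))) \<in> borel_measurable lborel" for n
      using rapid_open_measurable[OF k, of "\<lambda>x. bes m (x * y) * e n x"] by (simp add: mult.assoc)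
    show "integrable lborel (\<lambda>x. norm (?I x *\<^sub>R k x))"
      using rapid_open_integrable[OF k] unfolding set_integrable_def by (rule integrable_norm)
    show "AE x in lborel. norm (?I x *\<^sub>R (?b x * (of_real (e n x) * k x))) \<le> norm (?I x *\<^sub>R k x)" for n
    proof (intro AE_I2)
      fix x :: real
      have "\<bar>bes m (x * y)\<bar> * (e n x * norm (k x)) \<le> 1 * (1 * norm (k x))" if "x > 0"
        using that y e[OF that, of n] by (intro mult_mono abs_bes_le_1) auto
      then show "norm (?I x *\<^sub>R (?b x * (of_real (e n x) * k x))) \<le> norm (?I x *\<^sub>R k x)"
        using e(1)[of x n] by (cases "x > 0") (auto simp: norm_mult)
    qed
    show "AE x in lborel. (\<lambda>n. ?I x *\<^sub>R (?b x * (of_real (e n x) * k x))) \<longlonglongrightarrow> ?I x *\<^sub>R (?b x * k x)"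
    proof (intro AE_I2)
      fix x :: real
      have "(\<lambda>n. ?I x *\<^sub>R (?b x * (of_real (e n x) * k x))) \<longlonglongrightarrow> ?I x *\<^sub>R (?b x * (of_real 1 * k x))" if "x > 0"
        by (intro tendsto_scaleR tendsto_const tendsto_mult tendsto_of_real e_lim that)
      then show "(\<lambda>n. ?I x *\<^sub>R (?b x * (of_real (e n x) * k x))) \<longlonglongrightarrow> ?I x *\<^sub>R (?b x * k x)"
        by (cases "x > 0") simp_all
    qed
  qed
  then show ?thesis by (simp add: e_def)
qed

lemma square_integrable_indicator:
  assumes "0 < a" shows "square_integrable (\<lambda>x. indicator {a..b} x)"
\<comment> \<open>On \<open>[a, b]\<close> the majorant is at least
  \<open>a / (1 + b^2)\<close>.\<close>
proof (rule square_integrable_majorant[where C = "max 0 ((1 + b\<^sup>2) / a)"])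
  fix x :: real
  show "cmod (indicator {a..b} x) \<le> max 0 ((1 + b\<^sup>2) / a) * (\<bar>x\<bar> / (1 + x\<^sup>2))"
  proof (cases "x \<in> {a..b}")
    case True
    then have "x\<^sup>2 \<le> b\<^sup>2" using assms by (intro power_mono) auto
    then have "a * (1 + x\<^sup>2) \<le> x * (1 + b\<^sup>2)"
      using True assms by (intro mult_mono) auto
    moreover have "1 + x\<^sup>2 > 0" by (auto intro: add_pos_nonneg)
    ultimately have "1 \<le> (x * (1 + b\<^sup>2)) / (a * (1 + x\<^sup>2))"
      using assms by (simp only: le_divide_eq_1_pos mult_pos_pos)
    also have "\<dots> = (1 + b\<^sup>2) / a * (x / (1 + x\<^sup>2))" by (simp add: mult.commute)
    also have "\<dots> \<le> max 0 ((1 + b\<^sup>2) / a) * (x / (1 + x\<^sup>2))"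
      using True assms by (intro mult_right_mono) auto
    finally show ?thesis using True assms by simp
  qed simp
qed auto

lemma haar_interval_integral:
  assumes g: "square_integrable g" and a: "0 < a"
  shows "set_integrable lborel {a..b} (\<lambda>x. g x / of_real x)"
    "(\<integral>x. g x * indicator {a..b} x \<partial>mult_haar) = (LINT x:{a..b}|lborel. g x / of_real x)"
proof -
  have meas: "g \<in> borel_measurable borel" using g by (simp add: square_integrable_def)
  then have meas': "(\<lambda>x. g x * indicator {a..b} x) \<in> borel_measurable borel" by measurable
  have eq: "(1 / \<bar>x\<bar>) *\<^sub>R (g x * indicator {a..b} x) = indicator {a..b} x *\<^sub>R (g x / of_real x)" for x
    using a by (auto simp: indicator_def scaleR_conv_of_real divide_inverse)
  have "integrable mult_haar (\<lambda>x. g x * cnj (indicator {a..b} x))"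
    by (intro integrable_mult_cnj g square_integrable_indicator a)
  moreover have "(\<lambda>x. g x * cnj (indicator {a..b} x)) = (\<lambda>x. g x * indicator {a..b} x)"
    by (auto simp: indicator_def)
  ultimately show "set_integrable lborel {a..b} (\<lambda>x. g x / of_real x)"
    using integrable_mult_haar_iff[OF meas'] by (simp add: set_integrable_def eq)
  show "(\<integral>x. g x * indicator {a..b} x \<partial>mult_haar) = (LINT x:{a..b}|lborel. g x / of_real x)"
    unfolding integral_mult_haar[OF meas'] eq set_lebesgue_integral_def ..
qed

section \<open>Smooth vectors belong to the space K\<close>

context kirillov
begin

abbreviation SV :: "l2 set" where "SV \<equiv> smooth_vectors R"

text \<open>The orbit map of \<open>D X\<close> is \<open>g\<close> to \<open>Dg g (g ** X)\<close>:
  a smooth family of derivatives, contracted with entries that are linear in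
  \<open>g\<close>.\<close>

lemma SV_derivative:
  assumes "v \<in> SV"
  shows "\<exists>D. ((\<lambda>g. R g v) has_derivative D) (at (mat 1)) \<and> (\<forall>X. D X \<in> SV)"
proof -
  have "smooth_on GL2 (\<lambda>g. R g v)" using assms by (simp add: smooth_vectors_def)
  then obtain Dg where Dg: "\<And>g. g \<in> GL2 \<Longrightarrow> ((\<lambda>g. R g v) has_derivative Dg g) (at g)"
    "\<And>X. smooth_on GL2 (\<lambda>g. Dg g X)"
    by (rule smooth_on_derivative[OF open_GL2]) blast
  \<comment> \<open>The map \<open>h\<close> to \<open>R (g ** h) v\<close> is differentiated at 1
    in two ways, by the chain rule and through \<open>R g\<close>; uniqueness of the derivative
    equates them.\<close>
  have R_Dg: "R g (Dg (mat 1) X) = Dg g (g ** X)" if g: "g \<in> GL2" for g X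
  proof -
    have "((\<lambda>h. g ** h) has_derivative (\<lambda>X. g ** X)) (at (mat 1))"
      by (intro bounded_linear_imp_has_derivative bounded_linear_matrix_mult_left)
    from has_derivative_compose[OF this, of "\<lambda>h. R h v" "Dg g"] Dg(1)[OF g]
    have 1: "((\<lambda>h. R (g ** h) v) has_derivative (\<lambda>X. Dg g (g ** X))) (at (mat 1))"
      by simp
    have "((\<lambda>h. R g (R h v)) has_derivative (\<lambda>X. R g (Dg (mat 1) X))) (at (mat 1))"
      by (intro bounded_linear.has_derivative[OF R_bounded_linear[OF g]] Dg mat_1_GL2)
    then have "((\<lambda>h. R (g ** h) v) has_derivative (\<lambda>X. R g (Dg (mat 1) X))) (at (mat 1))"
      by (rule has_derivative_transform_within_open[OF _ open_GL2 mat_1_GL2]) (simp add: R_mult g)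
    from has_derivative_unique[OF this 1] show ?thesis by meson
  qed
  have "Dg (mat 1) X \<in> SV" for X
    unfolding smooth_vectors_def smooth_on_def
  proof (intro CollectI allI)
    fix k
    have entry: "(\<lambda>g. (g ** X) $ i $ j) \<in> regular_functions" for i j
    proof -
      have "(\<lambda>g. g $ i $ 1 * X $ 1 $ j + g $ i $ 2 * X $ 2 $ j) \<in> regular_functions"
        by (intro regular_functions.intros)
      then show ?thesis by (simp add: matrix_matrix_mult_def sum_2)
    qed
    let ?t = "\<lambda>i j E g. (g ** X) $ i $ j *\<^sub>R Dg g E"
    have t: "Ck_on k GL2 (?t i j E)" for i j E
      by (intro Ck_on_regular_function_scaleR entry Dg)
    have "Ck_on k GL2 (\<lambda>g. ?t 1 1 (mat2 1 0 0 0) g + ?t 1 2 (mat2 0 1 0 0) g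
        + ?t 2 1 (mat2 0 0 1 0) g + ?t 2 2 (mat2 0 0 0 1) g)"
      by (intro Ck_on_add open_GL2 t)
    also have "?this \<longleftrightarrow> Ck_on k GL2 (\<lambda>g. R g (Dg (mat 1) X))"
    proof (rule Ck_on_cong)
      fix g assume g: "g \<in> GL2"
      show "?t 1 1 (mat2 1 0 0 0) g + ?t 1 2 (mat2 0 1 0 0) g
        + ?t 2 1 (mat2 0 0 1 0) g + ?t 2 2 (mat2 0 0 0 1) g = R g (Dg (mat 1) X)"
        unfolding R_Dg[OF g]
        using linear_mat2_expansion[OF has_derivative_linear[OF Dg(1)[OF g]], of "g ** X"] by simp
    qed
    finally show "Ck_on k GL2 (\<lambda>g. R g (Dg (mat 1) X))" .
  qed
  then show ?thesis using Dg(1)[OF mat_1_GL2] by blast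
qed

text \<open>The orbit map of \<open>R w v\<close> is that of \<open>v\<close> after right
  translation by \<open>w\<close>, which is linear and preserves the group.\<close>

lemma SV_w:
  assumes "v \<in> SV" shows "R w v \<in> SV"
proof -
  have "Ck_on k GL2 (\<lambda>g. R (g ** w) v)" for k
    using assms
    by (intro Ck_on_compose_linear[OF open_GL2 bounded_linear_matrix_mult_right])
      (auto simp: smooth_vectors_def smooth_on_def GL2_mult)
  moreover have "Ck_on k GL2 (\<lambda>g. R (g ** w) v) \<longleftrightarrow> Ck_on k GL2 (\<lambda>g. R g (R w v))" for k
    by (intro Ck_on_cong) (simp add: R_mult)
  ultimately show ?thesis by (simp add: smooth_vectors_def smooth_on_def)
qed

lemma SV_curve_derivative:
  assumes "((\<lambda>g. R g v) has_derivative D) (at (mat 1))" and "\<gamma> 0 = mat 1"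
    and "(\<gamma> has_vector_derivative X) (at 0)"
  shows "((\<lambda>t. R (\<gamma> t) v) has_vector_derivative D X) (at 0)"
proof -
  have "((\<lambda>t. R (\<gamma> t) v) has_derivative (\<lambda>t. D (t *\<^sub>R X))) (at 0)"
    using has_derivative_compose[of \<gamma> "\<lambda>t. t *\<^sub>R X" 0 UNIV "\<lambda>g. R g v" D] assms
    by (simp add: has_vector_derivative_def)
  moreover have "(\<lambda>t. D (t *\<^sub>R X)) = (\<lambda>t. t *\<^sub>R D X)"
    using linear_scale[OF has_derivative_linear[OF assms(1)]] by auto
  ultimately show ?thesis by (simp add: has_vector_derivative_def)
qed

lemma has_vector_derivative_mat2:
  assumes "(a has_vector_derivative a') F" "(b has_vector_derivative b') F"
    "(c has_vector_derivative c') F" "(e has_vector_derivative e') F"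
  shows "((\<lambda>t. mat2 (a t) (b t) (c t) (e t)) has_vector_derivative mat2 a' b' c' e') F"
proof -
  have eq: "mat2 a b c e = a *\<^sub>R mat2 1 0 0 0 + b *\<^sub>R mat2 0 1 0 0 + c *\<^sub>R mat2 0 0 1 0 + e *\<^sub>R mat2 0 0 0 1"
    for a b c e
    by (rule mat2_eqI) simp_all
  have *: "((\<lambda>t. f t *\<^sub>R E) has_vector_derivative f' *\<^sub>R E) F"
    if "(f has_vector_derivative f') F" for f f' and E :: "real^2^2"
    by (rule bounded_linear.has_vector_derivative[OF bounded_linear_scaleR_left that])
  show ?thesis
    unfolding eq[of "a _" "b _" "c _" "e _"] eq[of a' b' c' e']
    by (intro has_vector_derivative_add * assms)
qed

text \<open>The difference quotients along the upper unipotent subgroup converge in norm by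
  smoothness and pointwise to \<open>i x f\<close>. Both limits agree almost everywhere, which shows
  in particular that \<open>x f\<close> is square integrable.\<close>

lemma SV_times_x:
  assumes v: "v \<in> SV" "represents f v"
  shows "\<exists>u\<in>SV. represents (\<lambda>x. \<i> * (of_real x * f x)) u"
proof -
  obtain D where D: "((\<lambda>g. R g v) has_derivative D) (at (mat 1))" "\<And>X. D X \<in> SV"
    using SV_derivative[OF v(1)] by blast
  let ?u = "D (mat2 0 1 0 0)"
  have "((\<lambda>y. upper y) has_vector_derivative mat2 0 1 0 0) (at 0)"
    by (intro has_vector_derivative_mat2 has_vector_derivative_const has_vector_derivative_id)
  from SV_curve_derivative[OF D(1) _ this]
  have curve: "((\<lambda>y. R (upper y) v) has_vector_derivative ?u) (at 0)"
    by (simp add: mat_1_eq_mat2)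
  define V where "V n = real (Suc n) *\<^sub>R (R (upper (1 / real (Suc n))) v - v)" for n
  define F where "F n x = of_real (real (Suc n)) * (exp (\<i> * of_real (1 / real (Suc n) * x)) * f x - f x)" for n x
  have rep: "represents (F n) (V n)" for n
    unfolding F_def V_def by (intro represents_scaleR represents_diff represents_upper v)
  have quot: "(\<lambda>n. real (Suc n) *\<^sub>R (\<gamma> (1 / real (Suc n)) - \<gamma> 0)) \<longlonglongrightarrow> D"
    if "(\<gamma> has_vector_derivative D) (at 0)" for \<gamma> :: "real \<Rightarrow> 'b :: real_normed_vector" and D
  proof -
    from that have "(\<lambda>n. (\<gamma> (1 / real (Suc n)) - \<gamma> 0) /\<^sub>R (1 / real (Suc n) - 0)) \<longlonglongrightarrow> D"
      unfolding has_vector_derivative_iff_quotient tendsto_at_iff_sequentially comp_def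
      by (elim allE[of _ "\<lambda>n. 1 / real (Suc n)"])
        (use LIMSEQ_inverse_real_of_nat in \<open>auto simp: inverse_eq_divide simp del: of_nat_Suc\<close>)
    then show ?thesis by (simp del: of_nat_Suc)
  qed
  have "V \<longlonglongrightarrow> ?u"
    using quot[OF curve] by (simp add: V_def[abs_def] mat_1_eq_mat2[symmetric] del: of_nat_Suc)
  moreover obtain f2 where f2: "represents f2 ?u" using represents_ex by blast
  moreover have "(\<lambda>n. F n x) \<longlonglongrightarrow> \<i> * (of_real x * f x)" for x
  proof -
    have "((\<lambda>s. exp (\<i> * (of_real s * of_real x)) * f x) has_vector_derivative \<i> * (of_real x * f x)) (at 0)"
      using has_vector_derivative_mult_left[OF exp_curve_has_vector_derivative[of "\<i> * of_real x" 0], of "f x"]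
      by (simp add: mult_ac)
    from quot[OF this] show ?thesis
      by (simp add: F_def scaleR_conv_of_real del: of_nat_Suc)
  qed
  moreover have meas: "(\<lambda>x. \<i> * (of_real x * f x)) \<in> borel_measurable borel"
    using represents_measurable[OF v(2)] by measurable
  ultimately have "AE x in lborel. f2 x = \<i> * (of_real x * f x)"
    by (intro represents_limit_AE[where F = F and V = V] rep) auto
  then have "represents (\<lambda>x. \<i> * (of_real x * f x)) ?u"
    by (rule represents_cong_AE[OF f2 meas])
  then show ?thesis using D(2) by blast
qed

text \<open>As \<open>f\<close> is not yet known to be differentiable, the derivative is tested
  against indicators of intervals. The invariant measure moves the dilation from \<open>f\<close> to
  the interval, which becomes \<open>[a exp h, b exp h]\<close>. The sign \<open>s\<close> selects
  the half-line.\<close>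

lemma SV_dilation_derivative:
  assumes v: "v \<in> SV" "represents f v"
  shows "\<exists>v1\<in>SV. \<forall>f1 s a b. represents f1 v1 \<longrightarrow> \<bar>s\<bar> = 1 \<longrightarrow> 0 < a \<longrightarrow> a < b \<longrightarrow>
    ((\<lambda>h. LINT x:{a * exp h..b * exp h}|lborel. f (s * x) / of_real x) has_vector_derivative
      (LINT x:{a..b}|lborel. (f1 (s * x) - \<sigma> * f (s * x)) / of_real x)) (at 0)"
proof -
  obtain D where D: "((\<lambda>g. R g v) has_derivative D) (at (mat 1))" "\<And>X. D X \<in> SV"
    using SV_derivative[OF v(1)] by blast
  let ?u = "D (mat2 1 0 0 0)"
  have "(exp has_vector_derivative 1) (at (0::real))"
    using DERIV_exp[of "0::real"] by (simp add: has_real_derivative_iff_has_vector_derivative)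
  then have "((\<lambda>t. diag (exp t)) has_vector_derivative mat2 1 0 0 0) (at 0)"
    by (intro has_vector_derivative_mat2 has_vector_derivative_const)
  from SV_curve_derivative[OF D(1) _ this]
  have curve: "((\<lambda>t. R (diag (exp t)) v) has_vector_derivative ?u) (at 0)"
    by (simp add: mat_1_eq_mat2)
  show ?thesis
  proof (intro bexI[of _ ?u] allI impI D(2))
    fix f1 :: "real \<Rightarrow> complex" and s a b :: real
    assume f1: "represents f1 ?u" and s: "\<bar>s\<bar> = 1" and a: "0 < a" and b: "a < b"
    then have s0: "s \<noteq> 0" by auto
    have s_sq: "s * s = 1" using s by (auto simp: abs_if split: if_splits)
    let ?J = "\<lambda>x. indicator {a..b} (s * x) :: complex"
    have J: "square_integrable ?J"
      using square_integrable_scale_arg[OF square_integrable_indicator[OF a] s0] .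
    obtain j where j: "represents ?J j" using represents_exists[OF J] by blast
    obtain ij where ij: "represents (\<lambda>x. \<i> * ?J x) ij"
      using represents_exists[OF square_integrable_scale[OF J]] by blast
    \<comment> \<open>\<open>inner\<close> is only the real part of the Hermitian product; pairing
      with \<open>i\<close> times the indicator recovers the imaginary part.\<close>
    define \<Lambda> where "\<Lambda> u = Complex (inner u j) (inner u ij)" for u
    have \<Lambda>: "\<Lambda> u = (\<integral>x. k (s * x) * indicator {a..b} x \<partial>mult_haar)" if k: "represents k u" for k u
    proof -
      have meas: "(\<lambda>x. k x * ?J x) \<in> borel_measurable borel"
        using represents_measurable[OF k] by measurable
      have "inner u j = Re (\<integral>x. k x * ?J x \<partial>mult_haar)"
      proof -
        have "(\<lambda>x. k x * cnj (?J x)) = (\<lambda>x. k x * ?J x)"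
          by (auto simp: indicator_def)
        then show ?thesis unfolding represents_inner[OF k j] by (simp only:)
      qed
      moreover have "inner u ij = Re (- \<i> * (\<integral>x. k x * ?J x \<partial>mult_haar))"
      proof -
        have "(\<lambda>x. k x * cnj (\<i> * ?J x)) = (\<lambda>x. - \<i> * (k x * ?J x))"
          by (auto simp: indicator_def)
        then show ?thesis
          unfolding represents_inner[OF k ij] by (simp only: integral_mult_right_zero)
      qed
      ultimately have "\<Lambda> u = (\<integral>x. k x * ?J x \<partial>mult_haar)"
        by (simp add: \<Lambda>_def complex_eq_iff)
      also have "\<dots> = (\<integral>x. k (s * x) * ?J (s * x) \<partial>mult_haar)"
        by (rule integral_mult_haar_scale[symmetric, OF meas s0])
      also have "\<dots> = (\<integral>x. k (s * x) * indicator {a..b} x \<partial>mult_haar)"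
        by (simp add: s_sq flip: mult.assoc)
      finally show ?thesis .
    qed
    have sq: "square_integrable (\<lambda>x. f (s * x))" "square_integrable (\<lambda>x. f1 (s * x))"
      by (intro square_integrable_scale_arg represents_square_integrable[OF v(2)]
          represents_square_integrable[OF f1] s0)+
    have \<Lambda>_deriv: "((\<lambda>h. \<Lambda> (R (diag (exp h)) v)) has_vector_derivative \<Lambda> ?u) (at 0)"
      unfolding \<Lambda>_def has_vector_derivative_complex_iff complex.sel
      unfolding has_real_derivative_iff_has_vector_derivative
      by (intro conjI bounded_linear.has_vector_derivative[OF bounded_linear_inner_left curve])
    have \<Lambda>_diag: "\<Lambda> (R (diag (exp h)) v) = exp (\<sigma> * of_real h) *
        (LINT x:{a * exp h..b * exp h}|lborel. f (s * x) / of_real x)" for h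
    proof -
      have ah: "0 < a * exp h" using a by simp
      have meas: "(\<lambda>x. f (s * x) * indicator {a * exp h..b * exp h} x) \<in> borel_measurable borel"
        using measurable_compose[OF _ represents_measurable[OF v(2)], of "\<lambda>x. s * x" borel] by measurable
      have "\<Lambda> (R (diag (exp h)) v) =
          (\<integral>x. exp (\<sigma> * of_real h) * f (exp h * (s * x)) * indicator {a..b} x \<partial>mult_haar)"
        by (rule \<Lambda>[OF represents_diag_exp[OF v(2)]])
      also have "\<dots> = (\<integral>x. exp (\<sigma> * of_real h) *
          (f (s * (exp h * x)) * indicator {a * exp h..b * exp h} (exp h * x)) \<partial>mult_haar)"
        by (intro Bochner_Integration.integral_cong)
          (auto simp: indicator_def mult_ac)
      also have "\<dots> = exp (\<sigma> * of_real h) * (\<integral>x. f (s * x) * indicator {a * exp h..b * exp h} x \<partial>mult_haar)"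
        using integral_mult_haar_scale[OF meas, of "exp h"] by simp
      finally show ?thesis unfolding haar_interval_integral(2)[OF sq(1) ah] .
    qed
    have \<Lambda>_0: "\<Lambda> v = (LINT x:{a..b}|lborel. f (s * x) / of_real x)"
      unfolding \<Lambda>[OF v(2)] by (rule haar_interval_integral(2)[OF sq(1) a])
    have \<Lambda>_u: "\<Lambda> ?u = (LINT x:{a..b}|lborel. f1 (s * x) / of_real x)"
      unfolding \<Lambda>[OF f1] by (rule haar_interval_integral(2)[OF sq(2) a])
    \<comment> \<open>Multiplying by \<open>exp (- \<sigma> h)\<close> strips the scalar factor of
      the representation; its derivative is the origin of the term with
      \<open>- \<sigma>\<close>.\<close>
    have "((\<lambda>h. exp (- \<sigma> * of_real h)) has_vector_derivative - \<sigma>) (at 0)"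
      using exp_curve_has_vector_derivative[of "- \<sigma>" 0] by simp
    from has_vector_derivative_mult[OF this \<Lambda>_deriv]
    have "((\<lambda>h. exp (- \<sigma> * of_real h) * \<Lambda> (R (diag (exp h)) v)) has_vector_derivative \<Lambda> ?u - \<sigma> * \<Lambda> v) (at 0)"
      by (simp add: mat_1_eq_mat2[symmetric])
    moreover have "exp (- \<sigma> * of_real h) * \<Lambda> (R (diag (exp h)) v)
        = (LINT x:{a * exp h..b * exp h}|lborel. f (s * x) / of_real x)" for h
      unfolding \<Lambda>_diag by (simp add: exp_minus)
    moreover have "\<Lambda> ?u - \<sigma> * \<Lambda> v = (LINT x:{a..b}|lborel. (f1 (s * x) - \<sigma> * f (s * x)) / of_real x)"
    proof -
      have "(LINT x:{a..b}|lborel. f1 (s * x) / of_real x - \<sigma> * (f (s * x) / of_real x))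
          = (LINT x:{a..b}|lborel. f1 (s * x) / of_real x) - (LINT x:{a..b}|lborel. \<sigma> * (f (s * x) / of_real x))"
        by (intro set_integral_diff set_integrable_mult_right haar_interval_integral(1) sq a)
      then show ?thesis
        unfolding \<Lambda>_0 \<Lambda>_u set_integral_mult_right by (simp add: diff_divide_distrib)
    qed
    ultimately show "((\<lambda>h. LINT x:{a * exp h..b * exp h}|lborel. f (s * x) / of_real x) has_vector_derivative
      (LINT x:{a..b}|lborel. (f1 (s * x) - \<sigma> * f (s * x)) / of_real x)) (at 0)"
      by simp
  qed
qed

text \<open>By \<open>continuous_AE_eq\<close>, a representative continuous off 0 is determined
  there by its class, so pointwise statements about smooth vectors make sense.\<close>

definition SF :: "(real \<Rightarrow> complex) set" where
  "SF = {f. continuous_on (- {0}) f \<and> (\<exists>v\<in>SV. represents f v)}"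

lemma SF_continuous_dilate:
  assumes "f \<in> SF" "s \<noteq> 0" shows "continuous_on {0<..} (\<lambda>x. f (s * x))"
proof -
  have "continuous_on (- {0}) f" using assms(1) by (simp add: SF_def)
  then show ?thesis
    by (rule continuous_on_compose2) (use assms(2) in \<open>auto intro!: continuous_intros\<close>)
qed

lemma SF_square_integrable: "f \<in> SF \<Longrightarrow> square_integrable f"
  unfolding SF_def using represents_square_integrable by blast

lemma locally_integrable_haar:
  assumes "square_integrable g" shows "locally_integrable (\<lambda>x. g x / of_real x)"
proof -
  have "g \<in> borel_measurable borel" using assms by (simp add: square_integrable_def)
  then show ?thesis
    using haar_interval_integral(1)[OF assms] by (auto simp: locally_integrable_def)
qed

text \<open>\<open>v1\<close> is fixed before \<open>s\<close>, so one vector serves both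
  half-lines. The derivative is stated relative to a continuous \<open>\<eta>\<close> because
  \<open>v1\<close> itself gets a continuous representative only through this lemma.\<close>

lemma SV_half_line:
  assumes v: "v \<in> SV" "represents f v"
  shows "\<exists>v1\<in>SV. \<forall>f1 s. represents f1 v1 \<longrightarrow> \<bar>s\<bar> = 1 \<longrightarrow>
    (\<exists>\<rho>. continuous_on {0<..} \<rho> \<and> (AE x in lborel. 0 < x \<longrightarrow> f (s * x) = \<rho> x) \<and>
      (\<forall>\<eta> x. continuous_on {0<..} \<eta> \<longrightarrow> (AE x in lborel. 0 < x \<longrightarrow> f1 (s * x) - \<sigma> * f (s * x) = \<eta> x) \<longrightarrow> 0 < x \<longrightarrow>
        (\<rho> has_vector_derivative \<eta> x / of_real x) (at x)))"
proof -
  obtain v1 where v1: "v1 \<in> SV" and D: "\<And>f1 s a b. represents f1 v1 \<Longrightarrow> \<bar>s\<bar> = 1 \<Longrightarrow> 0 < a \<Longrightarrow> a < b \<Longrightarrow>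
    ((\<lambda>h. LINT x:{a * exp h..b * exp h}|lborel. f (s * x) / of_real x) has_vector_derivative
      (LINT x:{a..b}|lborel. (f1 (s * x) - \<sigma> * f (s * x)) / of_real x)) (at 0)"
    using SV_dilation_derivative[OF v] by blast
  show ?thesis
  proof (intro bexI[of _ v1] allI impI v1)
    fix f1 and s :: real assume f1: "represents f1 v1" and s: "\<bar>s\<bar> = 1"
    have s0: "s \<noteq> 0" using s by auto
    have sq: "square_integrable (\<lambda>x. f (s * x))" "square_integrable (\<lambda>x. f1 (s * x) - \<sigma> * f (s * x))"
    proof -
      show f: "square_integrable (\<lambda>x. f (s * x))"
        by (rule square_integrable_scale_arg[OF represents_square_integrable[OF v(2)] s0])
      have "square_integrable (\<lambda>x. f1 (s * x) + (- \<sigma>) * f (s * x))"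
        by (intro square_integrable_add square_integrable_scale f
            square_integrable_scale_arg[OF represents_square_integrable[OF f1] s0])
      then show "square_integrable (\<lambda>x. f1 (s * x) - \<sigma> * f (s * x))" by simp
    qed
    obtain \<rho> where "continuous_on {0<..} \<rho>" "AE x in lborel. 0 < x \<longrightarrow> f (s * x) = \<rho> x"
      "\<And>\<eta> x. continuous_on {0<..} \<eta> \<Longrightarrow> AE x in lborel. 0 < x \<longrightarrow> f1 (s * x) - \<sigma> * f (s * x) = \<eta> x \<Longrightarrow> 0 < x \<Longrightarrow>
        (\<rho> has_vector_derivative \<eta> x / of_real x) (at x)"
      by (rule weak_dilation_derivative[OF locally_integrable_haar[OF sq(1)] locally_integrable_haar[OF sq(2)]
            D[OF f1 s]]) blast+
    then show "\<exists>\<rho>. continuous_on {0<..} \<rho> \<and> (AE x in lborel. 0 < x \<longrightarrow> f (s * x) = \<rho> x) \<and>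
      (\<forall>\<eta> x. continuous_on {0<..} \<eta> \<longrightarrow> (AE x in lborel. 0 < x \<longrightarrow> f1 (s * x) - \<sigma> * f (s * x) = \<eta> x) \<longrightarrow> 0 < x \<longrightarrow>
        (\<rho> has_vector_derivative \<eta> x / of_real x) (at x))"
      by (intro exI[of _ \<rho>] conjI allI impI) assumption+
  qed
qed

lemma SV_continuous_representative:
  assumes v: "v \<in> SV" shows "\<exists>f\<in>SF. represents f v"
proof -
  obtain f where f: "represents f v" using represents_ex by blast
  obtain v1 where v1: "\<And>f1 s. represents f1 v1 \<Longrightarrow> \<bar>s\<bar> = 1 \<Longrightarrow>
    \<exists>\<rho>. continuous_on {0<..} \<rho> \<and> (AE x in lborel. 0 < x \<longrightarrow> f (s * x) = \<rho> x)"
    using SV_half_line[OF v f] by blast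
  obtain f1 where f1: "represents f1 v1" using represents_ex by blast
  obtain \<rho> where \<rho>: "continuous_on {0<..} \<rho>" "AE x in lborel. 0 < x \<longrightarrow> f x = \<rho> x"
    using v1[OF f1, of 1] by auto
  obtain \<rho>' where \<rho>': "continuous_on {0<..} \<rho>'" "AE x in lborel. 0 < x \<longrightarrow> f (- x) = \<rho>' x"
    using v1[OF f1, of "- 1"] by auto
  define k where "k x = (if x > 0 then \<rho> x else \<rho>' (- x))" for x
  have k: "continuous_on (- {0}) k"
    unfolding k_def by (rule continuous_on_punctured[OF \<rho>(1) \<rho>'(1)])
  have "AE x in lborel. 0 < - 1 * x \<longrightarrow> f (- (- 1 * x)) = \<rho>' (- 1 * x)"
    by (rule AE_lborel_scale[OF \<rho>'(2)]) simp
  then have "AE x in lborel. f x = k x"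
    using \<rho>(2) AE_lborel_singleton[of 0] by eventually_elim (auto simp: k_def)
  moreover have "k \<in> borel_measurable borel"
    by (rule borel_measurable_continuous_countable_exceptions[OF _ k]) simp
  ultimately have "represents k v" by (intro represents_cong_AE[OF f])
  then show ?thesis using v k by (auto simp: SF_def)
qed

text \<open>Bootstrapping: \<open>v1\<close> is smooth again, so its own continuous representative
  \<open>f1\<close> supplies the \<open>\<eta>\<close> of \<open>SV_half_line\<close>. Thus
  \<open>x f' = f1 - \<sigma> f\<close> holds at every point off 0.\<close>

lemma SF_derivative:
  assumes f: "f \<in> SF"
  shows "\<exists>f1\<in>SF. \<forall>x. x \<noteq> 0 \<longrightarrow> (f has_vector_derivative (f1 x - \<sigma> * f x) / of_real x) (at x)"
proof -
  obtain v where v: "v \<in> SV" "represents f v" using f by (auto simp: SF_def)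
  obtain v1 where v1: "v1 \<in> SV" and half: "\<And>f1 s. represents f1 v1 \<Longrightarrow> \<bar>s\<bar> = 1 \<Longrightarrow>
    \<exists>\<rho>. continuous_on {0<..} \<rho> \<and> (AE x in lborel. 0 < x \<longrightarrow> f (s * x) = \<rho> x) \<and>
      (\<forall>\<eta> x. continuous_on {0<..} \<eta> \<longrightarrow> (AE x in lborel. 0 < x \<longrightarrow> f1 (s * x) - \<sigma> * f (s * x) = \<eta> x) \<longrightarrow> 0 < x \<longrightarrow>
        (\<rho> has_vector_derivative \<eta> x / of_real x) (at x))"
    using SV_half_line[OF v] by blast
  obtain f1 where f1: "f1 \<in> SF" "represents f1 v1" using SV_continuous_representative[OF v1] by blast
  have deriv: "((\<lambda>x. f (s * x)) has_vector_derivative (f1 (s * x) - \<sigma> * f (s * x)) / of_real x) (at x)"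
    if s: "\<bar>s\<bar> = 1" and x: "0 < x" for s x :: real
  proof -
    have s0: "s \<noteq> 0" using s by auto
    obtain \<rho> where \<rho>: "continuous_on {0<..} \<rho>" "AE x in lborel. 0 < x \<longrightarrow> f (s * x) = \<rho> x"
      and \<rho>': "\<And>\<eta> x. continuous_on {0<..} \<eta> \<Longrightarrow> AE x in lborel. 0 < x \<longrightarrow> f1 (s * x) - \<sigma> * f (s * x) = \<eta> x \<Longrightarrow>
        0 < x \<Longrightarrow> (\<rho> has_vector_derivative \<eta> x / of_real x) (at x)"
      using half[OF f1(2) s] by blast
    have cont: "continuous_on {0<..} (\<lambda>x. f1 (s * x) - \<sigma> * f (s * x))"
      by (intro continuous_intros SF_continuous_dilate f f1 s0)
    have eq: "f (s * x) = \<rho> x" if "x \<in> {0<..}" for x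
      by (rule continuous_AE_eq[OF _ SF_continuous_dilate[OF f s0] \<rho>(1) _ that]) (use \<rho>(2) in auto)
    have "(\<rho> has_vector_derivative (f1 (s * x) - \<sigma> * f (s * x)) / of_real x) (at x)"
      by (rule \<rho>'[OF cont _ x]) simp
    then show ?thesis
      by (rule has_vector_derivative_transform_within_open[where S = "{0<..}"]) (use x eq in auto)
  qed
  have "(f has_vector_derivative (f1 x - \<sigma> * f x) / of_real x) (at x)" if "x \<noteq> 0" for x
  proof (cases "x > 0")
    case True
    then show ?thesis using deriv[of 1 x] by simp
  next
    case False
    then have x: "- x > 0" using that by simp
    from has_vector_derivative_reflect[OF deriv[of "- 1" "- x", OF _ x]]
    show ?thesis by simp
  qed
  then show ?thesis using f1(1) by blast
qed

lemma SF_times_x: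
  assumes "f \<in> SF" shows "(\<lambda>x. \<i> * (of_real x * f x)) \<in> SF"
proof -
  obtain v where v: "v \<in> SV" "represents f v" using assms by (auto simp: SF_def)
  then show ?thesis
    using SV_times_x[OF v] assms by (auto simp: SF_def intro!: continuous_intros)
qed

lemma SF_bounded:
  assumes f: "f \<in> SF"
  shows "\<exists>C. \<forall>x. x \<noteq> 0 \<longrightarrow> \<bar>x\<bar> ^ N * norm (f x) \<le> C"
  using f
\<comment> \<open>Boundedness is proved for all of \<open>SF\<close>, so each further power of
  \<open>x\<close> is obtained by passing from \<open>f\<close> to \<open>i x f\<close>, again in
  \<open>SF\<close>.\<close>
proof (induction N arbitrary: f)
  case (0 f)
  obtain f1 where f1: "f1 \<in> SF"
    "\<And>x. x \<noteq> 0 \<Longrightarrow> (f has_vector_derivative (f1 x - \<sigma> * f x) / of_real x) (at x)"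
    using SF_derivative[OF 0] by blast
  have half: "\<exists>C. \<forall>x>0. cmod (f (s * x)) \<le> C" if s: "\<bar>s\<bar> = 1" for s :: real
  proof (rule bounded_of_square_integrable_derivative)
    have s0: "s \<noteq> 0" using s by auto
    show sq: "square_integrable (\<lambda>x. f (s * x))"
      by (rule square_integrable_scale_arg[OF SF_square_integrable[OF 0] s0])
    have "square_integrable (\<lambda>x. f1 (s * x) + (- \<sigma>) * f (s * x))"
      by (intro square_integrable_add square_integrable_scale sq
          square_integrable_scale_arg[OF SF_square_integrable[OF f1(1)] s0])
    then show "square_integrable (\<lambda>x. f1 (s * x) - \<sigma> * f (s * x))" by simp
    fix x :: real assume x: "0 < x"
    show "((\<lambda>x. f (s * x)) has_vector_derivative (f1 (s * x) - \<sigma> * f (s * x)) / of_real x) (at x)"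
      using has_vector_derivative_scale_arg[OF f1(2)[of "s * x"]] x s0 by (simp add: scaleR_conv_of_real)
  qed
  obtain A where A: "\<And>x. x > 0 \<Longrightarrow> cmod (f x) \<le> A" using half[of 1] by auto
  obtain B where B: "\<And>x. x > 0 \<Longrightarrow> cmod (f (- x)) \<le> B" using half[of "- 1"] by auto
  have "cmod (f x) \<le> max A B" if "x \<noteq> 0" for x
    using A[of x] B[of "- x"] that by (cases "x > 0") auto
  then show ?case by auto
next
  case (Suc N)
  obtain C where "\<And>x. x \<noteq> 0 \<Longrightarrow> \<bar>x\<bar> ^ N * norm (\<i> * (of_real x * f x)) \<le> C"
    using Suc.IH[OF SF_times_x[OF Suc.prems]] by blast
  then show ?case by (intro exI[of _ C]) (auto simp: norm_mult mult_ac)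
qed

lemma SF_half_line_bound:
  assumes "f \<in> SF" "\<bar>s\<bar> = 1" shows "\<exists>C. \<forall>x>0. x ^ N * norm (f (s * x)) \<le> C"
proof -
  obtain C where C: "\<And>x. x \<noteq> 0 \<Longrightarrow> \<bar>x\<bar> ^ N * norm (f x) \<le> C"
    using SF_bounded[OF assms(1)] by blast
  have "x ^ N * norm (f (s * x)) \<le> C" if "x > 0" for x
    using C[of "s * x"] that assms(2) by (force simp: abs_mult)
  then show ?thesis by blast
qed

lemma SF_rapid_open: "f \<in> SF \<Longrightarrow> \<bar>s\<bar> = 1 \<Longrightarrow> rapid_open (\<lambda>x. f (s * x))"
  unfolding rapid_open_def using SF_continuous_dilate[of f s] SF_half_line_bound[of f s] by auto

lemma SF_smooth_with:
  assumes "f \<in> SF" shows "smooth_with (- {0}) rapidly_decreasing f"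
proof -
  \<comment> \<open>Each derivative contributes a factor \<open>1 / x\<close>; these powers are
    smooth off 0 and bounded for \<open>|x| >= 1\<close>, so they keep the decay.\<close>
  define E where "E c m f x = c * of_real ((1 / x) ^ m) * f x" for c m and f :: "real \<Rightarrow> complex" and x :: real
  define B where "B = {E c m f |c m f. f \<in> SF}"
  have "smooth_with (- {0}) rapidly_decreasing (E 1 0 f)"
  proof (rule smooth_with_sums_of[where B = B])
    fix g assume "g \<in> B"
    then obtain c m f where g: "g = E c m f" and f: "f \<in> SF" unfolding B_def by blast
    have rapid: "rapid_top (\<lambda>x. E c m f (s * x))" if s: "\<bar>s\<bar> = 1" for s
      unfolding E_def
    proof (rule rapid_top_mult_bounded[where C = "norm c"])
      show "rapid_top (\<lambda>x. f (s * x))"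
        by (rule rapid_top_of_bound) (rule SF_half_line_bound[OF f s])
      fix x :: real assume "x \<ge> 1"
      then have "\<bar>1 / (s * x)\<bar> \<le> 1" using s by (simp add: abs_mult)
      then have "\<bar>1 / (s * x)\<bar> ^ m \<le> 1" by (intro power_le_one) auto
      then have "norm c * \<bar>1 / (s * x)\<bar> ^ m \<le> norm c * 1" by (intro mult_left_mono) auto
      then show "norm (c * of_real ((1 / (s * x)) ^ m)) \<le> norm c"
        unfolding norm_mult norm_of_real power_abs by simp
    qed
    show "rapidly_decreasing g"
      unfolding rapidly_decreasing_iff g using rapid[of 1] rapid[of "- 1"] by simp
    obtain f1 where f1: "f1 \<in> SF"
      "\<And>x. x \<noteq> 0 \<Longrightarrow> (f has_vector_derivative (f1 x - \<sigma> * f x) / of_real x) (at x)"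
      using SF_derivative[OF f] by blast
    let ?g' = "\<lambda>x. E (c * (- of_real (real m) - \<sigma>)) (Suc m) f x + E c (Suc m) f1 x"
    have "?g' \<in> sums_of B"
      by (intro sums_of.add sums_of.base) (use f f1 in \<open>auto simp: B_def\<close>)
    moreover have "(g has_vector_derivative ?g' x) (at x within - {0})" if x: "x \<noteq> 0" for x
    proof -
      have "((\<lambda>x. (1 / x) ^ m) has_real_derivative - real m * (1 / x) ^ Suc m) (at x)"
      proof -
        have "((\<lambda>x. 1 / x) has_real_derivative - ((1 / x) * (1 / x))) (at x)"
          using x by (auto intro!: derivative_eq_intros)
        from DERIV_power[OF this, of m] show ?thesis
          by (rule DERIV_cong) (cases m; simp del: of_nat_Suc)
      qed
      from has_vector_derivative_mult_right[OF has_vector_derivative_mult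
          [OF has_vector_derivative_of_real[OF this] f1(2)[OF x]], of c]
      have "((\<lambda>x. c * (of_real ((1 / x) ^ m) * f x)) has_vector_derivative ?g' x) (at x)"
        unfolding E_def by (rule has_vector_derivative_eq_rhs) (use x in \<open>simp add: field_simps\<close>)
      then show ?thesis
        unfolding g E_def by (simp add: mult.assoc has_vector_derivative_at_within)
    qed
    ultimately show "\<exists>g'\<in>sums_of B. \<forall>x\<in>- {0}. (g has_vector_derivative g' x) (at x within - {0})"
      by (intro bexI[of _ ?g']) auto
  next
    fix f g assume "rapidly_decreasing f" "rapidly_decreasing g"
    then show "rapidly_decreasing (\<lambda>x. f x + g x)"
      unfolding rapidly_decreasing_iff using rapid_top_add[of f g] rapid_top_add[of "\<lambda>x. f (- x)" "\<lambda>x. g (- x)"] by blast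
  next
    show "E 1 0 f \<in> sums_of B" using assms by (intro sums_of.base) (auto simp: B_def)
  qed
  then show ?thesis by (simp add: E_def[abs_def])
qed

lemma SF_cutoff:
  assumes f: "f \<in> SF" and \<delta>: "\<delta> > 0"
  shows "(\<lambda>x. of_real (exp (- \<delta> / \<bar>x\<bar>)) * f x) \<in> kirillov_space d"
proof -
  \<comment> \<open>The exponent \<open>n = d + 1\<close> of \<open>half_schwartz_cutoff\<close>
    divides out the weight.\<close>
  have half: "half_schwartz (\<lambda>x. if x > 0 then of_real ((1 / sqrt x) ^ (d + 1) * exp (- \<delta> / x)) * f (s * x) else 0)"
    if s: "\<bar>s\<bar> = 1" for s :: real
  proof (rule half_schwartz_cutoff[where W = "{\<lambda>x. f (s * x) |f. f \<in> SF}" and \<sigma> = \<sigma>, OF _ _ \<delta>])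
    fix k assume "k \<in> {\<lambda>x. f (s * x) |f. f \<in> SF}"
    then obtain f where k: "k = (\<lambda>x. f (s * x))" and f: "f \<in> SF" by blast
    have s0: "s \<noteq> 0" using s by auto
    obtain f1 where f1: "f1 \<in> SF"
      "\<And>x. x \<noteq> 0 \<Longrightarrow> (f has_vector_derivative (f1 x - \<sigma> * f x) / of_real x) (at x)"
      using SF_derivative[OF f] by blast
    have "(k has_vector_derivative (f1 (s * x) - \<sigma> * k x) / of_real x) (at x)" if x: "x > 0" for x
      using has_vector_derivative_scale_arg[OF f1(2)[of "s * x"]] x s0 unfolding k
      by (simp add: scaleR_conv_of_real)
    then show "\<exists>k1\<in>{\<lambda>x. f (s * x) |f. f \<in> SF}. \<forall>x>0. (k has_vector_derivative (k1 x - \<sigma> * k x) / of_real x) (at x)"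
      using f1(1) by (intro bexI[of _ "\<lambda>x. f1 (s * x)"]) auto
    show "\<exists>C. \<forall>x>0. x ^ N * norm (k x) \<le> C" for N
      unfolding k by (rule SF_half_line_bound[OF f s])
  qed (use f in blast)
  show ?thesis
    by (rule kirillov_space_of_half_schwartz[OF half[of 1] half[of "- 1"]])
      (auto simp: weight_def power_divide mult_ac)
qed

text \<open>The integral formula for \<open>R w\<close> extends from the space K to smooth vectors, because multiplication
  by a factor flat at 0 approximates a smooth vector by elements of K.\<close>

lemma SF_bessel_transform:
  assumes f: "f \<in> SF" "represents f v"
  shows "\<exists>k1 k2. rapid_open k1 \<and> rapid_open k2 \<and>
    represents (\<lambda>y. if y > 0 then of_real (weight d y) * hankel d k1 y
      else of_real (weight d (- y)) * hankel d k2 (- y)) (R w v)"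
proof -
  let ?c = "\<i> powi (- (int d + 1))"
  \<comment> \<open>The weight of the kernel times the density \<open>1 / x\<close>; for
    \<open>d > 0\<close> only a nonnegative power of \<open>sqrt x\<close> is left, so boundedness
    of \<open>f\<close> near 0 is enough.\<close>
  define K where "K s x = complex_of_real (sqrt x ^ (d - 1)) * f (s * x)" for s x
  have K: "rapid_open (K s)" if "\<bar>s\<bar> = 1" for s
    unfolding K_def by (intro rapid_open_sqrt_power SF_rapid_open f that)
  define k1 where "k1 x = ?c * K 1 x" for x
  define k2 where "k2 x = ((- 1) powi \<epsilon> * ?c) * K (- 1) x" for x
  have k: "rapid_open k1" "rapid_open k2"
    unfolding k1_def k2_def by (intro rapid_open_mult_left K; simp)+
  define \<Phi> where "\<Phi> y = (if y > 0 then of_real (weight d y) * hankel d k1 y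
      else of_real (weight d (- y)) * hankel d k2 (- y))" for y
  define F where "F n x = complex_of_real (exp (- (1 / real (Suc n)) / \<bar>x\<bar>)) * f x" for n x
  have F: "F n \<in> kirillov_space d" for n
    unfolding F_def by (rule SF_cutoff[OF f(1)]) (simp del: of_nat_Suc)
  obtain V where V: "\<And>n. represents (F n) (V n)"
    using kirillov_space_represents[OF F d_pos] by metis
  have lim0: "(\<lambda>n. 1 / real (Suc n)) \<longlonglongrightarrow> 0"
    using LIMSEQ_inverse_real_of_nat by (simp add: inverse_eq_divide)
  have "V \<longlonglongrightarrow> v"
  proof (rule represents_dominated_convergence[OF V f(2)])
    fix x :: real assume x: "x \<noteq> 0"
    have "(\<lambda>n. F n x) \<longlonglongrightarrow> complex_of_real (exp (- 0 / \<bar>x\<bar>)) * f x"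
      unfolding F_def using x
      by (intro tendsto_mult tendsto_const tendsto_of_real tendsto_exp tendsto_divide tendsto_minus lim0) auto
    then show "(\<lambda>n. F n x) \<longlonglongrightarrow> f x" by simp
    fix n
    define e where "e = exp (- (1 / real (Suc n)) / \<bar>x\<bar>)"
    have e: "0 \<le> e" "e \<le> 1"
      unfolding e_def by (auto simp: divide_nonpos_nonneg simp del: of_nat_Suc)
    have "F n x - f x = of_real (e - 1) * f x" by (simp add: F_def e_def algebra_simps)
    then have "cmod (F n x - f x) = (1 - e) * cmod (f x)"
      using e by (simp add: norm_mult flip: of_real_diff)
    also have "\<dots> \<le> cmod (f x)" using e by (intro mult_left_le_one_le) auto
    finally show "cmod (F n x - f x) \<le> cmod (f x)" .
  qed
  then have lim: "(\<lambda>n. R w (V n)) \<longlonglongrightarrow> R w v"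
    by (intro bounded_linear.tendsto[OF R_bounded_linear]) simp_all
  obtain r where r: "represents r (R w v)" using represents_ex by blast
  have hankel_F: "hankel d (\<lambda>x. F n (s * x) * of_real (weight d x / x)) y
      = hankel d (\<lambda>x. of_real (exp (- (1 / real (Suc n)) / x)) * K s x) y"
    if s: "\<bar>s\<bar> = 1" for n s y
  proof (rule hankel_cong)
    fix x :: real assume x: "x > 0"
    then show "F n (s * x) * of_real (weight d x / x) = of_real (exp (- (1 / real (Suc n)) / x)) * K s x"
      using s d_pos by (simp add: F_def K_def weight_eq abs_mult mult_ac del: of_nat_Suc)
  qed
  have pointwise: "(\<lambda>n. of_real (sgn y) powi \<epsilon> * (\<integral>x. F n x * bessel_kernel d (x * y) \<partial>mult_haar)) \<longlonglongrightarrow> \<Phi> y"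
    if y: "y \<noteq> 0" for y
  proof -
    have s: "\<bar>sgn y\<bar> = 1" using y by (simp add: abs_sgn_eq)
    have "(\<lambda>n. of_real (sgn y) powi \<epsilon> * (?c * of_real (weight d y) *
          hankel d (\<lambda>x. of_real (exp (- (1 / real (Suc n)) / x)) * K (sgn y) x) \<bar>y\<bar>))
        \<longlonglongrightarrow> of_real (sgn y) powi \<epsilon> * (?c * of_real (weight d y) * hankel d (K (sgn y)) \<bar>y\<bar>)"
      by (intro tendsto_mult tendsto_const hankel_cutoff_limit K s) simp
    moreover have "of_real (sgn y) powi \<epsilon> * (?c * of_real (weight d y) * hankel d (K (sgn y)) \<bar>y\<bar>) = \<Phi> y"
    proof -
      have "hankel d k1 z = ?c * hankel d (K 1) z"
        "hankel d k2 z = ((- 1) powi \<epsilon> * ?c) * hankel d (K (- 1)) z" for z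
        unfolding k1_def k2_def by (rule hankel_mult_left)+
      then show ?thesis using y by (cases "y > 0") (auto simp: \<Phi>_def)
    qed
    ultimately show ?thesis
      unfolding bessel_transform_eq[OF represents_measurable[OF V] y] hankel_F[OF s] by simp
  qed
  have meas: "\<Phi> \<in> borel_measurable borel"
  proof -
    have cont: "continuous_on {0..} (hankel d k)" if "rapid_open k" for k
      by (rule smooth_with_continuous_on[OF smooth_with_hankel[OF that]])
    have "continuous_on {0<..} (\<lambda>y. of_real (weight d y) * hankel d k y)" if "rapid_open k" for k
      unfolding weight_def by (intro continuous_intros continuous_on_subset[OF cont[OF that]]) auto
    from continuous_on_punctured[OF this[OF k(1)] this[OF k(2)]]
    have "continuous_on (- {0}) \<Phi>" unfolding \<Phi>_def .
    then show ?thesis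
      by (intro borel_measurable_continuous_countable_exceptions[of "{0}"]) auto
  qed
  have "AE y in lborel. (\<lambda>n. of_real (sgn y) powi \<epsilon> * (\<integral>x. F n x * bessel_kernel d (x * y) \<partial>mult_haar)) \<longlonglongrightarrow> \<Phi> y"
    using AE_lborel_singleton[of 0] by eventually_elim (rule pointwise)
  \<comment> \<open>The transforms of the cutoffs converge to \<open>R w v\<close> in norm and to
    \<open>\<Phi>\<close> pointwise, so \<open>\<Phi>\<close> represents
    \<open>R w v\<close>.\<close>
  from represents_limit_AE[OF represents_w[OF F V] lim r meas this]
  have "AE y in lborel. r y = \<Phi> y" .
  then have "represents \<Phi> (R w v)" by (rule represents_cong_AE[OF r meas])
  then show ?thesis using k unfolding \<Phi>_def by blast
qed

lemma SV_KV: "SV \<subseteq> KV"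
proof
  fix v assume v: "v \<in> SV"
  obtain f where f: "f \<in> SF" "represents f v" using SV_continuous_representative[OF v] by blast
  obtain u where u: "u \<in> SF" "represents u (R w v)" using SV_continuous_representative[OF SV_w[OF v]] by blast
  obtain k1 k2 where k: "rapid_open k1" "rapid_open k2"
    and rep: "represents (\<lambda>y. if y > 0 then of_real (weight d y) * hankel d k1 y
      else of_real (weight d (- y)) * hankel d k2 (- y)) (R w (R w v))"
    using SF_bessel_transform[OF u] by blast
  \<comment> \<open>The central character at \<open>- 1\<close>. Since \<open>w\<close> squares to
    \<open>scalar (- 1)\<close>, applying \<open>R w\<close> twice multiplies by
    \<open>\<omega>\<close>, and dividing recovers \<open>v\<close>.\<close>
  define \<omega> where "\<omega> = quasichar (s1 + s2 + 1) (m1 + m2) (- 1)"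
  have "\<omega> \<noteq> 0" by (simp add: \<omega>_def quasichar_def)
  have "w ** w = scalar (- 1)" by (simp add: mat2_mult)
  then have "R w (R w v) = scaleC_l2 \<omega> v"
    using R_mult[of w w v] by (simp add: R_scalar \<omega>_def)
  then have "scaleC_l2 (1 / \<omega>) (R w (R w v)) = v"
    using \<open>\<omega> \<noteq> 0\<close> by (simp add: scaleC_l2_scaleC)
  with represents_scaleC[OF rep, of "1 / \<omega>"]
  have "represents (\<lambda>y. 1 / \<omega> * (if y > 0 then of_real (weight d y) * hankel d k1 y
      else of_real (weight d (- y)) * hankel d k2 (- y))) v" by simp
  from represents_AE[OF f(2) this]
  have AE: "AE x in lborel. f x = 1 / \<omega> * (if x > 0 then of_real (weight d x) * hankel d k1 x
      else of_real (weight d (- x)) * hankel d k2 (- x))" .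
  have cont: "continuous_on {0<..} (\<lambda>x. 1 / \<omega> * (of_real (weight d x) * hankel d k x))" if "rapid_open k" for k
    unfolding weight_def
    by (intro continuous_intros continuous_on_subset[OF smooth_with_continuous_on[OF smooth_with_hankel[OF that]]]) auto
  \<comment> \<open>Both sides are continuous on the open half-line, so equality almost everywhere
    holds at every point.\<close>
  have f1: "f x = 1 / \<omega> * (of_real (weight d x) * hankel d k1 x)" if "x > 0" for x
  proof (rule continuous_AE_eq[OF _ _ cont[OF k(1)]])
    show "continuous_on {0<..} f" using SF_continuous_dilate[OF f(1), of 1] by simp
    show "AE x in lborel. x \<in> {0<..} \<longrightarrow> f x = 1 / \<omega> * (of_real (weight d x) * hankel d k1 x)"
      using AE by eventually_elim auto
  qed (use that in auto)
  have f2: "f (- x) = 1 / \<omega> * (of_real (weight d x) * hankel d k2 x)" if "x > 0" for x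
  proof (rule continuous_AE_eq[OF _ _ cont[OF k(2)]])
    show "continuous_on {0<..} (\<lambda>x. f (- x))" using SF_continuous_dilate[OF f(1), of "- 1"] by simp
    have "AE x in lborel. f (- 1 * x) = 1 / \<omega> * (if - 1 * x > 0 then of_real (weight d (- 1 * x)) * hankel d k1 (- 1 * x)
      else of_real (weight d (- (- 1 * x))) * hankel d k2 (- (- 1 * x)))"
      by (rule AE_lborel_scale[OF AE]) simp
    then show "AE x in lborel. x \<in> {0<..} \<longrightarrow> f (- x) = 1 / \<omega> * (of_real (weight d x) * hankel d k2 x)"
      by eventually_elim auto
  qed (use that in auto)
  have smooth: "smooth_with {0..} (\<lambda>_. True) (\<lambda>x. 1 / \<omega> * hankel d k x)" if "rapid_open k" for k
    by (rule smooth_with_mult_left[OF smooth_with_hankel[OF that]]) simp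
  \<comment> \<open>Smoothness off 0 and decay come from \<open>SF_smooth_with\<close>, smoothness
    up to 0 from the two transforms.\<close>
  have "f \<in> kirillov_space d"
    unfolding kirillov_space_iff_weight
    using SF_smooth_with[OF f(1)] smooth[OF k(1)] smooth[OF k(2)]
    by (intro conjI exI[of _ "\<lambda>x. 1 / \<omega> * hankel d k1 x"] exI[of _ "\<lambda>x. 1 / \<omega> * hankel d k2 x"])
      (auto simp: f1 f2 weight_def)
  then show "v \<in> KV" using f(2) unfolding KV_def by blast
qed

end

theorem theorem8p3:
  fixes d :: nat and s1 s2 :: complex and m1 m2 \<epsilon> :: int
    and R :: "real^2^2 \<Rightarrow> l2 \<Rightarrow> l2"
  assumes "d > 0"
    and "m1 \<in> {0, 1}" and "m2 \<in> {0, 1}"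
    and "\<forall>t::real. t \<noteq> 0 \<longrightarrow> quasichar (s1 - s2) (m1 - m2) t = of_real (t ^ d * sgn t)"
    and "\<epsilon> = m2 + int d + 1 \<or> \<epsilon> = int d + 1"
    and "kirillov_rep d s1 s2 m1 m2 \<epsilon> R"
  shows "smooth_vectors R = {v. \<exists>f \<in> kirillov_space d. represents f v}"
proof -
  interpret kirillov d s1 s2 m1 m2 \<epsilon> R
    using assms by unfold_locales
  show ?thesis
    using SV_KV KV_smooth unfolding KV_def by blast
qed

end
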